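(* Let $$F^V_{g,n}(\mathbf t)=\int_{\mathbb R_+^n}V_{g,n}(\mathbf b)e^{-\mathbf b\cdot\mathbf t}\,d\mathbf b$$ be the Laplace transform of the Weil–Petersson volume $V_{g,n}$. Let $g\ge0$, $n\ge1$ with $2g-2+n\ge2$, and $\mathbf t=(t_1,\dots,t_{n-1})$. (1) The recursion (M) for the volumes (see context) implies the recursion $$\text{(A)}\quad -t\frac{\partial}{\partial t}F^V_{g,n}(t,\mathbf t)=\mathsf P_t\!\left(\pi\csc(2\pi t)\left.\frac{\partial^2}{\partial t\,\partial t'}F^V_{g-1,n+1}(t,t',\mathbf t)\right|_{t'=t}\right)+\sum_{\substack{g_1+g_2=g\\ \mathbf t_1\sqcup\mathbf t_2=\mathbf t}}\mathsf P_t\!\left(\pi\csc(2\pi t)\frac{\partial F^V_{g_1,n_1}}{\partial t}(t,\mathbf t_1)\,\frac{\partial F^V_{g_2,n_2}}{\partial t}(t,\mathbf t_2)\right)+\sum_{j=1}^{n-1}\mathsf P_t\!\left(\frac{2\pi t_j\csc(2\pi t)}{t^2-t_j^2}\frac{\partial}{\partial t}F^V_{g,n-1}(t,\mathbf t\setminus t_j)\right).$$ (2) The recursion (N) for the volumes (see context) implies the recursion $$\text{(B)}\quad -\mathsf P_t\!\left(\frac{\sin 2\pi t}{2\pi}\frac{\partial}{\partial t}F^V_{g,n}(t,\mathbf t)\right)=\frac1{2t}\left.\frac{\partial^2}{\partial t\,\partial t'}F^V_{g-1,n+1}(t,t',\mathbf t)\right|_{t'=t}+\sum_{\substack{g_1+g_2=g\\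 \mathbf t_1\sqcup\mathbf t_2=\mathbf t}}\frac1{2t}\frac{\partial F^V_{g_1,n_1}}{\partial t}(t,\mathbf t_1)\,\frac{\partial F^V_{g_2,n_2}}{\partial t}(t,\mathbf t_2)+\sum_{j=1}^{n-1}\frac1{t^2-t_j^2}\left(\frac{t_j}{t}\frac{\partial}{\partial t}F^V_{g,n-1}(t,\mathbf t\setminus t_j)-\frac t{t_j}\frac{\partial}{\partial t_j}F^V_{g,n-1}(\mathbf t)\right).$$ Moreover, (A) and (B) are equivalent (as relations among symmetric functions $F_{g,n}$ that are polynomials in $t_1^{-1},\dots,t_n^{-1}$, odd in each $t_i^{-1}$).
   Context: For $g\ge0$, $n\ge1$, $2g-2+n\ge1$, $V_{g,n}(b_1,\dots,b_n)$ is the Weil–Petersson volume of the moduli space of hyperbolic surfaces of genus $g$ with $n$ labelled geodesic boundary components of lengths $b_1,\dots,b_n$ (with $V_{1,1}$ taken as half of the volume); it is a symmetric polynomial, even in each variable, with $V_{0,3}=1$, $V_{1,1}(b)=\frac1{48}(b^2+4\pi^2)$. For $2g-2+n\ge2$ the volumes satisfy Mirzakhani's recursion (M): $$\frac{\partial}{\partial b}\big(bV_{g,n}(b,\mathbf b)\big)=\frac12\int_0^\infty\!\!\int_0^\infty b'b''V_{g-1,n+1}(b',b'',\mathbf b)H(b'+b'',b)\,db'db''+\frac12\sum_{\substack{g_1+g_2=g\\ \mathbf b_1\sqcup\mathbf b_2=\mathbf b}}\int_0^\infty\!\!\int_0^\infty b'b''V_{g_1,n_1}(b',\mathbf b_1)V_{g_2,n_2}(b'',\mathbf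 b_2)H(b'+b'',b)\,db'db''+\frac12\sum_{j=1}^{n-1}\int_0^\infty b'V_{g,n-1}(b',\mathbf b\setminus b_j)\big(H(b',b+b_j)+H(b',b-b_j)\big)db',$$ $H(x,y)=(1+e^{(x+y)/2})^{-1}+(1+e^{(x-y)/2})^{-1}$; and the recursion (N): $$\frac{1}{4\pi i}\Big((b+2\pi i)V_{g,n}(b+2\pi i,\mathbf b)-(b-2\pi i)V_{g,n}(b-2\pi i,\mathbf b)\Big)=\frac12\iint_{b',b''\ge 0,\ b'+b''\le b} b'b''V_{g-1,n+1}(b',b'',\mathbf b)\,db'db''+\frac12\sum_{\substack{g_1+g_2=g\\ \mathbf b_1\sqcup\mathbf b_2=\mathbf b}}\iint_{b',b''\ge 0,\ b'+b''\le b} b'b''V_{g_1,n_1}(b',\mathbf b_1)V_{g_2,n_2}(b'',\mathbf b_2)\,db'db''+\frac12\sum_{j=1}^{n-1}\Big(\int_0^{b+b_j}+\int_0^{b-b_j}\Big)b'V_{g,n-1}(b',\mathbf b\setminus b_j)\,db'.$$ Conventions: $\mathbf b=(b_1,\dots,b_{n-1})$; $\mathbf b\setminus b_j$ (resp. $\mathbf t\setminus t_j$) means the entry is removed; sums over $g_1+g_2=g$ and $\mathbf b_1\sqcup\mathbf b_2=\mathbf b$ (resp. $\mathbf t_1\sqcup\mathbf t_2=\mathbf t$) run over ordered pairs of nonnegative integers and ordered set partitions, $n_i=|\mathbf b_i|+1$ (resp. $|\mathbf t_i|+1$); terms involving $(g',n')$ with $g'<0$ or $2g'-2+n'\le0$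 are zero. The Laplace integrals converge for $\mathrm{Re}\,t_i>0$ and are identified with the resulting polynomials in $t_i^{-1}$. $\mathsf P_t$ denotes the principal part (the negative powers of $t$) of the Laurent expansion at $t=0$, with the $t_j\neq0$ fixed. *)

theory Defs
  imports "HOL-Analysis.Analysis" "HOL-Complex_Analysis.Complex_Analysis"
begin

text \<open>
  A family \<open>F\<^sub>g\<^sub>,\<^sub>n(x\<^sub>1, \<dots>, x\<^sub>n)\<close> is represented by a function
  \<open>F :: nat \<Rightarrow> complex list \<Rightarrow> complex\<close>: the first argument is \<open>g\<close>, and \<open>n\<close> is the
  length of the list of arguments.  Volumes are polynomial functions of complex variables that are
  real on real arguments; the recursion for the volumes with shifts by \<open>2 \<pi> i\<close> needs their
  values at complex arguments.
\<close>

type_synonym family = "nat \<Rightarrow> complex list \<Rightarrow> complex"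

text \<open>Terms with \<open>g < 0\<close> or \<open>2 g - 2 + n \<le> 0\<close> in the recursions are zero.\<close>

definition stab :: "family \<Rightarrow> int \<Rightarrow> complex list \<Rightarrow> complex" where
  "stab F g xs =
     (if 0 \<le> g \<and> 0 < 2 * g - 2 + int (length xs) then F (nat g) xs else 0)"

definition poly_fun :: "nat \<Rightarrow> (complex list \<Rightarrow> complex) \<Rightarrow> bool" where
  "poly_fun n f \<longleftrightarrow>
     (\<exists>(S :: (nat \<Rightarrow> nat) set) c. finite S \<and>
        (\<forall>xs. length xs = n \<longrightarrow> f xs = (\<Sum>e\<in>S. c e * (\<Prod>i<n. (xs ! i) ^ e i))))"

definition inv_poly_fun :: "nat \<Rightarrow> (complex list \<Rightarrow> complex) \<Rightarrow> bool" where
  "inv_poly_fun n f \<longleftrightarrow>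
     (\<exists>p. poly_fun n p \<and>
        (\<forall>ts. length ts = n \<and> 0 \<notin> set ts \<longrightarrow> f ts = p (map inverse ts)))"

text \<open>
  Moduli spaces and their Weil--Petersson volumes are not available in the libraries.  The following
  collects the properties of the volumes that accompany the recursions: real symmetric polynomials,
  even in each variable, with the two initial values (\<open>V\<^sub>1\<^sub>,\<^sub>1\<close> is half of the volume).
  Together with \<open>recursion_M\<close> below for all \<open>n \<ge> 1\<close>, \<open>2 g - 2 + n \<ge> 2\<close>, these properties determine the volumes.
\<close>

definition volume_family :: "family \<Rightarrow> bool" where
  "volume_family V \<longleftrightarrow>
     (\<forall>g n. 1 \<le> n \<and> 1 \<le> 2 * int g - 2 + int n \<longrightarrow>
        poly_fun n (V g) \<and>
        (\<forall>bs. length bs = n \<and> set bs \<subseteq> \<real> \<longrightarrow> V g bs \<in> \<real>) \<and>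
        (\<forall>bs cs. length bs = n \<and> mset bs = mset cs \<longrightarrow> V g bs = V g cs) \<and>
        (\<forall>bs i. length bs = n \<and> i < n \<longrightarrow> V g (bs[i := - (bs ! i)]) = V g bs)) \<and>
     (\<forall>bs. length bs = 3 \<longrightarrow> V 0 bs = 1) \<and>
     (\<forall>b. V 1 [b] = (b\<^sup>2 + 4 * of_real pi ^ 2) / 48)"

definition odd_inv_poly_family :: "family \<Rightarrow> bool" where
  "odd_inv_poly_family F \<longleftrightarrow>
     (\<forall>g n. 1 \<le> n \<and> 1 \<le> 2 * int g - 2 + int n \<longrightarrow>
        inv_poly_fun n (F g) \<and>
        (\<forall>ts us. length ts = n \<and> 0 \<notin> set ts \<and> mset ts = mset us \<longrightarrow> F g ts = F g us) \<and>
        (\<forall>ts i. length ts = n \<and> 0 \<notin> set ts \<and> i < n \<longrightarrow>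
            F g (ts[i := - (ts ! i)]) = - F g ts))"

definition partitions :: "nat \<Rightarrow> (nat set \<times> nat set) set" where
  "partitions m = {(I, J). I \<union> J = {..<m} \<and> I \<inter> J = {}}"

definition remove_at :: "nat \<Rightarrow> 'a list \<Rightarrow> 'a list" where
  "remove_at j xs = nths xs (- {j})"

definition H :: "real \<Rightarrow> real \<Rightarrow> real" where
  "H x y = 1 / (1 + exp ((x + y) / 2)) + 1 / (1 + exp ((x - y) / 2))"

definition recursion_M :: "family \<Rightarrow> nat \<Rightarrow> nat \<Rightarrow> bool" where
  "recursion_M V g n \<longleftrightarrow>
    (\<forall>(b::real) (rs::real list). 0 < b \<and> (\<forall>r\<in>set rs. 0 < r) \<and> length rs + 1 = n \<longrightarrow>
      (let bs = map complex_of_real rs in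
       deriv (\<lambda>z. z * V g (z # bs)) (of_real b) =
         1/2 * (LINT (x, y):{0..} \<times> {0..}|lborel.
           of_real (x * y * H (x + y) b) *
           stab V (int g - 1) (of_real x # of_real y # bs))
       + 1/2 * (\<Sum>(g1, g2)\<in>{(g1, g2). g1 + g2 = g}. \<Sum>(I, J)\<in>partitions (n - 1).
           LINT (x, y):{0..} \<times> {0..}|lborel.
             of_real (x * y * H (x + y) b) *
             stab V (int g1) (of_real x # nths bs I) *
             stab V (int g2) (of_real y # nths bs J))
       + 1/2 * (\<Sum>j<n - 1. LINT x:{0..}|lborel.
           of_real (x * (H x (b + rs ! j) + H x (b - rs ! j))) *
           stab V (int g) (of_real x # remove_at j bs))))"

text \<open>
  The interval integral \<open>LBINT x=0..c\<close> is oriented, so it is minus the integral over \<open>[c, 0]\<close>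
  for \<open>c < 0\<close>.
\<close>

definition recursion_N :: "family \<Rightarrow> nat \<Rightarrow> nat \<Rightarrow> bool" where
  "recursion_N V g n \<longleftrightarrow>
    (\<forall>(b::real) (rs::real list). 0 < b \<and> (\<forall>r\<in>set rs. 0 < r) \<and> length rs + 1 = n \<longrightarrow>
      (let bs = map complex_of_real rs; w = 2 * of_real pi * \<i>;
           T = {(x, y). 0 \<le> x \<and> 0 \<le> y \<and> x + y \<le> b} in
       1 / (4 * of_real pi * \<i>) *
         ((of_real b + w) * V g ((of_real b + w) # bs)
          - (of_real b - w) * V g ((of_real b - w) # bs)) =
         1/2 * (LINT (x, y):T|lborel.
           of_real (x * y) * stab V (int g - 1) (of_real x # of_real y # bs))
       + 1/2 * (\<Sum>(g1, g2)\<in>{(g1, g2). g1 + g2 = g}. \<Sum>(I, J)\<in>partitions (n - 1).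
           LINT (x, y):T|lborel.
             of_real (x * y) *
             stab V (int g1) (of_real x # nths bs I) *
             stab V (int g2) (of_real y # nths bs J))
       + 1/2 * (\<Sum>j<n - 1.
           (LBINT x=0..ereal (b + rs ! j).
              of_real x * stab V (int g) (of_real x # remove_at j bs))
         + (LBINT x=0..ereal (b - rs ! j).
              of_real x * stab V (int g) (of_real x # remove_at j bs)))))"

definition laplace_integral :: "(complex list \<Rightarrow> complex) \<Rightarrow> complex list \<Rightarrow> complex" where
  "laplace_integral f ts =
     (let n = length ts in
      LINT b:({..<n} \<rightarrow>\<^sub>E {0..})|(\<Pi>\<^sub>M i\<in>{..<n}. (lborel :: real measure)).
        f (map (\<lambda>i. of_real (b i)) [0..<n]) * exp (- (\<Sum>i<n. of_real (b i) * ts ! i)))"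

text \<open>
  The value at \<open>ts\<close> of the polynomial in the inverse variables that agrees with the Laplace
  integral where all real parts are positive.  This value is unique if no entry of \<open>ts\<close> is zero.
\<close>

definition laplace_transform :: "family \<Rightarrow> family" where
  "laplace_transform V g ts =
     (THE z. \<exists>f. inv_poly_fun (length ts) f \<and>
        (\<forall>s. length s = length ts \<and> (\<forall>x\<in>set s. 0 < Re x) \<longrightarrow>
               f s = laplace_integral (V g) s) \<and>
        z = f ts)"

text \<open>The coefficient of \<open>X ^ k\<close> in \<^term>\<open>fls_prpart L\<close> is the coefficient of index \<open>- k\<close> in \<open>L\<close>.\<close>

definition principal_part :: "(complex \<Rightarrow> complex) \<Rightarrow> complex \<Rightarrow> complex" where
  "principal_part f t = poly (fls_prpart (laurent_expansion f 0)) (inverse t)"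

definition csc :: "complex \<Rightarrow> complex" where
  "csc z = inverse (sin z)"

definition mixed_deriv :: "(complex \<Rightarrow> complex \<Rightarrow> complex) \<Rightarrow> complex \<Rightarrow> complex \<Rightarrow> complex" where
  "mixed_deriv f t t' = deriv (\<lambda>x. deriv (\<lambda>y. f x y) t') t"

definition recursion_A :: "family \<Rightarrow> nat \<Rightarrow> nat \<Rightarrow> bool" where
  "recursion_A F g n \<longleftrightarrow>
    (\<forall>t ts. t \<noteq> 0 \<and> 0 \<notin> set ts \<and> length ts + 1 = n \<longrightarrow>
       - t * deriv (\<lambda>x. F g (x # ts)) t =
         principal_part (\<lambda>s. of_real pi * csc (2 * of_real pi * s) *
           mixed_deriv (\<lambda>x y. stab F (int g - 1) (x # y # ts)) s s) t
       + (\<Sum>(g1, g2)\<in>{(g1, g2). g1 + g2 = g}. \<Sum>(I, J)\<in>partitions (n - 1).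
           principal_part (\<lambda>s. of_real pi * csc (2 * of_real pi * s) *
             deriv (\<lambda>x. stab F (int g1) (x # nths ts I)) s *
             deriv (\<lambda>x. stab F (int g2) (x # nths ts J)) s) t)
       + (\<Sum>j<n - 1.
           principal_part (\<lambda>s. 2 * of_real pi * ts ! j * csc (2 * of_real pi * s)
                               / (s\<^sup>2 - (ts ! j)\<^sup>2) *
             deriv (\<lambda>x. stab F (int g) (x # remove_at j ts)) s) t))"

text \<open>
  The last sum on the right-hand side has removable singularities at \<open>t\<^sup>2 = t\<^sub>j\<^sup>2\<close>; as
  division by zero is zero here, these points are excluded.
\<close>

definition recursion_B :: "family \<Rightarrow> nat \<Rightarrow> nat \<Rightarrow> bool" where
  "recursion_B F g n \<longleftrightarrow>
    (\<forall>t ts. t \<noteq> 0 \<and> 0 \<notin> set ts \<and> length ts + 1 = n \<and> (\<forall>u\<in>set ts. t\<^sup>2 \<noteq> u\<^sup>2) \<longrightarrow>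
       - principal_part (\<lambda>s. sin (2 * of_real pi * s) / (2 * of_real pi) *
             deriv (\<lambda>x. F g (x # ts)) s) t =
         1 / (2 * t) * mixed_deriv (\<lambda>x y. stab F (int g - 1) (x # y # ts)) t t
       + (\<Sum>(g1, g2)\<in>{(g1, g2). g1 + g2 = g}. \<Sum>(I, J)\<in>partitions (n - 1).
           1 / (2 * t) *
           deriv (\<lambda>x. stab F (int g1) (x # nths ts I)) t *
           deriv (\<lambda>x. stab F (int g2) (x # nths ts J)) t)
       + (\<Sum>j<n - 1.
           1 / (t\<^sup>2 - (ts ! j)\<^sup>2) *
           (ts ! j / t * deriv (\<lambda>x. stab F (int g) (x # remove_at j ts)) t
            - t / ts ! j * deriv (\<lambda>x. stab F (int g) (ts[j := x])) (ts ! j))))"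

end

theory Submission
  imports Defs "HOL-Probability.Distributions" "HOL-Combinatorics.Permutations"
begin

text \<open>
  (A) and (B): put \<open>u = 2\<pi>t / sin(2\<pi>t)\<close>, \<open>Y = - t \<partial>F/\<partial>t\<close>, and let \<open>R\<close> be the right-hand side of (B).
  Both \<open>Y\<close> and \<open>R\<close> are their own principal parts, and up to a term regular at \<open>t = 0\<close> the functions in the
  right-hand side of (A) add up to \<open>u R\<close>. So (A) says that \<open>Y - u R\<close> is regular and (B) says that
  \<open>Y / u - R\<close> is regular; as \<open>u\<close> is a unit at \<open>0\<close>, these are equivalent.

  (N) and (B): the Laplace transform acts on polynomials by \<open>b^k \<mapsto> k! / t^(k+1)\<close>. The shift quotient
  by \<open>2\<pi>i\<close> is \<open>sin(2\<pi>D) / (2\<pi>)\<close> with \<open>D = d/db\<close>, and \<open>D\<close> becomes multiplication by \<open>t\<close> followed by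
  the principal part; the integrals over the triangle and over intervals transform term by term.

  (M) and (N): for odd \<open>m\<close> the integral of \<open>x^m H(x, b)\<close> over the half-line is a polynomial in \<open>b\<close> whose
  coefficients are those of the power series of \<open>u\<close>, by a Beta integral. The shift quotient of its
  primitive is therefore \<open>b^(m+1) / (m+1)\<close>. Hence (M) implies (N), and so (B) and (A).
\<close>

subsection \<open>Principal parts of Laurent expansions\<close>

text \<open>The recursions for volumes hold at positive real lengths and involve integrals, whereas
  (A) and (B) are identities in complex variables. The bridge is the relation
  \<open>has_laplace\<close>, which reads a polynomial and its transform off one list of
  coefficients; pairs that agree at positive reals have equal transforms, so the recursions can be
  compared monomial by monomial. The series of \<open>u\<close> enters through the weight
  \<open>1 / (1 + exp (z / 2))\<close>, two translates of which make up the kernel \<open>H\<close>.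
  The reflection \<open>z -> - z\<close> turns the odd moments of \<open>H\<close> into polynomials
  in \<open>b\<close>. The half-line moments of the weight are never computed individually: their
  generating function comes from the integral of \<open>exp (t * x)\<close> against the weight over
  the whole line, which is \<open>2 * pi / sin (2 * pi * t)\<close> by the reflection formula for
  Gamma. The comparison of (M) with (N) uses only that the series of \<open>u\<close> and
  \<open>1 / u\<close> convolve to 1. From (M) to (N) a primitive in \<open>b\<close> must be
  chosen; its constant is fixed because \<open>b * V\<close> vanishes at \<open>b = 0\<close>. The
  term of (B) that disappears in (A) is the derivative with respect to \<open>t_j\<close>: with its
  factor it is regular at \<open>t = 0\<close>.\<close>

definition meromorphic_at_0 :: "(complex \<Rightarrow> complex) \<Rightarrow> bool" where
  "meromorphic_at_0 f \<longleftrightarrow> f has_laurent_expansion laurent_expansion f 0"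

lemma meromorphic_at_0I: "f has_laurent_expansion L \<Longrightarrow> meromorphic_at_0 f"
  unfolding meromorphic_at_0_def using laurent_expansion_0_eqI by simp

lemma principal_part_eqI:
  "f has_laurent_expansion L \<Longrightarrow> principal_part f t = poly (fls_prpart L) (inverse t)"
  unfolding principal_part_def using laurent_expansion_0_eqI by simp

lemma principal_part_cong:
  "eventually (\<lambda>s. f s = g s) (at 0) \<Longrightarrow> principal_part f t = principal_part g t"
  unfolding principal_part_def using laurent_expansion_cong[of f g 0 0] by simp

lemma fls_prpart_cmult: "fls_prpart (fls_const c * L) = smult c (fls_prpart L)"
  by (rule poly_eqI) simp

lemma fls_prpart_sum: "fls_prpart (sum L A) = (\<Sum>a\<in>A. fls_prpart (L a))"
  by (induction A rule: infinite_finite_induct) auto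

text \<open>\<open>laurent_expansion\<close> is a total function; \<open>meromorphic_at_0\<close>
  says that its value really expands the given function, so that expansions can be added.\<close>

lemma principal_part_sum:
  assumes "\<And>a. a \<in> A \<Longrightarrow> meromorphic_at_0 (f a)"
  shows "meromorphic_at_0 (\<lambda>s. \<Sum>a\<in>A. f a s)"
    and "principal_part (\<lambda>s. \<Sum>a\<in>A. f a s) t = (\<Sum>a\<in>A. principal_part (f a) t)"
proof -
  have *: "(\<lambda>s. \<Sum>a\<in>A. f a s) has_laurent_expansion (\<Sum>a\<in>A. laurent_expansion (f a) 0)"
    using assms by (intro has_laurent_expansion_sum) (auto simp: meromorphic_at_0_def)
  show "meromorphic_at_0 (\<lambda>s. \<Sum>a\<in>A. f a s)" by (rule meromorphic_at_0I[OF *])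
  show "principal_part (\<lambda>s. \<Sum>a\<in>A. f a s) t = (\<Sum>a\<in>A. principal_part (f a) t)"
    using principal_part_eqI[OF *] by (simp add: fls_prpart_sum poly_sum principal_part_def)
qed

lemma principal_part_add:
  assumes "meromorphic_at_0 f" "meromorphic_at_0 g"
  shows "meromorphic_at_0 (\<lambda>s. f s + g s)"
    and "principal_part (\<lambda>s. f s + g s) t = principal_part f t + principal_part g t"
proof -
  have *: "(\<lambda>s. f s + g s) has_laurent_expansion (laurent_expansion f 0 + laurent_expansion g 0)"
    using assms by (intro has_laurent_expansion_add) (auto simp: meromorphic_at_0_def)
  show "meromorphic_at_0 (\<lambda>s. f s + g s)" by (rule meromorphic_at_0I[OF *])
  show "principal_part (\<lambda>s. f s + g s) t = principal_part f t + principal_part g t"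
    using principal_part_eqI[OF *] by (simp add: principal_part_def)
qed

lemma meromorphic_at_0_mult:
  "meromorphic_at_0 f \<Longrightarrow> meromorphic_at_0 g \<Longrightarrow> meromorphic_at_0 (\<lambda>s. f s * g s)"
  unfolding meromorphic_at_0_def
  by (rule meromorphic_at_0I[unfolded meromorphic_at_0_def, OF has_laurent_expansion_mult])

lemma inverse_poly_eqI:
  fixes p q :: "complex poly"
  assumes "finite E" "\<And>t. t \<noteq> 0 \<Longrightarrow> t \<notin> E \<Longrightarrow> poly p (inverse t) = poly q (inverse t)"
  shows "p = q"
proof (rule ccontr)
  assume "p \<noteq> q"
  hence "finite {x. poly (p - q) x = 0}" by (intro poly_roots_finite) simp
  moreover have "UNIV - ({0} \<union> inverse ` E) \<subseteq> {x. poly (p - q) x = 0}"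
  proof
    fix x assume "x \<in> UNIV - ({0} \<union> inverse ` E)"
    hence "x \<noteq> 0" "inverse x \<notin> E" by (auto simp: image_iff dest: bspec[of E _ "inverse x"])
    thus "x \<in> {x. poly (p - q) x = 0}" using assms(2)[of "inverse x"] by simp
  qed
  ultimately have "finite (UNIV - ({0} \<union> inverse ` E))" by (rule finite_subset[rotated])
  moreover have "infinite (UNIV - ({0} \<union> inverse ` E))"
    using assms(1) by (intro Diff_infinite_finite infinite_UNIV_char_0) auto
  ultimately show False by simp
qed

text \<open>A principal part is a polynomial in \<open>1/t\<close>, hence determined off any finite
  set. So an identity over the points \<open>t\<close> becomes one between Laurent series, and the
  points left out in (B) cost nothing.\<close>

lemma principal_part_eq_iff:
  assumes "finite E"
  shows "(\<forall>t. t \<noteq> 0 \<and> t \<notin> E \<longrightarrow> principal_part f t = principal_part g t) \<longleftrightarrow>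
    fls_prpart (laurent_expansion f 0) = fls_prpart (laurent_expansion g 0)"
  using inverse_poly_eqI[OF assms] unfolding principal_part_def by metis

text \<open>The constant coefficient is 0 because a principal part contains only strictly negative
  powers. The set \<open>E\<close> collects points at which division by zero distorts the values,
  such as \<open>t^2 = t_j^2\<close> in (B).\<close>

definition purely_singular :: "complex set \<Rightarrow> (complex \<Rightarrow> complex) \<Rightarrow> bool" where
  "purely_singular E f \<longleftrightarrow>
     (\<exists>p. coeff p 0 = 0 \<and> (\<forall>t. t \<noteq> 0 \<and> t \<notin> E \<longrightarrow> f t = poly p (inverse t)))"

lemma purely_singular_sum:
  assumes "\<And>a. a \<in> A \<Longrightarrow> purely_singular E (f a)"
  shows "purely_singular E (\<lambda>t. \<Sum>a\<in>A. f a t)"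
proof -
  obtain p where "\<And>a. a \<in> A \<Longrightarrow> coeff (p a) 0 = 0 \<and>
      (\<forall>t. t \<noteq> 0 \<and> t \<notin> E \<longrightarrow> f a t = poly (p a) (inverse t))"
    using assms unfolding purely_singular_def by metis
  thus ?thesis unfolding purely_singular_def
    by (intro exI[of _ "\<Sum>a\<in>A. p a"]) (auto simp: coeff_sum poly_sum intro!: sum.cong)
qed

lemma purely_singular_add:
  assumes "purely_singular E f" "purely_singular E g"
  shows "purely_singular E (\<lambda>t. f t + g t)"
proof -
  obtain p q where "coeff p 0 = 0" "coeff q 0 = 0"
    "\<forall>t. t \<noteq> 0 \<and> t \<notin> E \<longrightarrow> f t = poly p (inverse t)"
    "\<forall>t. t \<noteq> 0 \<and> t \<notin> E \<longrightarrow> g t = poly q (inverse t)"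
    using assms unfolding purely_singular_def by auto
  thus ?thesis unfolding purely_singular_def by (intro exI[of _ "p + q"]) auto
qed

lemma purely_singular_mult:
  assumes "purely_singular E f" "purely_singular E g"
  shows "purely_singular E (\<lambda>t. f t * g t)"
proof -
  obtain p q where "coeff p 0 = 0" "coeff q 0 = 0"
    "\<forall>t. t \<noteq> 0 \<and> t \<notin> E \<longrightarrow> f t = poly p (inverse t)"
    "\<forall>t. t \<noteq> 0 \<and> t \<notin> E \<longrightarrow> g t = poly q (inverse t)"
    using assms unfolding purely_singular_def by auto
  thus ?thesis unfolding purely_singular_def by (intro exI[of _ "p * q"]) (auto simp: coeff_mult_0)
qed

lemma purely_singular_power:
  "purely_singular E f" if "\<And>t. t \<noteq> 0 \<Longrightarrow> t \<notin> E \<Longrightarrow> f t = c * inverse t ^ Suc k"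
  unfolding purely_singular_def
  by (intro exI[of _ "monom c (Suc k)"]) (use that in \<open>auto simp: poly_monom\<close>)

lemma purely_singular_cong:
  "purely_singular E f" if "purely_singular E g" "\<And>t. t \<noteq> 0 \<Longrightarrow> t \<notin> E \<Longrightarrow> f t = g t"
  using that unfolding purely_singular_def by metis

lemma eventually_at_0_avoid:
  "finite E \<Longrightarrow> 0 \<notin> E \<Longrightarrow> eventually (\<lambda>s. s \<noteq> 0 \<and> s \<notin> E) (at (0::complex))"
proof -
  assume "finite E" "0 \<notin> E"
  hence "eventually (\<lambda>s. s \<in> - E) (nhds 0)"
    by (intro eventually_nhds_in_open) (auto simp: finite_imp_closed)
  thus ?thesis by (auto simp: eventually_at_filter elim: eventually_mono)
qed

lemma purely_singular_principal_part:
  assumes "purely_singular E f" "finite E" "0 \<notin> E"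
  shows "meromorphic_at_0 f" and "t \<noteq> 0 \<Longrightarrow> t \<notin> E \<Longrightarrow> principal_part f t = f t"
proof -
  obtain p where p: "coeff p 0 = 0" "\<forall>t. t \<noteq> 0 \<and> t \<notin> E \<longrightarrow> f t = poly p (inverse t)"
    using assms(1) unfolding purely_singular_def by auto
  define L where "L = (\<Sum>k\<le>degree p. fls_const (coeff p k) * fls_X_inv ^ k)"
  have "(\<lambda>t. \<Sum>k\<le>degree p. coeff p k * inverse t ^ k) has_laurent_expansion L"
    unfolding L_def by (intro laurent_expansion_intros)
  moreover have "eventually (\<lambda>t. (\<Sum>k\<le>degree p. coeff p k * inverse t ^ k) = f t) (at 0)"
    by (rule eventually_mono[OF eventually_at_0_avoid[OF assms(2,3)]])
       (use p in \<open>auto simp: poly_altdef\<close>)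
  ultimately have L: "f has_laurent_expansion L"
    by (subst (asm) has_laurent_expansion_cong[OF _ refl])
  have "fls_prpart L = p"
  proof (rule poly_eqI)
    fix n
    have "fls_nth L (- int n) = coeff p n"
      unfolding L_def by (auto simp: fls_nth_sum if_distrib[of "(*) _"] sum.delta coeff_eq_0 cong: if_cong)
    thus "coeff (fls_prpart L) n = coeff p n" using p(1) by auto
  qed
  thus "meromorphic_at_0 f" "t \<noteq> 0 \<Longrightarrow> t \<notin> E \<Longrightarrow> principal_part f t = f t"
    using L p(2) meromorphic_at_0I principal_part_eqI by auto
qed

text \<open>A vanishing principal part means nonnegative order, and orders add under
  multiplication.\<close>

lemma fls_prpart_mult_eq_0:
  fixes L M :: "complex fls"
  assumes "fls_prpart L = 0" "fls_prpart M = 0"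
  shows "fls_prpart (L * M) = 0"
proof (cases "L * M = 0")
  case False
  thus ?thesis using assms by (simp add: fls_prpart_eq0_iff)
qed auto

text \<open>Both sides say that a difference is regular: \<open>Y - U * R\<close> on the left,
  \<open>V * Y - R\<close> on the right. Multiplication by \<open>V\<close> leads from the first to
  the second, multiplication by \<open>U\<close> leads back, and neither creates a pole.\<close>

lemma fls_prpart_unit_iff:
  fixes U V Y R :: "complex fls"
  assumes "fls_prpart U = 0" "fls_prpart V = 0" "U * V = 1"
  shows "fls_prpart Y = fls_prpart (U * R) \<longleftrightarrow> fls_prpart (V * Y) = fls_prpart R"
proof -
  have "fls_prpart Y = fls_prpart (U * R) \<longleftrightarrow> fls_prpart (Y - U * R) = 0" by simp
  also have "\<dots> \<longleftrightarrow> fls_prpart (V * Y - R) = 0"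
  proof
    assume "fls_prpart (Y - U * R) = 0"
    hence "fls_prpart (V * (Y - U * R)) = 0" by (rule fls_prpart_mult_eq_0[OF assms(2)])
    also have "V * (Y - U * R) = V * Y - (U * V) * R" by (simp add: algebra_simps)
    finally show "fls_prpart (V * Y - R) = 0" using assms(3) by simp
  next
    assume "fls_prpart (V * Y - R) = 0"
    hence "fls_prpart (U * (V * Y - R)) = 0" by (rule fls_prpart_mult_eq_0[OF assms(1)])
    also have "U * (V * Y - R) = (U * V) * Y - U * R" by (simp add: algebra_simps)
    finally show "fls_prpart (Y - U * R) = 0" using assms(3) by simp
  qed
  finally show ?thesis by simp
qed

text \<open>The function \<open>1 / u\<close> of the overview. Its value at 0 is 0 here, by division
  by zero, instead of 1; Laurent expansions do not see that point.\<close>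

definition sin_quot :: "complex \<Rightarrow> complex" where
  "sin_quot s = sin (2 * of_real pi * s) / (2 * of_real pi * s)"

text \<open>The sine has a simple zero at 0, so dividing its series by \<open>c * X\<close> leaves a
  series of order 0; such a series and its inverse are both regular.\<close>

lemma sin_quot_laurent:
  obtains U V where "sin_quot has_laurent_expansion V"
    "(\<lambda>s. inverse (sin_quot s)) has_laurent_expansion U"
    "fls_prpart U = 0" "fls_prpart V = 0" "U * V = 1"
proof -
  define c :: complex where "c = 2 * of_real pi"
  have c: "c \<noteq> 0" by (simp add: c_def)
  define W where "W = fps_to_fls (fps_sin c)"
  have "subdegree (fps_sin c) = 1"
    by (rule subdegreeI) (auto simp: c fps_sin_def)
  hence sW: "fls_subdegree W = 1" unfolding W_def by (simp add: fls_subdegree_fls_to_fps)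
  hence W0: "W \<noteq> 0" by auto
  define V where "V = W / (fls_const c * fls_X)"
  have X0: "fls_const c * fls_X \<noteq> 0" using c by (simp add: fls_const_nonzero)
  have V0: "V \<noteq> 0" using W0 X0 by (simp add: V_def)
  have "fls_subdegree V = fls_subdegree W - fls_subdegree (fls_const c * fls_X)"
    unfolding V_def by (rule fls_divide_subdegree[OF W0 X0])
  also have "fls_subdegree (fls_const c * fls_X) = 1"
    using c by (subst fls_subdegree_mult) (auto simp: fls_const_nonzero)
  finally have sV: "fls_subdegree V = 0" using sW by simp
  have "sin_quot has_laurent_expansion V"
    unfolding V_def W_def sin_quot_def c_def by (intro laurent_expansion_intros)
  moreover have "(\<lambda>s. inverse (sin_quot s)) has_laurent_expansion inverse V"
    by (intro laurent_expansion_intros calculation)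
  moreover have "fls_prpart (inverse V) = 0" "fls_prpart V = 0"
    by (simp_all add: fls_prpart_eq0_iff sV)
  ultimately show ?thesis using that V0 by simp
qed

subsection \<open>Functions that are polynomial in the inverse variables\<close>

lemma has_field_derivative_inverse_sum:
  assumes "finite S" "\<And>x. x \<noteq> 0 \<Longrightarrow> f x = (\<Sum>e\<in>S. c e * inverse x ^ k e)" "s \<noteq> (0::complex)"
  shows "(f has_field_derivative (\<Sum>e\<in>S. - (c e * of_nat (k e) * inverse s ^ Suc (k e)))) (at s)"
proof -
  have "((\<lambda>x. \<Sum>e\<in>S. c e * inverse x ^ k e) has_field_derivative
     (\<Sum>e\<in>S. - (c e * of_nat (k e) * inverse s ^ Suc (k e)))) (at s)"
  proof (rule DERIV_sum)
    fix e assume "e \<in> S"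
    show "((\<lambda>x. c e * inverse x ^ k e) has_field_derivative
        - (c e * of_nat (k e) * inverse s ^ Suc (k e))) (at s)"
      using DERIV_cmult[OF DERIV_power[OF DERIV_inverse[OF assms(3)], of "k e"], of "c e"]
      by (cases "k e") (simp_all add: mult_ac)
  qed
  moreover have "eventually (\<lambda>x. f x = (\<Sum>e\<in>S. c e * inverse x ^ k e)) (nhds s)"
    using t1_space_nhds[OF assms(3)] by (rule eventually_mono) (use assms(2) in auto)
  ultimately show ?thesis by (subst DERIV_cong_ev[OF refl _ refl])
qed

lemmas deriv_inverse_sum = DERIV_imp_deriv[OF has_field_derivative_inverse_sum]

text \<open>Differentiation raises every exponent of \<open>1/x\<close> by one and kills constants,
  so no constant term survives even if \<open>f\<close> has one.\<close>

lemma purely_singular_deriv: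
  assumes "finite S" "\<And>x. x \<noteq> 0 \<Longrightarrow> f x = (\<Sum>e\<in>S. c e * inverse x ^ k e)"
  shows "purely_singular E (deriv f)"
  by (rule purely_singular_cong[OF purely_singular_sum[of S E "\<lambda>e s. - (c e * of_nat (k e) * inverse s ^ Suc (k e))"]])
     (auto simp: deriv_inverse_sum[OF assms] mult_ac intro!: purely_singular_power[of _ _ "- (c e * of_nat (k e))" "k e" for e])

lemma mixed_deriv_inverse_sum:
  assumes "finite S" "s \<noteq> 0" "s' \<noteq> 0"
    "\<And>x y. x \<noteq> 0 \<Longrightarrow> y \<noteq> 0 \<Longrightarrow> f x y = (\<Sum>e\<in>S. c e * inverse x ^ k e * inverse y ^ l e)"
  shows "mixed_deriv f s s' =
    (\<Sum>e\<in>S. c e * of_nat (k e) * of_nat (l e) * inverse s ^ Suc (k e) * inverse s' ^ Suc (l e))"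
proof -
  have "deriv (f x) s' = (\<Sum>e\<in>S. (- (c e * of_nat (l e) * inverse s' ^ Suc (l e))) * inverse x ^ k e)"
    if "x \<noteq> 0" for x
    by (subst deriv_inverse_sum[of S _ "\<lambda>e. c e * inverse x ^ k e" l])
       (use assms that in \<open>auto simp: mult_ac intro!: sum.cong\<close>)
  from deriv_inverse_sum[OF assms(1) this assms(2)] show ?thesis
    unfolding mixed_deriv_def by (simp add: mult_ac)
qed

lemma purely_singular_mixed_deriv:
  assumes "finite S"
    "\<And>x y. x \<noteq> 0 \<Longrightarrow> y \<noteq> 0 \<Longrightarrow> f x y = (\<Sum>e\<in>S. c e * inverse x ^ k e * inverse y ^ l e)"
  shows "purely_singular E (\<lambda>s. mixed_deriv f s s)"
  by (rule purely_singular_cong[OF purely_singular_sum[of S E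
       "\<lambda>e s. (c e * of_nat (k e) * of_nat (l e)) * inverse s ^ Suc (k e + Suc (l e))"]])
     (auto simp: mixed_deriv_inverse_sum[OF assms(1) _ _ assms(2)] power_add mult_ac
        intro!: purely_singular_power[of _ _ "c e * of_nat (k e) * of_nat (l e)" "k e + Suc (l e)" for e])

lemma inv_poly_funE:
  assumes "inv_poly_fun n f"
  obtains S :: "(nat \<Rightarrow> nat) set" and c where "finite S"
    "\<And>ts. length ts = n \<Longrightarrow> 0 \<notin> set ts \<Longrightarrow> f ts = (\<Sum>e\<in>S. c e * (\<Prod>i<n. inverse (ts ! i) ^ e i))"
proof -
  obtain p where p: "poly_fun n p"
    "\<And>us. length us = n \<Longrightarrow> 0 \<notin> set us \<Longrightarrow> f us = p (map inverse us)"
    using assms unfolding inv_poly_fun_def by auto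
  obtain S :: "(nat \<Rightarrow> nat) set" and c where "finite S"
    "\<And>xs. length xs = n \<Longrightarrow> p xs = (\<Sum>e\<in>S. c e * (\<Prod>i<n. (xs ! i) ^ e i))"
    using p(1) unfolding poly_fun_def by auto
  thus ?thesis by (intro that[of S c]) (auto simp: p(2))
qed

text \<open>Fixing the remaining variables absorbs their powers into the coefficients. The index set
  is still a set of exponent functions, so several summands may carry the same power of
  \<open>x\<close>.\<close>

lemma inv_poly_fun_Cons:
  assumes "inv_poly_fun (Suc m) f" "length ts = m" "0 \<notin> set ts"
  obtains S :: "(nat \<Rightarrow> nat) set" and c where "finite S"
    "\<And>x. x \<noteq> 0 \<Longrightarrow> f (x # ts) = (\<Sum>e\<in>S. c e * inverse x ^ e 0)"
proof (rule inv_poly_funE[OF assms(1)])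
  fix S :: "(nat \<Rightarrow> nat) set" and c assume "finite S"
    "\<And>ts. length ts = Suc m \<Longrightarrow> 0 \<notin> set ts \<Longrightarrow> f ts = (\<Sum>e\<in>S. c e * (\<Prod>i<Suc m. inverse (ts ! i) ^ e i))"
  thus thesis
    by (intro that[of S "\<lambda>e. c e * (\<Prod>i<m. inverse (ts ! i) ^ e (Suc i))"])
       (use assms in \<open>simp_all add: prod.lessThan_Suc_shift mult_ac del: prod.lessThan_Suc\<close>)
qed

lemma inv_poly_fun_Cons2:
  assumes "inv_poly_fun (Suc (Suc m)) f" "length ts = m" "0 \<notin> set ts"
  obtains S :: "(nat \<Rightarrow> nat) set" and c where "finite S"
    "\<And>x y. x \<noteq> 0 \<Longrightarrow> y \<noteq> 0 \<Longrightarrow> f (x # y # ts) = (\<Sum>e\<in>S. c e * inverse x ^ e 0 * inverse y ^ e 1)"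
proof (rule inv_poly_funE[OF assms(1)])
  fix S :: "(nat \<Rightarrow> nat) set" and c assume "finite S" "\<And>ts. length ts = Suc (Suc m) \<Longrightarrow> 0 \<notin> set ts \<Longrightarrow>
      f ts = (\<Sum>e\<in>S. c e * (\<Prod>i<Suc (Suc m). inverse (ts ! i) ^ e i))"
  thus thesis
    by (intro that[of S "\<lambda>e. c e * (\<Prod>i<m. inverse (ts ! i) ^ e (Suc (Suc i)))"])
       (use assms in \<open>simp_all add: prod.lessThan_Suc_shift mult_ac del: prod.lessThan_Suc\<close>)
qed

lemma inv_poly_fun_0: "inv_poly_fun n (\<lambda>_. 0)"
  unfolding inv_poly_fun_def poly_fun_def
  by (intro exI[of _ "\<lambda>_. 0"] conjI exI[of _ "{}"]) auto

lemma odd_inv_poly_familyD: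
  assumes "odd_inv_poly_family F" "1 \<le> n" "1 \<le> 2 * int g - 2 + int n"
  shows "inv_poly_fun n (F g)"
    and "\<forall>ts us. length ts = n \<and> 0 \<notin> set ts \<and> mset ts = mset us \<longrightarrow> F g ts = F g us"
    and "\<forall>ts i. length ts = n \<and> 0 \<notin> set ts \<and> i < n \<longrightarrow> F g (ts[i := - (ts ! i)]) = - F g ts"
  using assms unfolding odd_inv_poly_family_def by blast+

lemma stab_odd_inv_poly:
  assumes "odd_inv_poly_family F" "1 \<le> n"
  shows "inv_poly_fun n (stab F g)"
    and "length ts = n \<Longrightarrow> 0 \<notin> set ts \<Longrightarrow> mset ts = mset us \<Longrightarrow> stab F g ts = stab F g us"
    and "length ts = n \<Longrightarrow> 0 \<notin> set ts \<Longrightarrow> i < n \<Longrightarrow> stab F g (ts[i := - (ts ! i)]) = - stab F g ts"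
proof -
  show "inv_poly_fun n (stab F g)"
  proof (cases "0 \<le> g \<and> 0 < 2 * g - 2 + int n")
    case True
    hence "inv_poly_fun n (F (nat g))" using assms unfolding odd_inv_poly_family_def by auto
    thus ?thesis using True unfolding inv_poly_fun_def stab_def by simp
  next
    case False
    thus ?thesis using inv_poly_fun_0[of n] unfolding inv_poly_fun_def stab_def by auto
  qed
  show "stab F g ts = stab F g us" if "length ts = n" "0 \<notin> set ts" "mset ts = mset us"
  proof (cases "0 \<le> g \<and> 0 < 2 * g - 2 + int n")
    case True
    hence "F (nat g) ts = F (nat g) us"
      using odd_inv_poly_familyD(2)[OF assms, of "nat g"] that by auto
    thus ?thesis using that mset_eq_length[OF that(3)] unfolding stab_def by simp
  qed (use that mset_eq_length[OF that(3)] in \<open>auto simp: stab_def\<close>)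
  show "stab F g (ts[i := - (ts ! i)]) = - stab F g ts" if "length ts = n" "0 \<notin> set ts" "i < n"
  proof (cases "0 \<le> g \<and> 0 < 2 * g - 2 + int n")
    case True
    hence "F (nat g) (ts[i := - (ts ! i)]) = - F (nat g) ts"
      using odd_inv_poly_familyD(3)[OF assms, of "nat g"] that by auto
    thus ?thesis using that unfolding stab_def by simp
  qed (use that in \<open>auto simp: stab_def\<close>)
qed

text \<open>By oddness the function equals half of its value at \<open>x\<close> minus its value at
  \<open>- x\<close>, which removes the even exponents. They are written with \<open>div\<close> so
  that the derivative has the exponents \<open>2 * k + 2\<close> of
  \<open>third_term_monomial\<close>.\<close>

lemma stab_Cons_odd:
  assumes "odd_inv_poly_family F" "0 \<notin> set ts"
  obtains S :: "(nat \<Rightarrow> nat) set" and c where "finite S"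
    "\<And>x. x \<noteq> 0 \<Longrightarrow> stab F g (x # ts) = (\<Sum>e\<in>S. c e * inverse x ^ Suc (2 * (e 0 div 2)))"
proof -
  obtain S :: "(nat \<Rightarrow> nat) set" and c where S: "finite S"
    "\<And>x. x \<noteq> 0 \<Longrightarrow> stab F g (x # ts) = (\<Sum>e\<in>S. c e * inverse x ^ e 0)"
    by (rule inv_poly_fun_Cons[OF stab_odd_inv_poly(1)[OF assms(1)] refl assms(2)]) auto
  show ?thesis
  proof (rule that[of "{e \<in> S. odd (e 0)}" c])
    fix x :: complex assume x: "x \<noteq> 0"
    have "stab F g (x # ts) = (stab F g (x # ts) - stab F g (- x # ts)) / 2"
      using stab_odd_inv_poly(3)[OF assms(1), of "Suc (length ts)" "x # ts" 0 g] assms(2) x by simp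
    also have "\<dots> = (\<Sum>e\<in>S. c e * (inverse x ^ e 0 - inverse (- x) ^ e 0) / 2)"
      using x by (simp add: S(2) sum_subtractf[symmetric] sum_divide_distrib algebra_simps)
    also have "\<dots> = (\<Sum>e\<in>{e \<in> S. odd (e 0)}. c e * inverse x ^ e 0)"
      by (rule sum.mono_neutral_cong_right) (use S(1) in \<open>auto simp: power_minus_odd\<close>)
    also have "\<dots> = (\<Sum>e\<in>{e \<in> S. odd (e 0)}. c e * inverse x ^ Suc (2 * (e 0 div 2)))"
      by (intro sum.cong) auto
    finally show "stab F g (x # ts) = \<dots>" .
  qed (use S(1) in auto)
qed

section \<open>The summands in which one variable is removed\<close>

lemma remove_at_Cons: "remove_at j (x # xs) = (if j = 0 then xs else x # remove_at (j - 1) xs)"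
proof -
  have "{k. Suc k \<noteq> j} = - {j - 1}" if "j \<noteq> 0" using that by auto
  thus ?thesis unfolding remove_at_def by (auto simp: nths_Cons nths_all)
qed

lemma set_remove_at: "set (remove_at j xs) \<subseteq> set xs"
  unfolding remove_at_def by (rule set_nths_subset)

lemma length_remove_at: "j < length xs \<Longrightarrow> length (remove_at j xs) = length xs - 1"
  by (induction xs arbitrary: j) (auto simp: remove_at_Cons)

lemma mset_update_remove_at:
  "j < length xs \<Longrightarrow> mset (xs[j := x]) = mset (x # remove_at j xs)"
proof (induction xs arbitrary: j)
  case (Cons a xs)
  thus ?case by (cases j) (auto simp: remove_at_Cons)
qed simp

text \<open>With \<open>a = 1/t^2\<close> and \<open>b = 1/s^2\<close> the bracket is
  \<open>t * s * (a^(k+2) - b^(k+2))\<close> and the prefactor is \<open>a * b / (b - a)\<close>, so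
  the product is a finite geometric sum. The pole at \<open>t^2 = s^2\<close> is thus removable and
  only odd negative powers of \<open>t\<close> remain.\<close>

lemma third_term_monomial:
  fixes t s :: complex
  assumes "t \<noteq> 0" "s \<noteq> 0" "t\<^sup>2 \<noteq> s\<^sup>2"
  shows "1 / (t\<^sup>2 - s\<^sup>2) * (s / t * inverse t ^ (2 * k + 2) - t / s * inverse s ^ (2 * k + 2)) =
    - (\<Sum>l\<le>k + 1. inverse t ^ Suc (2 * l) * inverse s ^ Suc (2 * (k + 1 - l)))"
proof -
  define a b where "a = inverse t ^ 2" and "b = inverse s ^ 2"
  have "(\<Sum>l<k + 2. a ^ l * b ^ (k + 1 - l)) * (a - b) = a ^ (k + 2) - b ^ (k + 2)"
    using power_diff_sumr2[of a "k + 2" b] by (simp add: mult_ac)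
  hence sum: "(\<Sum>l\<le>k + 1. a ^ l * b ^ (k + 1 - l)) * (a - b) = a ^ (k + 2) - b ^ (k + 2)"
    by (simp add: lessThan_Suc_atMost)
  have "(\<Sum>l\<le>k + 1. inverse t ^ Suc (2 * l) * inverse s ^ Suc (2 * (k + 1 - l))) =
      inverse t * inverse s * (\<Sum>l\<le>k + 1. a ^ l * b ^ (k + 1 - l))"
    unfolding a_def b_def by (simp add: sum_distrib_left power_mult[symmetric] mult_ac del: sum.atMost_Suc)
  note lhs = this
  have "(t\<^sup>2 - s\<^sup>2) * a * b = b - a"
    using assms unfolding a_def b_def by (simp add: field_simps)
  hence "1 / (t\<^sup>2 - s\<^sup>2) * (b - a) = a * b" using assms(3) by (simp add: field_simps)
  have "s / t * inverse t ^ (2 * k + 2) - t / s * inverse s ^ (2 * k + 2) =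
     t * s * (a ^ (k + 2) - b ^ (k + 2))"
  proof -
    have pow: "(y ^ 2) ^ (k + 2) = y * y * y ^ (2 * k + 2)" for y :: complex
    proof -
      have "(y ^ 2) ^ (k + 2) = y ^ (2 * (k + 2))" by (rule power_mult[symmetric])
      also have "2 * (k + 2) = Suc (Suc (2 * k + 2))" by simp
      finally show ?thesis by (simp add: mult_ac)
    qed
    have "s / t * p - t / s * q = t * s * (inverse t * inverse t * p - inverse s * inverse s * q)" for p q
      using assms(1,2) by (simp add: field_simps)
    thus ?thesis unfolding a_def b_def pow .
  qed
  moreover have "x * (y * (S * (a - b))) = - (y * S * (x * (b - a)))" for x y S
    by (simp add: algebra_simps)
  ultimately have "1 / (t\<^sup>2 - s\<^sup>2) * (s / t * inverse t ^ (2 * k + 2) - t / s * inverse s ^ (2 * k + 2)) =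
     - (t * s * (\<Sum>l\<le>k + 1. a ^ l * b ^ (k + 1 - l)) * (1 / (t\<^sup>2 - s\<^sup>2) * (b - a)))"
    unfolding sum[symmetric] by metis
  also have "\<dots> = - (inverse t * inverse s * (\<Sum>l\<le>k + 1. a ^ l * b ^ (k + 1 - l)))"
    unfolding \<open>1 / (t\<^sup>2 - s\<^sup>2) * (b - a) = a * b\<close> unfolding a_def b_def
    using assms by (simp add: field_simps power2_eq_square)
  finally show ?thesis unfolding lhs .
qed

subsection \<open>Equivalence of the recursions (A) and (B)\<close>

text \<open>As in (A) and (B), the point \<open>t\<close> ranges over all nonzero values on the left
  but avoids \<open>E\<close> on the right. Both sides amount to an equation between Laurent series,
  so this difference is immaterial.\<close>

lemma principal_part_mult_iff:
  assumes Y: "meromorphic_at_0 Y" and R: "meromorphic_at_0 R" and "finite E"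
  shows "(\<forall>t. t \<noteq> 0 \<longrightarrow> principal_part Y t = principal_part (\<lambda>s. inverse (sin_quot s) * R s) t) \<longleftrightarrow>
    (\<forall>t. t \<noteq> 0 \<and> t \<notin> E \<longrightarrow> principal_part (\<lambda>s. sin_quot s * Y s) t = principal_part R t)"
proof -
  obtain U V where UV: "sin_quot has_laurent_expansion V"
    "(\<lambda>s. inverse (sin_quot s)) has_laurent_expansion U"
    "fls_prpart U = 0" "fls_prpart V = 0" "U * V = 1" by (rule sin_quot_laurent)
  let ?Y = "laurent_expansion Y 0" and ?R = "laurent_expansion R 0"
  have 1: "laurent_expansion (\<lambda>s. inverse (sin_quot s) * R s) 0 = U * ?R"
    using R UV(2) unfolding meromorphic_at_0_def
    by (intro laurent_expansion_0_eqI has_laurent_expansion_mult)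
  have 2: "laurent_expansion (\<lambda>s. sin_quot s * Y s) 0 = V * ?Y"
    using Y UV(1) unfolding meromorphic_at_0_def
    by (intro laurent_expansion_0_eqI has_laurent_expansion_mult)
  show ?thesis
    using principal_part_eq_iff[of "{}" Y "\<lambda>s. inverse (sin_quot s) * R s"]
      principal_part_eq_iff[OF \<open>finite E\<close>, of "\<lambda>s. sin_quot s * Y s" R] fls_prpart_unit_iff[OF UV(3-5), of ?Y ?R]
    unfolding 1 2 by simp
qed

lemma meromorphic_at_0_inverse_sin_quot: "meromorphic_at_0 (\<lambda>s. inverse (sin_quot s))"
  using sin_quot_laurent meromorphic_at_0I by metis

text \<open>The factor \<open>inverse (sin_quot s)\<close> is regular at 0, so its product with
  \<open>h\<close> has no principal part. This disposes of the derivative with respect to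
  \<open>t_j\<close>, which occurs in (B) but not in (A).\<close>

lemma principal_part_regular_summand:
  assumes "meromorphic_at_0 Z" "h analytic_on {0}"
  shows "meromorphic_at_0 (\<lambda>s. inverse (sin_quot s) * (Z s + h s))"
    and "principal_part (\<lambda>s. inverse (sin_quot s) * (Z s + h s)) t =
      principal_part (\<lambda>s. inverse (sin_quot s) * Z s) t"
proof -
  obtain U V where UV: "(\<lambda>s. inverse (sin_quot s)) has_laurent_expansion U" "fls_prpart U = 0"
    by (rule sin_quot_laurent)
  define L where "L = fps_to_fls (fps_expansion h 0)"
  have "h has_laurent_expansion L" unfolding L_def
    by (intro has_laurent_expansion_fps analytic_at_imp_has_fps_expansion_0 assms)
  moreover have "fls_prpart L = 0" unfolding L_def
    by (simp add: fls_prpart_eq0_iff fls_subdegree_fls_to_fps)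
  ultimately have h: "h has_laurent_expansion L" "fls_prpart L = 0" by auto
  have 1: "(\<lambda>s. inverse (sin_quot s) * (Z s + h s)) has_laurent_expansion
      U * (laurent_expansion Z 0 + L)"
    using assms UV h unfolding meromorphic_at_0_def by (intro laurent_expansion_intros)
  have 2: "(\<lambda>s. inverse (sin_quot s) * Z s) has_laurent_expansion U * laurent_expansion Z 0"
    using assms UV unfolding meromorphic_at_0_def by (intro laurent_expansion_intros)
  show "meromorphic_at_0 (\<lambda>s. inverse (sin_quot s) * (Z s + h s))" by (rule meromorphic_at_0I[OF 1])
  show "principal_part (\<lambda>s. inverse (sin_quot s) * (Z s + h s)) t =
      principal_part (\<lambda>s. inverse (sin_quot s) * Z s) t"
    unfolding principal_part_eqI[OF 1] principal_part_eqI[OF 2]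
    using fls_prpart_mult_eq_0[OF UV(2) h(2)] by (simp add: distrib_left)
qed

text \<open>Symmetry moves the varied entry to the front. It is available only for nonzero entries,
  so the two functions agree near the nonzero point \<open>ts ! j\<close>, which suffices for the
  derivative.\<close>

lemma deriv_stab_list_update:
  assumes F: "odd_inv_poly_family F" and ts: "0 \<notin> set ts" and j: "j < length ts"
  shows "deriv (\<lambda>x. stab F g (ts[j := x])) (ts ! j) = deriv (\<lambda>x. stab F g (x # remove_at j ts)) (ts ! j)"
proof -
  have tj: "ts ! j \<noteq> 0" using ts j nth_mem by metis
  have "stab F g (ts[j := x]) = stab F g (x # remove_at j ts)" if "x \<noteq> 0" for x
    by (rule stab_odd_inv_poly(2)[OF F])
       (use ts that set_update_subset_insert[of ts j x] j mset_update_remove_at[OF j] in \<open>auto simp: Suc_le_eq\<close>)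
  hence "eventually (\<lambda>x. stab F g (ts[j := x]) = stab F g (x # remove_at j ts)) (nhds (ts ! j))"
    using t1_space_nhds[OF tj] by (auto elim: eventually_mono)
  thus ?thesis by (rule deriv_cong_ev) simp
qed

lemma recursion_A_iff_B:
  assumes F: "odd_inv_poly_family F" and n: "1 \<le> n" "1 \<le> 2 * int g - 2 + int n"
  shows "recursion_A F g n \<longleftrightarrow> recursion_B F g n"
proof -
  let ?S = "{(g1, g2). g1 + g2 = g}"
  let ?u = "\<lambda>s. inverse (sin_quot s)"
  let ?c = "\<lambda>s. of_real pi * csc (2 * of_real pi * s)"
  define M where "M ts s = mixed_deriv (\<lambda>x y. stab F (int g - 1) (x # y # ts)) s s" for ts s
  define P where "P ts p q s = deriv (\<lambda>x. stab F (int (fst p)) (x # nths ts (fst q))) s *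
      deriv (\<lambda>x. stab F (int (snd p)) (x # nths ts (snd q))) s" for ts p q s
  define D where "D ts j s = deriv (\<lambda>x. stab F (int g) (x # remove_at j ts)) s" for ts j s
  define D' where "D' ts j = deriv (\<lambda>x. stab F (int g) (ts[j := x])) (ts ! j)" for ts j
  define Z where "Z ts j s = 1 / (s\<^sup>2 - (ts ! j)\<^sup>2) * (ts ! j / s * D ts j s - s / ts ! j * D' ts j)"
    for ts j s
  define R where "R ts s = 1 / (2 * s) * M ts s
     + (\<Sum>p\<in>?S. \<Sum>q\<in>partitions (n - 1). 1 / (2 * s) * P ts p q s)
     + (\<Sum>j<n - 1. Z ts j s)" for ts s
  define Y where "Y ts s = - s * deriv (\<lambda>x. F g (x # ts)) s" for ts s
  define E where "E ts = {s. \<exists>u\<in>set ts. s\<^sup>2 = u\<^sup>2}" for ts :: "complex list"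
  define A where "A ts t = (principal_part (\<lambda>s. ?c s * M ts s) t
     + (\<Sum>p\<in>?S. \<Sum>q\<in>partitions (n - 1).
          principal_part (\<lambda>s. ?c s * P ts p q s) t)
     + (\<Sum>j<n - 1. principal_part (\<lambda>s. 2 * of_real pi * ts ! j * csc (2 * of_real pi * s)
                               / (s\<^sup>2 - (ts ! j)\<^sup>2) * D ts j s) t))" for ts t
  have recA: "recursion_A F g n \<longleftrightarrow>
      (\<forall>ts. 0 \<notin> set ts \<and> length ts + 1 = n \<longrightarrow> (\<forall>t. t \<noteq> 0 \<longrightarrow> Y ts t = A ts t))"
    unfolding recursion_A_def A_def Y_def M_def P_def D_def by (auto simp: case_prod_beta mult.assoc)
  have recB: "recursion_B F g n \<longleftrightarrow>
      (\<forall>ts. 0 \<notin> set ts \<and> length ts + 1 = n \<longrightarrow> (\<forall>t. t \<noteq> 0 \<and> t \<notin> E ts \<longrightarrow>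
         - principal_part (\<lambda>s. sin (2 * of_real pi * s) / (2 * of_real pi) *
             deriv (\<lambda>x. F g (x # ts)) s) t = R ts t))"
    unfolding recursion_B_def R_def E_def Z_def M_def P_def D_def D'_def
    by (auto simp: case_prod_beta mult.assoc)
  have "(\<forall>t. t \<noteq> 0 \<longrightarrow> Y ts t = A ts t) \<longleftrightarrow> (\<forall>t. t \<noteq> 0 \<and> t \<notin> E ts \<longrightarrow>
         - principal_part (\<lambda>s. sin (2 * of_real pi * s) / (2 * of_real pi) *
             deriv (\<lambda>x. F g (x # ts)) s) t = R ts t)"
    if ts: "0 \<notin> set ts" "length ts + 1 = n" for ts
  proof -
    have "E ts \<subseteq> (\<Union>u\<in>set ts. {u, - u})" unfolding E_def by (auto simp: power2_eq_iff)
    hence finE: "finite (E ts)" by (rule finite_subset) auto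
    have E0: "0 \<notin> E ts" using ts(1) unfolding E_def by auto
    have half: "purely_singular (E ts) (\<lambda>s. 1 / (2 * s))"
      by (rule purely_singular_power[of _ _ "1/2" 0]) (auto simp: field_simps)
    have stabD: "purely_singular E' (deriv (\<lambda>x. stab F h (x # us)))" if us: "0 \<notin> set us" for E' h us
    proof -
      obtain S :: "(nat \<Rightarrow> nat) set" and c where "finite S"
        "\<And>x. x \<noteq> 0 \<Longrightarrow> stab F h (x # us) = (\<Sum>e\<in>S. c e * inverse x ^ e 0)"
        by (rule inv_poly_fun_Cons[OF stab_odd_inv_poly(1)[OF F] refl us]) auto
      thus ?thesis by (rule purely_singular_deriv)
    qed
    have psM: "purely_singular (E ts) (\<lambda>s. 1 / (2 * s) * M ts s)"
    proof -
      obtain S :: "(nat \<Rightarrow> nat) set" and c where "finite S"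
        "\<And>x y. x \<noteq> 0 \<Longrightarrow> y \<noteq> 0 \<Longrightarrow>
          stab F (int g - 1) (x # y # ts) = (\<Sum>e\<in>S. c e * inverse x ^ e 0 * inverse y ^ e 1)"
        by (rule inv_poly_fun_Cons2[OF stab_odd_inv_poly(1)[OF F] refl ts(1)]) auto
      thus ?thesis unfolding M_def
        by (intro purely_singular_mult half purely_singular_mixed_deriv)
    qed
    have psP: "purely_singular (E ts) (\<lambda>s. 1 / (2 * s) * P ts p q s)" for p q
      unfolding P_def by (intro purely_singular_mult half stabD notin_set_nthsI ts(1))
    have D'eq: "D' ts j = D ts j (ts ! j)" if "j < n - 1" for j
      unfolding D'_def D_def by (rule deriv_stab_list_update[OF F ts(1)]) (use that ts in simp)
    have psZ: "purely_singular (E ts) (Z ts j)" if "j < n - 1" for j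
    proof -
      have j: "j < length ts" using that ts by simp
      hence tj: "ts ! j \<noteq> 0" using ts(1) nth_mem by metis
      have rem: "0 \<notin> set (remove_at j ts)" using ts(1) set_remove_at[of j ts] by auto
      obtain S :: "(nat \<Rightarrow> nat) set" and c where S: "finite S"
        "\<And>x. x \<noteq> 0 \<Longrightarrow> stab F (int g) (x # remove_at j ts) =
           (\<Sum>e\<in>S. c e * inverse x ^ Suc (2 * (e 0 div 2)))"
        by (rule stab_Cons_odd[OF F rem, where g = "int g"]) auto
      define k where "k e = e 0 div 2" for e :: "nat \<Rightarrow> nat"
      have D: "D ts j s = (\<Sum>e\<in>S. - (c e * of_nat (Suc (2 * k e)) * inverse s ^ (2 * k e + 2)))"
        if "s \<noteq> 0" for s
        unfolding D_def k_def by (subst deriv_inverse_sum[OF S that]) simp_all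
      show ?thesis
      proof (rule purely_singular_cong[OF purely_singular_sum[of S _
           "\<lambda>e s. \<Sum>l\<le>k e + 1. c e * of_nat (Suc (2 * k e)) * inverse (ts ! j) ^ Suc (2 * (k e + 1 - l))
              * inverse s ^ Suc (2 * l)"]])
        show "purely_singular (E ts) (\<lambda>s. \<Sum>l\<le>k e + 1. c e * of_nat (Suc (2 * k e)) *
           inverse (ts ! j) ^ Suc (2 * (k e + 1 - l)) * inverse s ^ Suc (2 * l))" for e
          by (intro purely_singular_sum) (rule purely_singular_power, rule refl)
        fix s assume s: "s \<noteq> 0" "s \<notin> E ts"
        hence s2: "s\<^sup>2 \<noteq> (ts ! j)\<^sup>2" using j unfolding E_def by auto
        have "Z ts j s = (\<Sum>e\<in>S. - (c e * of_nat (Suc (2 * k e))) * (1 / (s\<^sup>2 - (ts ! j)\<^sup>2) *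
           ((ts ! j) / s * inverse s ^ (2 * k e + 2) - s / (ts ! j) * inverse (ts ! j) ^ (2 * k e + 2))))"
          unfolding Z_def D'eq[OF \<open>j < n - 1\<close>] D[OF s(1)] D[OF tj]
          by (simp add: sum_distrib_left sum_subtractf[symmetric] right_diff_distrib mult_ac)
        also have "\<dots> = (\<Sum>e\<in>S. \<Sum>l\<le>k e + 1. c e * of_nat (Suc (2 * k e)) *
           inverse (ts ! j) ^ Suc (2 * (k e + 1 - l)) * inverse s ^ Suc (2 * l))"
          unfolding third_term_monomial[OF s(1) tj s2]
          by (simp add: sum_distrib_left mult_ac sum_negf del: sum.atMost_Suc power_Suc of_nat_Suc)
        finally show "Z ts j s = \<dots>" .
      qed
    qed
    have psR: "purely_singular (E ts) (R ts)"
      unfolding R_def by (intro purely_singular_add purely_singular_sum psM psP psZ) auto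
    have psY: "purely_singular {} (Y ts)"
    proof -
      have "inv_poly_fun (Suc (length ts)) (F g)"
        using F n ts unfolding odd_inv_poly_family_def by auto
      then obtain S :: "(nat \<Rightarrow> nat) set" and c where S: "finite S"
        "\<And>x. x \<noteq> 0 \<Longrightarrow> F g (x # ts) = (\<Sum>e\<in>S. c e * inverse x ^ e 0)"
        by (rule inv_poly_fun_Cons[OF _ refl ts(1)]) auto
      have "purely_singular {} (\<lambda>s. c e * of_nat (e 0) * inverse s ^ e 0)" for e
      proof (cases "e 0")
        case 0
        thus ?thesis unfolding purely_singular_def by (intro exI[of _ 0]) simp
      next
        case (Suc k)
        thus ?thesis by (intro purely_singular_power[of _ _ "c e * of_nat (e 0)" k]) simp
      qed
      hence "purely_singular {} (\<lambda>s. \<Sum>e\<in>S. c e * of_nat (e 0) * inverse s ^ e 0)"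
        by (rule purely_singular_sum)
      moreover have "Y ts s = (\<Sum>e\<in>S. c e * of_nat (e 0) * inverse s ^ e 0)" if "s \<noteq> 0" for s
      proof -
        have "s * inverse s ^ Suc k = inverse s ^ k" for k
          using that by simp
        thus ?thesis unfolding Y_def
          by (subst deriv_inverse_sum[OF S that]) (auto simp: sum_distrib_left simp del: power_Suc intro!: sum.cong)
      qed
      ultimately show ?thesis by (rule purely_singular_cong) auto
    qed
    note pole = purely_singular_principal_part(1)[OF _ finE E0]
    note upole = meromorphic_at_0_mult[OF meromorphic_at_0_inverse_sin_quot pole]
    have A: "A ts t = principal_part (\<lambda>s. ?u s * R ts s) t" for t
    proof -
      have ev: "eventually (\<lambda>s. s \<noteq> 0 \<and> s \<notin> E ts) (at 0)" by (rule eventually_at_0_avoid[OF finE E0])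
      have csc: "?c s * X = ?u s * (1 / (2 * s) * X)" if "s \<noteq> 0" for s X
        using that unfolding sin_quot_def csc_def by (simp add: field_simps)
      have A12: "principal_part (\<lambda>s. ?c s * X s) t = principal_part (\<lambda>s. ?u s * (1 / (2 * s) * X s)) t" for X
        by (intro principal_part_cong eventually_mono[OF ev]) (rule csc, blast)
      have A3: "principal_part (\<lambda>s. 2 * of_real pi * ts ! j * csc (2 * of_real pi * s)
                   / (s\<^sup>2 - (ts ! j)\<^sup>2) * D ts j s) t =
          principal_part (\<lambda>s. ?u s * Z ts j s) t" if "j < n - 1" for j
      proof -
        have tj: "ts ! j \<noteq> 0" using ts that nth_mem[of j ts] by (metis Suc_eq_plus1 diff_Suc_1)
        \<comment> \<open>Adding \<open>h\<close> cancels the part of \<open>Z\<close> with the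
          derivative at \<open>t_j\<close> and leaves the summand of (A). It is regular at 0 because
          \<open>t_j\<close> is nonzero.\<close>
        define h where "h s = s / ts ! j * D' ts j / (s\<^sup>2 - (ts ! j)\<^sup>2)" for s
        have h: "h analytic_on {0}" unfolding h_def
          by (intro analytic_intros) (use tj in auto)
        have "principal_part (\<lambda>s. 2 * of_real pi * ts ! j * csc (2 * of_real pi * s)
                   / (s\<^sup>2 - (ts ! j)\<^sup>2) * D ts j s) t = principal_part (\<lambda>s. ?u s * (Z ts j s + h s)) t"
        proof (intro principal_part_cong eventually_mono[OF ev])
          fix s assume s: "s \<noteq> 0 \<and> s \<notin> E ts"
          have "Z ts j s + h s = ts ! j / s * D ts j s / (s\<^sup>2 - (ts ! j)\<^sup>2)"
            unfolding Z_def h_def by (simp add: diff_divide_distrib)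
          \<comment> \<open>The identity also covers points where \<open>S\<close> or
            \<open>d\<close> vanishes: both sides are then 0 by division by zero.\<close>
          moreover have "2 * of_real pi * x * inverse S / d * y = inverse (S / (2 * of_real pi * s)) * (x / s * y / d)"
            for x y S d using s by (cases "d = 0"; cases "S = 0") (simp_all add: field_simps)
          ultimately show "2 * of_real pi * ts ! j * csc (2 * of_real pi * s) / (s\<^sup>2 - (ts ! j)\<^sup>2) * D ts j s =
            ?u s * (Z ts j s + h s)"
            unfolding sin_quot_def csc_def by (simp only:)
        qed
        thus ?thesis using principal_part_regular_summand(2)[OF pole[OF psZ[OF that]] h] by simp
      qed
      have "A ts t = principal_part (\<lambda>s. ?u s * (1 / (2 * s) * M ts s)) t
          + (\<Sum>p\<in>?S. \<Sum>q\<in>partitions (n - 1). principal_part (\<lambda>s. ?u s * (1 / (2 * s) * P ts p q s)) t)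
          + (\<Sum>j<n - 1. principal_part (\<lambda>s. ?u s * Z ts j s) t)"
        unfolding A_def A12 by (intro arg_cong2[where f = "(+)"] refl sum.cong A3) auto
      also have "\<dots> = principal_part (\<lambda>s. ?u s * (1 / (2 * s) * M ts s)
          + (\<Sum>p\<in>?S. \<Sum>q\<in>partitions (n - 1). ?u s * (1 / (2 * s) * P ts p q s))
          + (\<Sum>j<n - 1. ?u s * Z ts j s)) t"
        by (subst principal_part_add principal_part_sum,
            (intro principal_part_add(1) principal_part_sum(1) upole psM psP psZ; simp)+)+ simp
      also have "\<dots> = principal_part (\<lambda>s. ?u s * R ts s) t"
        unfolding R_def by (simp only: distrib_left sum_distrib_left)
      finally show ?thesis .
    qed
    have Y: "principal_part (Y ts) t = Y ts t" if "t \<noteq> 0" for t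
      using purely_singular_principal_part(2)[OF psY] that by simp
    have R: "principal_part (R ts) t = R ts t" if "t \<noteq> 0" "t \<notin> E ts" for t
      using purely_singular_principal_part(2)[OF psR finE E0] that by simp
    \<comment> \<open>\<open>Y\<close> carries the factor \<open>- s\<close>, which turns
      \<open>sin / (2 * pi)\<close> into \<open>sin_quot\<close> and accounts for the minus sign of
      (B).\<close>
    have vY: "- principal_part (\<lambda>s. sin (2 * of_real pi * s) / (2 * of_real pi) * deriv (\<lambda>x. F g (x # ts)) s) t
         = principal_part (\<lambda>s. sin_quot s * Y ts s) t" for t
    proof -
      have poleY: "meromorphic_at_0 (\<lambda>s. sin_quot s * Y ts s)"
        by (intro meromorphic_at_0_mult purely_singular_principal_part(1)[OF psY])
           (use sin_quot_laurent meromorphic_at_0I in \<open>metis\<close>, auto)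
      have "principal_part (\<lambda>s. sin (2 * of_real pi * s) / (2 * of_real pi) * deriv (\<lambda>x. F g (x # ts)) s) t
         = principal_part (\<lambda>s. - (sin_quot s * Y ts s)) t"
        by (intro principal_part_cong eventually_mono[OF eventually_at_0_avoid[of "{}"]])
           (auto simp: sin_quot_def Y_def)
      also have "\<dots> = poly (fls_prpart (- laurent_expansion (\<lambda>s. sin_quot s * Y ts s) 0)) (inverse t)"
        by (rule principal_part_eqI, rule has_laurent_expansion_minus)
           (use poleY in \<open>simp add: meromorphic_at_0_def\<close>)
      finally show ?thesis by (simp add: principal_part_def)
    qed
    show ?thesis
      using principal_part_mult_iff[OF purely_singular_principal_part(1)[OF psY] pole[OF psR] finE]
      unfolding A vY by (simp add: Y R cong: conj_cong imp_cong)
  qed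
  thus ?thesis unfolding recA recB by blast
qed

subsection \<open>A formal Laplace transform\<close>

text \<open>The transform as a relation: \<open>f\<close> and \<open>F\<close> share the set
  \<open>S\<close> of exponents and the coefficients \<open>c\<close>, and a monomial with exponents
  \<open>e i\<close> corresponds to the product of the \<open>(e i)! / t_i^(e i + 1)\<close>.
  Integrals enter only once, when this is compared with \<open>laplace_integral\<close>.\<close>

definition laplace_rep where
  "laplace_rep n f F (S :: (nat \<Rightarrow> nat) set) c \<longleftrightarrow> finite S \<and>
     (\<forall>xs. length xs = n \<longrightarrow> f xs = (\<Sum>e\<in>S. c e * (\<Prod>i<n. (xs ! i) ^ e i))) \<and>
     (\<forall>ts. length ts = n \<and> 0 \<notin> set ts \<longrightarrow>
        F ts = (\<Sum>e\<in>S. c e * (\<Prod>i<n. fact (e i) * inverse (ts ! i) ^ Suc (e i))))"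

definition has_laplace :: "nat \<Rightarrow> (complex list \<Rightarrow> complex) \<Rightarrow> (complex list \<Rightarrow> complex) \<Rightarrow> bool" where
  "has_laplace n f F \<longleftrightarrow> (\<exists>S c. laplace_rep n f F S c)"

lemma laplace_repD:
  assumes "laplace_rep n f F S c"
  shows "finite S" "\<forall>xs. length xs = n \<longrightarrow> f xs = (\<Sum>e\<in>S. c e * (\<Prod>i<n. (xs ! i) ^ e i))"
    "\<forall>ts. length ts = n \<and> 0 \<notin> set ts \<longrightarrow>
        F ts = (\<Sum>e\<in>S. c e * (\<Prod>i<n. fact (e i) * inverse (ts ! i) ^ Suc (e i)))"
  using assms unfolding laplace_rep_def by blast+

text \<open>The exponent map \<open>e\<close> may take the same value at several indices; the
  coefficients are added over its fibres.\<close>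

lemma has_laplaceI:
  assumes A: "finite A"
    and f: "\<And>xs. length xs = n \<Longrightarrow> f xs = (\<Sum>a\<in>A. c a * (\<Prod>i<n. (xs ! i) ^ e a i))"
    and F: "\<And>ts. length ts = n \<Longrightarrow> 0 \<notin> set ts \<Longrightarrow>
      F ts = (\<Sum>a\<in>A. c a * (\<Prod>i<n. fact (e a i) * inverse (ts ! i) ^ Suc (e a i)))"
  shows "has_laplace n f F"
proof -
  have group: "(\<Sum>a\<in>A. c a * h (e a)) = (\<Sum>s\<in>e ` A. (\<Sum>a | a \<in> A \<and> e a = s. c a) * h s)"
    for h :: "(nat \<Rightarrow> nat) \<Rightarrow> complex"
    by (subst sum.image_gen[OF A, of _ e]) (auto simp: sum_distrib_right intro!: sum.cong)
  show ?thesis unfolding has_laplace_def laplace_rep_def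
    by (intro exI[of _ "e ` A"] exI[of _ "\<lambda>s. \<Sum>a | a \<in> A \<and> e a = s. c a"])
       (use A f F group[of "\<lambda>e. \<Prod>i<n. _ i ^ e i"]
            group[of "\<lambda>e. \<Prod>i<n. fact (e i) * _ i ^ Suc (e i)"] in simp)
qed

lemma has_laplace_cong:
  assumes "has_laplace n f F" "\<And>xs. length xs = n \<Longrightarrow> g xs = f xs"
    "\<And>ts. length ts = n \<Longrightarrow> 0 \<notin> set ts \<Longrightarrow> G ts = F ts"
  shows "has_laplace n g G"
  using assms unfolding has_laplace_def laplace_rep_def by simp

lemma has_laplace_cmult:
  assumes "has_laplace n f F"
  shows "has_laplace n (\<lambda>xs. k * f xs) (\<lambda>ts. k * F ts)"
proof -
  obtain S c where "laplace_rep n f F S c" using assms unfolding has_laplace_def by blast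
  note S = laplace_repD[OF this]
  thus ?thesis using S
    by (intro has_laplaceI[of S n _ "\<lambda>e. k * c e" "\<lambda>e. e"]) (auto simp: sum_distrib_left mult.assoc)
qed

lemma has_laplace_add:
  assumes "has_laplace n f F" "has_laplace n g G"
  shows "has_laplace n (\<lambda>xs. f xs + g xs) (\<lambda>ts. F ts + G ts)"
proof -
  obtain S c where "laplace_rep n f F S c" using assms(1) unfolding has_laplace_def by blast
  note S = laplace_repD[OF this]
  obtain T d where "laplace_rep n g G T d" using assms(2) unfolding has_laplace_def by blast
  note T = laplace_repD[OF this]
  show ?thesis
    by (rule has_laplaceI[of "S <+> T" _ _ "case_sum c d" "case_sum (\<lambda>e. e) (\<lambda>e. e)"])
       (use S T in \<open>simp_all add: sum.Plus\<close>)
qed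

lemma has_laplace_0: "has_laplace n (\<lambda>_. 0) (\<lambda>_. 0)"
  unfolding has_laplace_def laplace_rep_def by (intro exI[of _ "{}"]) simp

lemma has_laplace_sum:
  "(\<And>a. a \<in> A \<Longrightarrow> has_laplace n (f a) (F a)) \<Longrightarrow>
    has_laplace n (\<lambda>xs. \<Sum>a\<in>A. f a xs) (\<lambda>ts. \<Sum>a\<in>A. F a ts)"
  by (induction A rule: infinite_finite_induct) (auto intro: has_laplace_0 has_laplace_add)

lemma has_laplace_Cons:
  assumes "has_laplace m f F"
  shows "has_laplace (Suc m) (\<lambda>xs. hd xs ^ k * f (tl xs))
     (\<lambda>ts. fact k * inverse (hd ts) ^ Suc k * F (tl ts))"
proof -
  obtain S c where "laplace_rep m f F S c" using assms unfolding has_laplace_def by blast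
  note S = laplace_repD[OF this]
  show ?thesis
  proof (rule has_laplaceI[of S "Suc m" _ c "\<lambda>e. case_nat k e"])
    show "hd xs ^ k * f (tl xs) = (\<Sum>e\<in>S. c e * (\<Prod>i<Suc m. xs ! i ^ case_nat k e i))"
      if "length xs = Suc m" for xs
      using that S by (cases xs) (auto simp: prod.lessThan_Suc_shift sum_distrib_left mult_ac simp del: prod.lessThan_Suc)
    show "fact k * inverse (hd ts) ^ Suc k * F (tl ts) =
       (\<Sum>e\<in>S. c e * (\<Prod>i<Suc m. fact (case_nat k e i) * inverse (ts ! i) ^ Suc (case_nat k e i)))"
      if "length ts = Suc m" "0 \<notin> set ts" for ts
      using that S by (cases ts)
        (auto simp: prod.lessThan_Suc_shift sum_distrib_left mult_ac simp del: prod.lessThan_Suc power_Suc)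
  qed (use S in auto)
qed

text \<open>An expansion in the first variable whose coefficients are again transform pairs, in the
  remaining \<open>m\<close> variables. Inductions on the number of variables rest on it.\<close>

definition laplace_Cons_rep where
  "laplace_Cons_rep m f F d f' F' \<longleftrightarrow> (\<forall>k. has_laplace m (f' k) (F' k)) \<and>
     (\<forall>x xs. length xs = m \<longrightarrow> f (x # xs) = (\<Sum>k\<le>d. x ^ k * f' k xs)) \<and>
     (\<forall>t ts. t \<noteq> 0 \<and> 0 \<notin> set ts \<and> length ts = m \<longrightarrow>
       F (t # ts) = (\<Sum>k\<le>(d::nat). fact k * inverse t ^ Suc k * F' k ts))"

lemma laplace_Cons_repI:
  assumes "\<And>k. has_laplace m (f' k) (F' k)"
    "\<And>x xs. length xs = m \<Longrightarrow> f (x # xs) = (\<Sum>k\<le>d. x ^ k * f' k xs)"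
    "\<And>t ts. t \<noteq> 0 \<Longrightarrow> 0 \<notin> set ts \<Longrightarrow> length ts = m \<Longrightarrow>
       F (t # ts) = (\<Sum>k\<le>d. fact k * inverse t ^ Suc k * F' k ts)"
  shows "laplace_Cons_rep m f F d f' F'"
  using assms unfolding laplace_Cons_rep_def by auto

lemma laplace_Cons_repD:
  assumes "laplace_Cons_rep m f F d f' F'"
  shows "has_laplace m (f' k) (F' k)"
    "length xs = m \<Longrightarrow> f (x # xs) = (\<Sum>k\<le>d. x ^ k * f' k xs)"
    "t \<noteq> 0 \<Longrightarrow> 0 \<notin> set ts \<Longrightarrow> length ts = m \<Longrightarrow>
       F (t # ts) = (\<Sum>k\<le>d. fact k * inverse t ^ Suc k * F' k ts)"
  using assms unfolding laplace_Cons_rep_def by auto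

lemma has_laplace_ConsE:
  assumes "has_laplace (Suc m) f F"
  obtains d f' F' where "laplace_Cons_rep m f F d f' F'"
proof -
  obtain S c where "laplace_rep (Suc m) f F S c" using assms unfolding has_laplace_def by blast
  note S = laplace_repD[OF this]
  \<comment> \<open>A crude bound for the exponents of the first variable; powers that do not occur
    get an empty sum as coefficient.\<close>
  define d where "d = (\<Sum>e\<in>S. e 0)"
  have d: "(\<lambda>e. e 0) ` S \<subseteq> {..d}"
    using member_le_sum[of _ S "\<lambda>e. e 0"] S(1) unfolding d_def by auto
  define T where "T k = {e \<in> S. e 0 = k}" for k
  have group: "(\<Sum>e\<in>S. h e) = (\<Sum>k\<le>d. \<Sum>e\<in>T k. h e)" for h :: "(nat \<Rightarrow> nat) \<Rightarrow> complex"
    unfolding T_def by (rule sum.group[symmetric]) (use S(1) d in auto)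
  show ?thesis
  proof (rule that, rule laplace_Cons_repI[of _ "\<lambda>k xs. \<Sum>e\<in>T k. c e * (\<Prod>i<m. (xs ! i) ^ e (Suc i))"
      "\<lambda>k ts. \<Sum>e\<in>T k. c e * (\<Prod>i<m. fact (e (Suc i)) * inverse (ts ! i) ^ Suc (e (Suc i)))" _ d])
    show "has_laplace m (\<lambda>xs. \<Sum>e\<in>T k. c e * (\<Prod>i<m. (xs ! i) ^ e (Suc i)))
      (\<lambda>ts. \<Sum>e\<in>T k. c e * (\<Prod>i<m. fact (e (Suc i)) * inverse (ts ! i) ^ Suc (e (Suc i))))" for k
      by (rule has_laplaceI[of "T k" _ _ c "\<lambda>e i. e (Suc i)"]) (use S(1) in \<open>auto simp: T_def\<close>)
    show "f (x # xs) = (\<Sum>k\<le>d. x ^ k * (\<Sum>e\<in>T k. c e * (\<Prod>i<m. (xs ! i) ^ e (Suc i))))"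
      if "length xs = m" for x xs
      using that S(2) by (simp add: group prod.lessThan_Suc_shift sum_distrib_left del: prod.lessThan_Suc)
         (auto simp: T_def mult_ac intro!: sum.cong)
    show "F (t # ts) = (\<Sum>k\<le>d. fact k * inverse t ^ Suc k *
        (\<Sum>e\<in>T k. c e * (\<Prod>i<m. fact (e (Suc i)) * inverse (ts ! i) ^ Suc (e (Suc i)))))"
      if "t \<noteq> 0" "0 \<notin> set ts" "length ts = m" for t ts
      using that S(3) by (simp add: group prod.lessThan_Suc_shift sum_distrib_left del: prod.lessThan_Suc power_Suc)
         (auto simp: T_def mult_ac simp del: power_Suc intro!: sum.cong)
  qed
qed

lemma poly_sum_eq_0_on_pos:
  fixes c :: "nat \<Rightarrow> complex"
  assumes "\<And>r :: real. 0 < r \<Longrightarrow> (\<Sum>k\<le>d. complex_of_real r ^ k * c k) = 0" "k \<le> d"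
  shows "c k = 0"
proof -
  have "complex_of_real ` {0<..} \<subseteq> {z. (\<Sum>k\<le>d. c k * z ^ k) = 0}"
    using assms(1) by (auto simp: mult.commute)
  moreover have "infinite (complex_of_real ` {0<..})"
    by (subst finite_image_iff) (auto simp: inj_on_def infinite_Ioi)
  ultimately have "infinite {z. (\<Sum>k\<le>d. c k * z ^ k) = 0}" by (metis finite_subset)
  thus ?thesis using polyfun_finite_roots[of c d] assms(2) by auto
qed

text \<open>Induction on the number of variables: for positive values of the others, the polynomial
  in the first variable has infinitely many zeros, so its coefficients vanish on the positive
  orthant. The claim is made for \<open>f\<close> and \<open>F\<close> together because
  \<open>has_laplace\<close> is a relation, in which \<open>F\<close> is not given as a function of
  \<open>f\<close>.\<close>

lemma has_laplace_eq_0: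
  assumes "has_laplace n f F"
    "\<And>rs. length rs = n \<Longrightarrow> (\<forall>r\<in>set rs. (0::real) < r) \<Longrightarrow> f (map of_real rs) = 0"
  shows "(\<forall>ts. length ts = n \<and> 0 \<notin> set ts \<longrightarrow> F ts = 0) \<and> (\<forall>xs. length xs = n \<longrightarrow> f xs = 0)"
  using assms
proof (induction n arbitrary: f F)
  case 0
  obtain S :: "(nat \<Rightarrow> nat) set" and c where "f [] = (\<Sum>e\<in>S. c e)" "F [] = (\<Sum>e\<in>S. c e)"
    using 0(1) unfolding has_laplace_def laplace_rep_def by auto
  moreover have "f [] = 0" using 0(2)[of "[]"] by simp
  ultimately show ?case by simp
next
  case (Suc m)
  obtain d f' F' where "laplace_Cons_rep m f F d f' F'"
    by (rule has_laplace_ConsE[OF Suc.prems(1)])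
  note * = laplace_Cons_repD[OF this]
  have "f' k (map of_real rs) = 0" if rs: "k \<le> d" "length rs = m" "\<forall>r\<in>set rs. (0::real) < r" for k rs
  proof (rule poly_sum_eq_0_on_pos[OF _ rs(1)])
    fix r :: real assume "0 < r"
    hence "f (map of_real (r # rs)) = 0"
      using Suc.prems(2)[of "r # rs"] rs by simp
    thus "(\<Sum>k\<le>d. complex_of_real r ^ k * f' k (map of_real rs)) = 0" using *(2) rs by simp
  qed
  hence zero: "(\<forall>ts. length ts = m \<and> 0 \<notin> set ts \<longrightarrow> F' k ts = 0) \<and> (\<forall>xs. length xs = m \<longrightarrow> f' k xs = 0)"
    if "k \<le> d" for k
    using Suc.IH[OF *(1)] that by blast
  show ?case
  proof (intro conjI allI impI)
    fix ts :: "complex list" assume "length ts = Suc m \<and> 0 \<notin> set ts"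
    then obtain t us where "ts = t # us" "t \<noteq> 0" "0 \<notin> set us" "length us = m" by (cases ts) auto
    thus "F ts = 0" using *(3)[of t us] zero by simp
  next
    fix xs :: "complex list" assume "length xs = Suc m"
    then obtain y ys where "xs = y # ys" "length ys = m" by (cases xs) auto
    thus "f xs = 0" using *(2)[of ys y] zero by simp
  qed
qed

lemma has_laplace_unique:
  assumes "has_laplace n f F" "has_laplace n g G"
    "\<And>rs. length rs = n \<Longrightarrow> (\<forall>r\<in>set rs. (0::real) < r) \<Longrightarrow> f (map of_real rs) = g (map of_real rs)"
    "length ts = n" "0 \<notin> set ts"
  shows "F ts = G ts"
  using has_laplace_eq_0[OF has_laplace_add[OF assms(1) has_laplace_cmult[OF assms(2), of "-1"]]] assms(3-5)
  by simp

section \<open>Products of transforms in disjoint blocks of variables\<close>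

lemma nths_Compl_Cons:
  "nths (x # xs) I = (if 0 \<in> I then [x] else []) @ nths xs {j. Suc j \<in> I}"
  "nths (x # xs) (- I) = (if 0 \<in> I then [] else [x]) @ nths xs (- {j. Suc j \<in> I})"
proof -
  have "{j. Suc j \<in> - I} = - {j. Suc j \<in> I}" by auto
  thus "nths (x # xs) I = (if 0 \<in> I then [x] else []) @ nths xs {j. Suc j \<in> I}"
    "nths (x # xs) (- I) = (if 0 \<in> I then [] else [x]) @ nths xs (- {j. Suc j \<in> I})"
    by (simp_all add: nths_Cons)
qed

lemma card_Suc_shift: "card {i. i < Suc m \<and> i \<in> I} =
    (if 0 \<in> I then 1 else 0) + card {i. i < m \<and> i \<in> {j. Suc j \<in> I}}"
proof -
  have "{i. i < Suc m \<and> i \<in> I} = (if 0 \<in> I then {0} else {}) \<union> Suc ` {i. i < m \<and> i \<in> {j. Suc j \<in> I}}"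
    by (auto simp: image_iff less_Suc_eq_0_disj)
  thus ?thesis by (simp add: card_image card_insert_if)
qed

text \<open>The blocks \<open>I\<close> and \<open>- I\<close> share no variable, so the transforms
  multiply. The induction removes the first variable from whichever factor contains it, which is why
  the factors, their arities and \<open>I\<close> all vary.\<close>

lemma has_laplace_product:
  assumes "has_laplace a f F" "has_laplace b g G"
    "a = card {i. i < m \<and> i \<in> I}" "b = card {i. i < m \<and> i \<in> - I}"
  shows "has_laplace m (\<lambda>xs. f (nths xs I) * g (nths xs (- I))) (\<lambda>ts. F (nths ts I) * G (nths ts (- I)))"
  using assms
proof (induction m arbitrary: a b f F g G I)
  case 0
  obtain S :: "(nat \<Rightarrow> nat) set" and c where S: "f [] = (\<Sum>e\<in>S. c e)" "F [] = (\<Sum>e\<in>S. c e)"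
    using 0(1,3) unfolding has_laplace_def laplace_rep_def by auto
  obtain S' :: "(nat \<Rightarrow> nat) set" and c' where "g [] = (\<Sum>e\<in>S'. c' e)" "G [] = (\<Sum>e\<in>S'. c' e)"
    using 0(2,4) unfolding has_laplace_def laplace_rep_def by auto
  thus ?case using S
    by (intro has_laplaceI[of "{()}" _ _ "\<lambda>_. f [] * g []" "\<lambda>_ _. 0"]) auto
next
  case (Suc m)
  \<comment> \<open>The case in which the first variable belongs to \<open>f\<close>; the other case
    follows by exchanging \<open>f\<close> with \<open>g\<close> and \<open>I\<close> with
    \<open>- I\<close>.\<close>
  have step: "has_laplace (Suc m) (\<lambda>xs. f (nths xs I) * g (nths xs (- I))) (\<lambda>ts. F (nths ts I) * G (nths ts (- I)))"
    if fg: "has_laplace a f F" "has_laplace b g G" "a = card {i. i < Suc m \<and> i \<in> I}"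
      "b = card {i. i < Suc m \<and> i \<in> - I}" "0 \<in> I" for f F g G I a b
  proof -
    let ?I = "{j. Suc j \<in> I}"
    have I: "{j. Suc j \<in> - I} = - ?I" by auto
    have a: "a = Suc (card {i. i < m \<and> i \<in> ?I})" and b: "b = card {i. i < m \<and> i \<in> - ?I}"
      using fg(3-5) unfolding card_Suc_shift I by auto
    obtain d f' F' where "laplace_Cons_rep (card {i. i < m \<and> i \<in> ?I}) f F d f' F'"
      by (rule has_laplace_ConsE[OF fg(1)[unfolded a]])
    note * = laplace_Cons_repD[OF this]
    have "has_laplace (Suc m)
        (\<lambda>xs. \<Sum>k\<le>d. hd xs ^ k * (f' k (nths (tl xs) ?I) * g (nths (tl xs) (- ?I))))
        (\<lambda>ts. \<Sum>k\<le>d. fact k * inverse (hd ts) ^ Suc k * (F' k (nths (tl ts) ?I) * G (nths (tl ts) (- ?I))))"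
      by (intro has_laplace_sum has_laplace_Cons Suc.IH[OF *(1) fg(2) refl b])
    thus ?thesis
    proof (rule has_laplace_cong)
      fix xs :: "complex list" assume xs: "length xs = Suc m"
      then obtain y ys where [simp]: "xs = y # ys" "length ys = m" by (cases xs) auto
      have "length (nths ys ?I) = card {i. i < m \<and> i \<in> ?I}" by (simp add: length_nths)
      thus "f (nths xs I) * g (nths xs (- I)) =
          (\<Sum>k\<le>d. hd xs ^ k * (f' k (nths (tl xs) ?I) * g (nths (tl xs) (- ?I))))"
        using nths_Compl_Cons[of y ys I] fg(5) *(2)[of "nths ys ?I" y]
        by (simp only: list.sel \<open>xs = y # ys\<close> if_True append_Cons append_Nil sum_distrib_right mult.assoc)
    next
      fix ts :: "complex list" assume ts: "length ts = Suc m" "0 \<notin> set ts"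
      then obtain y ys where [simp]: "ts = y # ys" "length ys = m" and y: "y \<noteq> 0" "0 \<notin> set ys"
        by (cases ts) auto
      have len: "length (nths ys ?I) = card {i. i < m \<and> i \<in> ?I}" by (simp add: length_nths)
      show "F (nths ts I) * G (nths ts (- I)) = (\<Sum>k\<le>d. fact k * inverse (hd ts) ^ Suc k *
          (F' k (nths (tl ts) ?I) * G (nths (tl ts) (- ?I))))"
        using nths_Compl_Cons[of y ys I] fg(5) *(3)[OF y(1) notin_set_nthsI[OF y(2)] len]
        by (simp only: list.sel \<open>ts = y # ys\<close> if_True append_Cons append_Nil sum_distrib_right mult.assoc)
    qed
  qed
  show ?case
  proof (cases "0 \<in> I")
    case True
    thus ?thesis using step[OF Suc.prems] by simp
  next
    case False
    have "has_laplace (Suc m) (\<lambda>xs. g (nths xs (- I)) * f (nths xs (- (- I))))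
        (\<lambda>ts. G (nths ts (- I)) * F (nths ts (- (- I))))"
      by (rule step[OF Suc.prems(2,1,4)]) (use Suc.prems(3) False in auto)
    thus ?thesis by (simp only: double_compl mult.commute[of "g _"] mult.commute[of "G _"])
  qed
qed

subsection \<open>The Laplace transform of volumes\<close>

lemma has_bochner_integral_power_exp:
  assumes "0 < (l::real)"
  shows "has_bochner_integral lborel (\<lambda>x. indicator {0..} x * (x ^ k * exp (- l * x))) (fact k / l ^ Suc k)"
proof (rule has_bochner_integral_nn_integral)
  have "(\<integral>\<^sup>+ x. ennreal (indicator {0..} x * (x ^ k * exp (- l * x))) \<partial>lborel) =
      (\<integral>\<^sup>+ x. ennreal (fact k / l ^ Suc k) * ennreal (erlang_density k l x * x ^ 0) \<partial>lborel)"
  proof (rule nn_integral_cong)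
    fix x :: real
    have eq: "indicator {0..} x * (x ^ k * exp (- l * x)) = (fact k / l ^ Suc k) * (erlang_density k l x * x ^ 0)"
      using assms by (auto simp: erlang_density_def field_simps indicator_def)
    show "ennreal (indicator {0..} x * (x ^ k * exp (- l * x))) =
        ennreal (fact k / l ^ Suc k) * ennreal (erlang_density k l x * x ^ 0)"
      unfolding eq by (intro ennreal_mult) (use assms in auto)
  qed
  also have "\<dots> = ennreal (fact k / l ^ Suc k) * (\<integral>\<^sup>+ x. ennreal (erlang_density k l x * x ^ 0) \<partial>lborel)"
    by (rule nn_integral_cmult) simp
  also have "\<dots> = ennreal (fact k / l ^ Suc k)"
    using nn_integral_erlang_ith_moment[OF assms, of k 0] by simp
  finally show "(\<integral>\<^sup>+ x. ennreal (indicator {0..} x * (x ^ k * exp (- l * x))) \<partial>lborel) =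
      ennreal (fact k / l ^ Suc k)" .
qed (use assms in \<open>auto simp: indicator_def\<close>)

lemma set_integrable_power_exp:
  assumes "0 < Re t"
  shows "set_integrable lborel {0..} (\<lambda>x. of_real x ^ k * exp (- (of_real x * t)))"
proof -
  have "integrable lborel (\<lambda>x. indicator {0..} x * (x ^ k * exp (- Re t * x)))"
    using has_bochner_integral_power_exp[OF assms, of k] by (auto simp: has_bochner_integral_iff)
  thus ?thesis unfolding set_integrable_def
    by (rule Bochner_Integration.integrable_bound)
       (auto simp: norm_mult norm_power indicator_def mult.commute)
qed

lemma set_integral_FTC_at_top:
  fixes f F :: "real \<Rightarrow> complex"
  assumes F: "\<And>x. (F has_vector_derivative f x) (at x)" and f: "\<And>x. isCont f x"
    and int: "set_integrable lborel {0..} f" and lim: "(F \<longlongrightarrow> 0) at_top"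
  shows "(LINT x:{0..}|lborel. f x) = - F 0"
proof -
  have "set_integrable lborel {0<..} f" by (rule set_integrable_subset[OF int]) auto
  moreover have "isCont F 0"
    using F[of 0] by (rule has_vector_derivative_continuous)
  hence "(F \<longlongrightarrow> F 0) (at_right 0)"
    by (auto simp: isCont_def intro: tendsto_within_subset)
  ultimately have "(LBINT x=ereal 0..\<infinity>. f x) = 0 - F 0"
    by (intro interval_integral_FTC_integrable F f) (use lim F in \<open>simp_all add: ereal_tendsto_simps\<close>)
  moreover have "(LINT x:{0..}|lborel. f x) = (LINT x:{0<..}|lborel. f x)"
    unfolding set_lebesgue_integral_def
  proof (rule integral_cong_AE)
    show "(\<lambda>x. indicat_real {0..} x *\<^sub>R f x) \<in> borel_measurable lborel"
      using int unfolding set_integrable_def by auto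
    show "(\<lambda>x. indicat_real {0<..} x *\<^sub>R f x) \<in> borel_measurable lborel"
      using \<open>set_integrable lborel {0<..} f\<close> unfolding set_integrable_def by auto
    show "AE x in lborel. indicat_real {0..} x *\<^sub>R f x = indicat_real {0<..} x *\<^sub>R f x"
      using AE_lborel_singleton[of "0::real"] by eventually_elim (auto simp: indicator_def)
  qed
  ultimately show ?thesis by (simp add: interval_integral_to_infinity_eq)
qed

lemma tendsto_power_exp_neg:
  assumes "0 < Re t"
  shows "((\<lambda>x. of_real x ^ k * exp (- (of_real x * t))) \<longlongrightarrow> 0) at_top"
proof (rule tendsto_norm_zero_cancel)
  define l where "l = Re t"
  have l: "0 < l" using assms by (simp add: l_def)
  have "filterlim (\<lambda>x. l * x) at_top at_top"
    by (rule filterlim_tendsto_pos_mult_at_top[OF tendsto_const l filterlim_ident])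
  from filterlim_compose[OF tendsto_power_div_exp_0 this]
  have "((\<lambda>x. (1 / l ^ k) * ((l * x) ^ k / exp (l * x))) \<longlongrightarrow> (1 / l ^ k) * 0) at_top"
    by (intro tendsto_mult tendsto_const)
  moreover have "(1 / l ^ k) * ((l * x) ^ k / exp (l * x)) = norm (of_real x ^ k * exp (- (of_real x * t)))"
    if "0 \<le> x" for x
  proof -
    have "norm (of_real x ^ k * exp (- (of_real x * t))) = x ^ k * exp (- (l * x))"
      using that by (simp add: norm_mult norm_power l_def mult.commute)
    thus ?thesis using l by (simp add: power_mult_distrib exp_minus divide_inverse)
  qed
  hence "eventually (\<lambda>x. (1 / l ^ k) * ((l * x) ^ k / exp (l * x)) =
      norm (of_real x ^ k * exp (- (of_real x * t)))) at_top"
    by (intro eventually_mono[OF eventually_ge_at_top[of 0]])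
  ultimately show "((\<lambda>x. norm (of_real x ^ k * exp (- (of_real x * t)))) \<longlongrightarrow> 0) at_top"
    by (simp add: tendsto_cong)
qed

text \<open>Integration by parts for complex \<open>t\<close>: the primitive
  \<open>- x^k * exp (- x * t) / t\<close> yields a recursion in \<open>k\<close>. Its boundary
  value at 0 is nonzero only for \<open>k = 0\<close>, and there the term with \<open>k - 1\<close>
  has coefficient 0, so truncated subtraction does no harm.\<close>

lemma laplace_power:
  assumes "0 < Re t"
  shows "(LINT x:{0..}|lborel. of_real x ^ k * exp (- (of_real x * t))) = fact k * inverse t ^ Suc k"
proof -
  have t: "t \<noteq> 0" using assms by auto
  let ?p = "\<lambda>k x. of_real x ^ k * exp (- (of_real x * t)) :: complex"
  have int: "set_integrable lborel {0..} (?p k)" for k by (rule set_integrable_power_exp[OF assms])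
  have "(LINT x:{0..}|lborel. ?p k x - of_nat k / t * ?p (k - 1) x) = - (- (?p k 0 / t))" for k
  proof (rule set_integral_FTC_at_top)
    show "((\<lambda>x. - (?p k x / t)) has_vector_derivative ?p k x - of_nat k / t * ?p (k - 1) x) (at x)" for x
    proof -
      have "((\<lambda>z. - (z ^ k * exp (- (z * t)) / t)) has_field_derivative
          ?p k x - of_nat k / t * ?p (k - 1) x) (at (of_real x))"
        using t by (auto intro!: derivative_eq_intros simp: field_simps simp del: power_Suc)
      thus ?thesis by (rule has_vector_derivative_real_field)
    qed
    show "((\<lambda>x. - (?p k x / t)) \<longlongrightarrow> 0) at_top"
      using tendsto_minus[OF tendsto_divide[OF tendsto_power_exp_neg[OF assms, of k] tendsto_const t]] by simp
    show "set_integrable lborel {0..} (\<lambda>x. ?p k x - of_nat k / t * ?p (k - 1) x)"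
      by (intro set_integral_diff set_integrable_mult_right int)
  qed (intro continuous_intros)
  moreover have "(LINT x:{0..}|lborel. ?p k x - of_nat k / t * ?p (k - 1) x) =
      (LINT x:{0..}|lborel. ?p k x) - of_nat k / t * (LINT x:{0..}|lborel. ?p (k - 1) x)" for k
    by (subst set_integral_diff) (auto intro!: set_integrable_mult_right int)
  ultimately have rec: "(LINT x:{0..}|lborel. ?p k x) = of_nat k / t * (LINT x:{0..}|lborel. ?p (k - 1) x) + ?p k 0 / t" for k
    by (simp add: algebra_simps)
  show ?thesis
  proof (induction k)
    case 0
    show ?case using rec[of 0] by (simp add: inverse_eq_divide)
  next
    case (Suc k)
    have "(LINT x:{0..}|lborel. ?p (Suc k) x) = of_nat (Suc k) / t * (fact k * inverse t ^ Suc k)"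
      using rec[of "Suc k"] Suc.IH by simp
    thus ?case using t by (simp add: field_simps)
  qed
qed

text \<open>Once the polynomial is expanded, each integrand is a product of functions of one
  coordinate, and Fubini reduces the claim to \<open>laplace_power\<close>.\<close>

lemma laplace_integral_eq:
  assumes "has_laplace n f F" "length ts = n" "\<And>t. t \<in> set ts \<Longrightarrow> 0 < Re t"
  shows "laplace_integral f ts = F ts"
proof -
  interpret product_sigma_finite "\<lambda>_ :: nat. lborel :: real measure" by standard
  obtain S c where "laplace_rep n f F S c" using assms(1) unfolding has_laplace_def by blast
  note S = laplace_repD[OF this]
  define h where "h e i x = indicator {0..} x *\<^sub>R (of_real x ^ e i * exp (- (of_real x * ts ! i)))"
    for e :: "nat \<Rightarrow> nat" and i and x :: real
  have h: "integrable lborel (h e i)" "integral\<^sup>L lborel (h e i) = fact (e i) * inverse (ts ! i) ^ Suc (e i)"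
    if "i < n" for e i
  proof -
    have "0 < Re (ts ! i)" using assms(2,3) that by simp
    thus "integrable lborel (h e i)" "integral\<^sup>L lborel (h e i) = fact (e i) * inverse (ts ! i) ^ Suc (e i)"
      using set_integrable_power_exp[of "ts ! i" "e i"] laplace_power[of "ts ! i" "e i"]
      unfolding set_integrable_def set_lebesgue_integral_def h_def by auto
  qed
  have eq: "indicator ({..<n} \<rightarrow>\<^sub>E {0..}) b *\<^sub>R
        (f (map (\<lambda>i. of_real (b i)) [0..<n]) * exp (- (\<Sum>i<n. of_real (b i) * ts ! i))) =
      (\<Sum>e\<in>S. c e * (\<Prod>i<n. h e i (b i)))" if b: "b \<in> space (\<Pi>\<^sub>M i\<in>{..<n}. (lborel :: real measure))" for b
  proof -
    \<comment> \<open>Points of the product space are extensional outside \<open>{..<n}\<close>, so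
      membership in the product set is a condition on the coordinates below \<open>n\<close>
      only.\<close>
    have ind: "indicator ({..<n} \<rightarrow>\<^sub>E {0..}) b = (\<Prod>i<n. indicator {0..} (b i) :: real)"
    proof (cases "\<forall>i<n. 0 \<le> b i")
      case True
      thus ?thesis using b by (auto simp: space_PiM PiE_iff indicator_def)
    next
      case False
      then obtain i where i: "i < n" "\<not> 0 \<le> b i" by auto
      hence "(\<Prod>i<n. indicator {0..} (b i) :: real) = 0" by (intro prod_zero bexI[of _ i]) auto
      moreover have "b \<notin> {..<n} \<rightarrow>\<^sub>E {0..}" using i by (auto simp: PiE_iff)
      ultimately show ?thesis by simp
    qed
    have "(\<Prod>i<n. h e i (b i)) = (\<Prod>i<n. indicator {0..} (b i) :: real) *\<^sub>R
        ((\<Prod>i<n. of_real (b i) ^ e i) * exp (- (\<Sum>i<n. of_real (b i) * ts ! i)))" for e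
      unfolding h_def by (simp add: scaleR_conv_of_real prod.distrib exp_sum sum_negf[symmetric])
    thus ?thesis unfolding ind using S(2)
      by (simp add: sum_distrib_right scaleR_sum_right mult.assoc)
  qed
  have "laplace_integral f ts = (\<integral>b. (\<Sum>e\<in>S. c e * (\<Prod>i<n. h e i (b i))) \<partial>(\<Pi>\<^sub>M i\<in>{..<n}. lborel))"
    unfolding laplace_integral_def Let_def set_lebesgue_integral_def assms(2)
    by (rule Bochner_Integration.integral_cong) (use eq in auto)
  also have "\<dots> = (\<Sum>e\<in>S. c e * (\<integral>b. (\<Prod>i<n. h e i (b i)) \<partial>(\<Pi>\<^sub>M i\<in>{..<n}. lborel)))"
  proof (subst Bochner_Integration.integral_sum)
    show "integrable (\<Pi>\<^sub>M i\<in>{..<n}. lborel) (\<lambda>b. c e * (\<Prod>i<n. h e i (b i)))" for e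
      by (intro integrable_mult_right product_integrable_prod h) auto
  qed simp
  also have "\<dots> = (\<Sum>e\<in>S. c e * (\<Prod>i<n. integral\<^sup>L lborel (h e i)))"
    by (intro sum.cong refl arg_cong2[of _ _ _ _ "(*)"] product_integral_prod h) auto
  also have "\<dots> = F ts"
  proof -
    have "0 \<notin> set ts" using assms(3)[of 0] by auto
    thus ?thesis using S(3) assms(2) h(2) by simp
  qed
  finally show ?thesis .
qed

lemma has_laplace_imp_inv_poly_fun:
  assumes "has_laplace n f F"
  shows "inv_poly_fun n F"
proof -
  obtain S c where "laplace_rep n f F S c" using assms unfolding has_laplace_def by blast
  note S = laplace_repD[OF this]
  define p where "p xs = (\<Sum>e\<in>S. c e * (\<Prod>i<n. fact (e i) * (xs ! i) ^ Suc (e i)))" for xs :: "complex list"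
  \<comment> \<open>The shift acts on every coordinate, also beyond \<open>n\<close>, so that
    subtracting 1 everywhere undoes it.\<close>
  define s where "s e i = Suc (e i)" for e :: "nat \<Rightarrow> nat" and i
  define c' where "c' e = c (\<lambda>i. e i - 1) * (\<Prod>i<n. fact (e i - 1))" for e :: "nat \<Rightarrow> nat"
  have inj: "inj_on s S"
  proof (rule inj_onI)
    fix x y assume "s x = s y"
    hence "s x i = s y i" for i by simp
    thus "x = y" unfolding s_def by auto
  qed
  have "p xs = (\<Sum>e\<in>s ` S. c' e * (\<Prod>i<n. (xs ! i) ^ e i))" for xs
    unfolding p_def sum.reindex[OF inj] c'_def s_def by (simp add: prod.distrib mult_ac)
  hence "poly_fun n p" unfolding poly_fun_def
    by (intro exI[of _ "s ` S"] exI[of _ c']) (simp add: S(1))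
  moreover have "\<forall>ts. length ts = n \<and> 0 \<notin> set ts \<longrightarrow> F ts = p (map inverse ts)"
    using S(3) unfolding p_def by simp
  ultimately show ?thesis unfolding inv_poly_fun_def by blast
qed

lemma poly_fun_imp_has_laplace:
  assumes "poly_fun n f"
  obtains F where "has_laplace n f F"
proof -
  obtain S :: "(nat \<Rightarrow> nat) set" and c where S: "finite S"
     "\<forall>xs. length xs = n \<longrightarrow> f xs = (\<Sum>e\<in>S. c e * (\<Prod>i<n. (xs ! i) ^ e i))"
    using assms unfolding poly_fun_def by blast
  thus ?thesis
    by (intro that[of "\<lambda>ts. \<Sum>e\<in>S. c e * (\<Prod>i<n. fact (e i) * inverse (ts ! i) ^ Suc (e i))"])
       (unfold has_laplace_def laplace_rep_def, blast)
qed

text \<open>Read as polynomials in the inverse variables, \<open>F\<close> and \<open>G\<close>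
  agree at positive reals, hence everywhere. The transforms \<open>P\<close> and \<open>Q\<close>
  only bring the difference into the form of \<open>has_laplace_eq_0\<close>.\<close>

lemma inv_poly_fun_unique:
  assumes "inv_poly_fun n F" "inv_poly_fun n G"
    "\<And>ts. length ts = n \<Longrightarrow> (\<forall>t\<in>set ts. 0 < Re t) \<Longrightarrow> F ts = G ts"
    "length ts = n" "0 \<notin> set ts"
  shows "F ts = G ts"
proof -
  obtain p where p: "poly_fun n p" "\<forall>ts. length ts = n \<and> 0 \<notin> set ts \<longrightarrow> F ts = p (map inverse ts)"
    using assms(1) unfolding inv_poly_fun_def by blast
  obtain q where q: "poly_fun n q" "\<forall>ts. length ts = n \<and> 0 \<notin> set ts \<longrightarrow> G ts = q (map inverse ts)"
    using assms(2) unfolding inv_poly_fun_def by blast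
  obtain P where P: "has_laplace n p P" by (rule poly_fun_imp_has_laplace[OF p(1)])
  obtain Q where Q: "has_laplace n q Q" by (rule poly_fun_imp_has_laplace[OF q(1)])
  have "(\<forall>ts. length ts = n \<and> 0 \<notin> set ts \<longrightarrow> P ts + (-1) * Q ts = 0) \<and>
      (\<forall>xs. length xs = n \<longrightarrow> p xs + (-1) * q xs = 0)"
  proof (rule has_laplace_eq_0[OF has_laplace_add[OF P has_laplace_cmult[OF Q]]])
    fix rs :: "real list" assume rs: "length rs = n" "\<forall>r\<in>set rs. 0 < r"
    define ts where "ts = map (\<lambda>r. complex_of_real (inverse r)) rs"
    have "map inverse ts = map complex_of_real rs" unfolding ts_def by simp
    moreover have "length ts = n" "0 \<notin> set ts" "\<forall>t\<in>set ts. 0 < Re t"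
      using rs unfolding ts_def by auto
    ultimately show "p (map of_real rs) + (-1) * q (map of_real rs) = 0"
      using assms(3)[of ts] p(2) q(2) by simp
  qed
  thus ?thesis using p(2) q(2) assms(4,5) by simp
qed

text \<open>Justifies the definite description: \<open>F\<close> is a witness by
  \<open>laplace_integral_eq\<close>, and any other witness agrees with it where all real parts are
  positive, hence at all nonzero arguments.\<close>

lemma laplace_transform_eq:
  assumes "has_laplace n (V g) F" "length ts = n" "0 \<notin> set ts"
  shows "laplace_transform V g ts = F ts"
  unfolding laplace_transform_def
proof (rule the_equality)
  show "\<exists>f. inv_poly_fun (length ts) f \<and>
        (\<forall>s. length s = length ts \<and> (\<forall>x\<in>set s. 0 < Re x) \<longrightarrow> f s = laplace_integral (V g) s) \<and>
        F ts = f ts"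
    using has_laplace_imp_inv_poly_fun[OF assms(1)] laplace_integral_eq[OF assms(1)] assms(2)
    by (intro exI[of _ F]) auto
next
  fix z assume "\<exists>f. inv_poly_fun (length ts) f \<and>
        (\<forall>s. length s = length ts \<and> (\<forall>x\<in>set s. 0 < Re x) \<longrightarrow> f s = laplace_integral (V g) s) \<and>
        z = f ts"
  then obtain f where f: "inv_poly_fun n f" "z = f ts"
    "\<And>s. length s = n \<Longrightarrow> (\<forall>x\<in>set s. 0 < Re x) \<Longrightarrow> f s = laplace_integral (V g) s"
    using assms(2) by auto
  have "f ts = F ts"
    by (rule inv_poly_fun_unique[OF f(1) has_laplace_imp_inv_poly_fun[OF assms(1)] _ assms(2,3)])
       (use f(3) laplace_integral_eq[OF assms(1)] in auto)
  thus "z = F ts" using f(2) by simp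
qed

lemma has_laplace_permute:
  assumes "has_laplace n f F" "p permutes {..<n}"
  shows "has_laplace n (\<lambda>xs. f (permute_list p xs)) (\<lambda>ts. F (permute_list p ts))"
proof -
  obtain S c where "laplace_rep n f F S c" using assms(1) unfolding has_laplace_def by blast
  note S = laplace_repD[OF this]
  have re: "(\<Prod>i<n. h (p i) (e i)) = (\<Prod>i<n. h i (e (inv p i)))"
    for h :: "nat \<Rightarrow> nat \<Rightarrow> complex" and e :: "nat \<Rightarrow> nat"
    using prod.permute[OF assms(2), of "\<lambda>i. h i (e (inv p i))"] permutes_inverses(2)[OF assms(2)]
    by (simp add: o_def)
  show ?thesis
  proof (rule has_laplaceI[of S n _ c "\<lambda>e i. e (inv p i)"])
    show "f (permute_list p xs) = (\<Sum>e\<in>S. c e * (\<Prod>i<n. xs ! i ^ e (inv p i)))" if "length xs = n" for xs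
      using S(2) that re[of "\<lambda>i k. xs ! i ^ k"] assms(2) by (simp add: permute_list_nth)
    show "F (permute_list p ts) =
        (\<Sum>e\<in>S. c e * (\<Prod>i<n. fact (e (inv p i)) * inverse (ts ! i) ^ Suc (e (inv p i))))"
      if "length ts = n" "0 \<notin> set ts" for ts
      using S(3) that re[of "\<lambda>i k. fact k * inverse (ts ! i) ^ Suc k"] assms(2)
      by (simp add: permute_list_nth)
  qed (rule S(1))
qed

text \<open>Reflection multiplies \<open>x^e\<close> by \<open>(-1)^e\<close> but
  \<open>1/x^(e+1)\<close> by \<open>(-1)^(e+1)\<close>. Through this extra sign, evenness of a
  volume becomes oddness of its transform.\<close>

lemma has_laplace_reflect:
  assumes "has_laplace n f F" "i < n"
  shows "has_laplace n (\<lambda>xs. f (xs[i := - (xs ! i)])) (\<lambda>ts. - F (ts[i := - (ts ! i)]))"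
proof -
  obtain S c where "laplace_rep n f F S c" using assms(1) unfolding has_laplace_def by blast
  note S = laplace_repD[OF this]
  have split: "prod h {..<n} = h i * prod h ({..<n} - {i})" for h :: "nat \<Rightarrow> complex"
    using assms(2) by (intro prod.remove) auto
  have neq: "(\<Prod>j\<in>{..<n} - {i}. h (xs[i := y] ! j) j) = (\<Prod>j\<in>{..<n} - {i}. h (xs ! j) j)"
    for h :: "complex \<Rightarrow> nat \<Rightarrow> complex" and xs y
    by (intro prod.cong) auto
  have minus: "(- y) ^ k = (-1) ^ k * y ^ k" for y :: complex and k
    by (simp add: power_mult_distrib[symmetric])
  show ?thesis
  proof (rule has_laplaceI[of S n _ "\<lambda>e. (-1) ^ e i * c e" "\<lambda>e. e"])
    show "f (xs[i := - (xs ! i)]) = (\<Sum>e\<in>S. (-1) ^ e i * c e * (\<Prod>i<n. xs ! i ^ e i))" if "length xs = n" for xs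
      using S(2) that assms(2)
      by (simp add: split neq[of "\<lambda>y j. y ^ _ j"] minus[of "xs ! i"] mult_ac)
    show "- F (ts[i := - (ts ! i)]) =
        (\<Sum>e\<in>S. (-1) ^ e i * c e * (\<Prod>i<n. fact (e i) * inverse (ts ! i) ^ Suc (e i)))"
      if ts: "length ts = n" "0 \<notin> set ts" for ts
    proof -
      have "0 \<notin> set (ts[i := - (ts ! i)])"
        using ts assms(2) by (auto simp: in_set_conv_nth nth_list_update split: if_splits)
      thus ?thesis
        using S(3) ts assms(2)
        by (simp add: split neq[of "\<lambda>y j. fact (_ j) * inverse y ^ Suc (_ j)"]
           minus[of "inverse (ts ! i)" "Suc _"] mult_ac sum_negf[symmetric] del: power_Suc)
           (simp add: mult_ac)
    qed
  qed (rule S(1))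
qed

lemma volume_familyD:
  assumes "volume_family V" "1 \<le> n" "1 \<le> 2 * int g - 2 + int n"
  shows "poly_fun n (V g)"
    and "\<forall>bs cs. length bs = n \<and> mset bs = mset cs \<longrightarrow> V g bs = V g cs"
    and "\<forall>bs i. length bs = n \<and> i < n \<longrightarrow> V g (bs[i := - (bs ! i)]) = V g bs"
  using assms unfolding volume_family_def by blast+

lemma has_laplace_volume:
  assumes "volume_family V" "1 \<le> n" "1 \<le> 2 * int g - 2 + int n"
  shows "has_laplace n (V g) (laplace_transform V g)"
proof -
  obtain F where F: "has_laplace n (V g) F"
    by (rule poly_fun_imp_has_laplace[OF volume_familyD(1)[OF assms]])
  show ?thesis
    by (rule has_laplace_cong[OF F]) (use laplace_transform_eq[of n V g, OF F] in auto)
qed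

lemma odd_inv_poly_laplace_transform:
  assumes V: "volume_family V"
  shows "odd_inv_poly_family (laplace_transform V)"
  unfolding odd_inv_poly_family_def
proof (intro allI impI conjI; elim conjE)
  fix g n :: nat assume gn: "1 \<le> n" "1 \<le> 2 * int g - 2 + int n"
  let ?F = "laplace_transform V g"
  note F = has_laplace_volume[OF V gn]
  show "inv_poly_fun n ?F" by (rule has_laplace_imp_inv_poly_fun[OF F])
  show "?F ts = ?F us" if ts: "length ts = n" "0 \<notin> set ts" "mset ts = mset us" for ts us
  proof -
    obtain p where p: "p permutes {..<length us}" "permute_list p us = ts"
      using mset_eq_permutation[OF ts(3)] by blast
    have us: "length us = n" "0 \<notin> set us"
      using ts mset_eq_length[OF ts(3)] mset_eq_setD[OF ts(3)] by auto
    have "?F (permute_list p us) = ?F us"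
    proof (rule has_laplace_unique[OF has_laplace_permute[OF F] F _ us])
      show "p permutes {..<n}" using p us by simp
      thus "V g (permute_list p (map of_real rs)) = V g (map of_real rs)" if "length rs = n" for rs :: "real list"
        using volume_familyD(2)[OF V gn] that by simp
    qed
    thus ?thesis using p by simp
  qed
  show "?F (ts[i := - (ts ! i)]) = - ?F ts" if ts: "length ts = n" "0 \<notin> set ts" "i < n" for ts i
  proof -
    have even: "V g (bs[i := - (bs ! i)]) = V g bs" if "length bs = n" for bs
      using volume_familyD(3)[OF V gn] that ts(3) by blast
    have "- ?F (ts[i := - (ts ! i)]) = ?F ts"
      by (rule has_laplace_unique[OF has_laplace_reflect[OF F ts(3)] F even ts(1,2)]) simp
    thus ?thesis by (simp add: minus_equation_iff)
  qed
qed

lemma has_laplace_stab_volume: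
  assumes "volume_family V" "1 \<le> n"
  shows "has_laplace n (stab V g) (stab (laplace_transform V) g)"
proof (cases "0 \<le> g \<and> 0 < 2 * g - 2 + int n")
  case True
  have "has_laplace n (V (nat g)) (laplace_transform V (nat g))"
    by (rule has_laplace_volume[OF assms]) (use True in auto)
  thus ?thesis by (rule has_laplace_cong) (use True in \<open>auto simp: stab_def\<close>)
next
  case False
  thus ?thesis by (intro has_laplace_cong[OF has_laplace_0]) (auto simp: stab_def)
qed

subsection \<open>Integrals over the quadrant and over a triangle\<close>

text \<open>Integration by parts trades a factor \<open>z - x\<close> for a factor \<open>x\<close>:
  the primitive \<open>x^(p+1) * (z - x)^(q+1) / (p+1)\<close> vanishes at both ends. Hence an
  induction on \<open>q\<close> with \<open>p\<close> free.\<close>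

lemma beta_nat_has_integral:
  fixes z :: real
  assumes "0 \<le> z"
  shows "((\<lambda>x. x ^ p * (z - x) ^ q) has_integral fact p * fact q / fact (p + q + 1) * z ^ (p + q + 1)) {0..z}"
proof (induction q arbitrary: p)
  case 0
  have "((\<lambda>x. x ^ p) has_integral (z ^ Suc p / real (Suc p) - 0 ^ Suc p / real (Suc p))) {0..z}"
    by (rule fundamental_theorem_of_calculus[OF assms])
       (auto intro!: derivative_eq_intros simp: has_real_derivative_iff_has_vector_derivative[symmetric] simp del: of_nat_Suc power_Suc)
  thus ?case by (simp add: field_simps del: of_nat_Suc)
next
  case (Suc q)
  have "((\<lambda>x. x ^ p * (z - x) ^ Suc q - real (Suc q) / real (Suc p) * (x ^ Suc p * (z - x) ^ q)) has_integral
      (z ^ Suc p * (z - z) ^ Suc q / real (Suc p) - 0 ^ Suc p * (z - 0) ^ Suc q / real (Suc p))) {0..z}"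
  proof (rule fundamental_theorem_of_calculus[OF assms])
    fix x :: real
    have "((\<lambda>x. x ^ Suc p * (z - x) ^ Suc q / real (Suc p)) has_real_derivative
      (x ^ p * (z - x) ^ Suc q - real (Suc q) / real (Suc p) * (x ^ Suc p * (z - x) ^ q))) (at x within {0..z})"
      by (auto intro!: derivative_eq_intros simp: field_simps simp del: of_nat_Suc power_Suc)
    thus "((\<lambda>x. x ^ Suc p * (z - x) ^ Suc q / real (Suc p)) has_vector_derivative
      (x ^ p * (z - x) ^ Suc q - real (Suc q) / real (Suc p) * (x ^ Suc p * (z - x) ^ q))) (at x within {0..z})"
      by (simp only: has_real_derivative_iff_has_vector_derivative)
  qed
  from has_integral_add[OF this has_integral_mult_right[OF Suc.IH[of "Suc p"], of "real (Suc q) / real (Suc p)"]]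
  have *: "((\<lambda>x. x ^ p * (z - x) ^ Suc q) has_integral real (Suc q) / real (Suc p) *
      (fact (Suc p) * fact q / fact (Suc p + q + 1) * z ^ (Suc p + q + 1))) {0..z}"
    by simp
  have eq: "real (Suc q) / real (Suc p) * (fact (Suc p) * fact q / fact (Suc p + q + 1) * z ^ (Suc p + q + 1)) =
      fact p * fact (Suc q) / fact (p + Suc q + 1) * z ^ (p + Suc q + 1)"
    unfolding fact_Suc[of p] fact_Suc[of q] by (simp del: of_nat_Suc fact_Suc)
  show ?case by (rule *[unfolded eq])
qed

lemma nn_integral_beta_nat:
  "(\<integral>\<^sup>+ x. ennreal (indicator {0..z} x * (x ^ p * (z - x) ^ q)) \<partial>lborel) =
    ennreal (indicator {0..} z * (fact p * fact q / fact (p + q + 1) * z ^ (p + q + 1)))"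
proof (cases "0 \<le> z")
  case True
  define f where "f x = (if x \<in> {0..z} then x ^ p * (z - x) ^ q else 0)" for x
  have int: "(f has_integral fact p * fact q / fact (p + q + 1) * z ^ (p + q + 1)) UNIV"
    unfolding f_def has_integral_restrict_UNIV by (rule beta_nat_has_integral[OF True])
  have "f \<in> borel_measurable borel" unfolding f_def by measurable
  hence "integral\<^sup>N lborel f = ennreal (fact p * fact q / fact (p + q + 1) * z ^ (p + q + 1))"
    by (rule nn_integral_has_integral_lborel[OF _ _ int]) (simp add: f_def)
  moreover have "f x = indicator {0..z} x * (x ^ p * (z - x) ^ q)" for x
    by (auto simp: f_def indicator_def)
  ultimately show ?thesis using True by simp
qed (auto simp: indicator_def)

text \<open>The substitution \<open>z = x + y\<close> separates a Beta integral over
  \<open>x\<close> from an integral over \<open>z\<close>. Nonnegativity permits Tonelli, so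
  integrability comes out together with the value. The weight \<open>f\<close> is the indicator of
  \<open>{..b}\<close> for (N) and the kernel \<open>H\<close> for (M).\<close>

lemma has_bochner_integral_simplex:
  fixes f :: "real \<Rightarrow> real"
  assumes f: "\<And>z. 0 \<le> f z" "f \<in> borel_measurable borel"
    and I: "has_bochner_integral lborel (\<lambda>z. indicator {0..} z * (z ^ (p + q + 1) * f z)) I"
  shows "has_bochner_integral lborel
     (\<lambda>(x, y). indicator ({0..} \<times> {0..}) (x, y) * (x ^ p * y ^ q * f (x + y)))
     (fact p * fact q / fact (p + q + 1) * I)"
proof (rule has_bochner_integral_nn_integral)
  note f(2)[measurable]
  let ?G = "\<lambda>(x, y). indicator ({0..} \<times> {0..}) (x, y) * (x ^ p * y ^ q * f (x + y)) :: real"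
  let ?c = "fact p * fact q / fact (p + q + 1) :: real"
  have G[measurable]: "?G \<in> borel_measurable (borel \<Otimes>\<^sub>M borel)" by measurable
  thus "?G \<in> borel_measurable lborel" by (simp add: borel_prod)
  show "AE x in lborel. 0 \<le> ?G x" by (auto simp: indicator_def f)
  have I0: "0 \<le> I"
    using I f by (auto simp: has_bochner_integral_iff intro!: integral_nonneg_AE split: split_indicator)
  thus "0 \<le> ?c * I" by simp
  have "(\<integral>\<^sup>+ x. ennreal (?G x) \<partial>lborel) = (\<integral>\<^sup>+ x. \<integral>\<^sup>+ y. ennreal (?G (x, y)) \<partial>lborel \<partial>lborel)"
    unfolding lborel_prod[symmetric] by (intro lborel.nn_integral_fst[symmetric]) measurable
  also have "\<dots> = (\<integral>\<^sup>+ x. \<integral>\<^sup>+ z. ennreal (?G (x, - x + 1 * z)) \<partial>lborel \<partial>lborel)"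
  proof (rule nn_integral_cong)
    fix x :: real
    have "(\<lambda>y. ennreal (?G (x, y))) \<in> borel_measurable borel" by measurable
    from nn_integral_real_affine[OF this, of 1 "- x"]
    show "(\<integral>\<^sup>+ y. ennreal (?G (x, y)) \<partial>lborel) = (\<integral>\<^sup>+ z. ennreal (?G (x, - x + 1 * z)) \<partial>lborel)"
      by simp
  qed
  also have "\<dots> = (\<integral>\<^sup>+ z. \<integral>\<^sup>+ x. ennreal (?G (x, - x + 1 * z)) \<partial>lborel \<partial>lborel)"
    by (rule lborel_pair.Fubini') measurable
  also have "\<dots> = (\<integral>\<^sup>+ z. ennreal (f z) * (\<integral>\<^sup>+ x. ennreal (indicator {0..z} x * (x ^ p * (z - x) ^ q)) \<partial>lborel) \<partial>lborel)"
  proof (rule nn_integral_cong)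
    fix z
    have "(\<integral>\<^sup>+ x. ennreal (?G (x, - x + 1 * z)) \<partial>lborel) =
        (\<integral>\<^sup>+ x. ennreal (f z) * ennreal (indicator {0..z} x * (x ^ p * (z - x) ^ q)) \<partial>lborel)"
      by (intro nn_integral_cong)
         (auto simp: indicator_def f ennreal_mult'[symmetric] mult_ac)
    also have "\<dots> = ennreal (f z) * (\<integral>\<^sup>+ x. ennreal (indicator {0..z} x * (x ^ p * (z - x) ^ q)) \<partial>lborel)"
      by (rule nn_integral_cmult) measurable
    finally show "(\<integral>\<^sup>+ x. ennreal (?G (x, - x + 1 * z)) \<partial>lborel) = \<dots>" .
  qed
  also have "\<dots> = (\<integral>\<^sup>+ z. ennreal ?c * ennreal (indicator {0..} z * (z ^ (p + q + 1) * f z)) \<partial>lborel)"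
    unfolding nn_integral_beta_nat
    by (intro nn_integral_cong) (auto simp: indicator_def f ennreal_mult'[symmetric] mult_ac)
  also have "\<dots> = ennreal ?c * (\<integral>\<^sup>+ z. ennreal (indicator {0..} z * (z ^ (p + q + 1) * f z)) \<partial>lborel)"
    by (rule nn_integral_cmult) measurable
  also have "(\<integral>\<^sup>+ z. ennreal (indicator {0..} z * (z ^ (p + q + 1) * f z)) \<partial>lborel) = ennreal I"
    using I f by (subst nn_integral_eq_integral) (auto simp: has_bochner_integral_iff split: split_indicator)
  also have "ennreal ?c * ennreal I = ennreal (?c * I)"
    by (rule ennreal_mult[symmetric]) (use I0 in auto)
  finally show "(\<integral>\<^sup>+ x. ennreal (?G x) \<partial>lborel) = ennreal (?c * I)" .
qed

abbreviation triangle :: "real \<Rightarrow> (real \<times> real) set" where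
  "triangle b \<equiv> {(x, y). 0 \<le> x \<and> 0 \<le> y \<and> x + y \<le> b}"

lemma has_bochner_integral_triangle:
  assumes "0 \<le> (b::real)"
  shows "has_bochner_integral lborel
     (\<lambda>(x, y). indicator (triangle b) (x, y) * (x ^ p * y ^ q))
     (fact p * fact q / fact (p + q + 2) * b ^ (p + q + 2))"
proof -
  have int: "has_bochner_integral lborel (\<lambda>z. indicator {0..b} z *\<^sub>R z ^ (p + q + 1))
      (b ^ (Suc (p + q + 1)) / real (Suc (p + q + 1)) - 0 ^ (Suc (p + q + 1)) / real (Suc (p + q + 1)))"
  proof (rule has_bochner_integral_FTC_Icc[OF assms])
    fix x :: real
    have "((\<lambda>x. x ^ (Suc (p + q + 1)) / real (Suc (p + q + 1))) has_real_derivative x ^ (p + q + 1)) (at x within {0..b})"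
      by (auto intro!: derivative_eq_intros simp del: of_nat_Suc power_Suc)
    thus "((\<lambda>x. x ^ (Suc (p + q + 1)) / real (Suc (p + q + 1))) has_vector_derivative x ^ (p + q + 1)) (at x within {0..b})"
      by (simp only: has_real_derivative_iff_has_vector_derivative)
  qed (intro continuous_intros)
  have "(\<lambda>z. indicator {0..b} z *\<^sub>R z ^ (p + q + 1)) =
      (\<lambda>z. indicator {0..} z * (z ^ (p + q + 1) * indicator {..b} z :: real))"
    by (auto simp: indicator_def)
  with int have "has_bochner_integral lborel (\<lambda>z. indicator {0..} z * (z ^ (p + q + 1) * indicator {..b} z))
      (b ^ (Suc (p + q + 1)) / real (Suc (p + q + 1)))" by simp
  from has_bochner_integral_simplex[OF _ _ this]
  have "has_bochner_integral lborel
     (\<lambda>(x, y). indicator ({0..} \<times> {0..}) (x, y) * (x ^ p * y ^ q * indicator {..b} (x + y)))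
     (fact p * fact q / fact (p + q + 1) * (b ^ Suc (p + q + 1) / real (Suc (p + q + 1))))" by simp
  moreover have "(\<lambda>(x, y). indicator ({0..} \<times> {0..}) (x, y) * (x ^ p * y ^ q * indicator {..b} (x + y))) =
     (\<lambda>(x, y). indicator (triangle b) (x, y) * (x ^ p * y ^ q) :: real)"
    by (auto simp: indicator_def fun_eq_iff)
  moreover have "fact p * fact q / fact (p + q + 1) * (b ^ Suc (p + q + 1) / real (Suc (p + q + 1))) =
      fact p * fact q / fact (p + q + 2) * b ^ (p + q + 2)"
    by (simp add: field_simps)
  ultimately show ?thesis by (simp only:)
qed

lemma set_lebesgue_integral_weighted_sum:
  fixes w :: "'a \<Rightarrow> 'i \<Rightarrow> real" and c :: "'i \<Rightarrow> complex"
  assumes "\<And>i. i \<in> A \<Longrightarrow> has_bochner_integral M (\<lambda>x. indicator S x * w x i) (I i)"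
  shows "(LINT x:S|M. (\<Sum>i\<in>A. of_real (w x i) * c i)) = (\<Sum>i\<in>A. of_real (I i) * c i)"
proof -
  have "has_bochner_integral M (\<lambda>x. \<Sum>i\<in>A. of_real (indicator S x * w x i) * c i) (\<Sum>i\<in>A. of_real (I i) * c i)"
    by (intro has_bochner_integral_sum has_bochner_integral_mult_left has_bochner_integral_of_real assms)
  moreover have "(\<lambda>x. \<Sum>i\<in>A. of_real (indicator S x * w x i) * c i) =
      (\<lambda>x. indicator S x *\<^sub>R (\<Sum>i\<in>A. of_real (w x i) * c i))"
    by (auto simp: indicator_def fun_eq_iff)
  ultimately show ?thesis unfolding set_lebesgue_integral_def by (auto simp: has_bochner_integral_iff)
qed

subsection \<open>Recursion (N) implies recursion (B)\<close>

text \<open>The right-hand side of (N) consists of integrals that depend on real lengths. It is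
  assigned the transform of a polynomial that agrees with it at positive arguments.\<close>

definition has_laplace_pos :: "nat \<Rightarrow> (real list \<Rightarrow> complex) \<Rightarrow> (complex list \<Rightarrow> complex) \<Rightarrow> bool" where
  "has_laplace_pos n h F \<longleftrightarrow> (\<exists>f. has_laplace n f F \<and>
     (\<forall>rs. length rs = n \<and> (\<forall>r\<in>set rs. 0 < r) \<longrightarrow> h rs = f (map complex_of_real rs)))"

lemma has_laplace_posI:
  assumes "has_laplace n f F"
    "\<And>rs. length rs = n \<Longrightarrow> (\<forall>r\<in>set rs. 0 < r) \<Longrightarrow> h rs = f (map complex_of_real rs)"
  shows "has_laplace_pos n h F"
  using assms unfolding has_laplace_pos_def by blast

lemma has_laplace_pos_add:
  assumes "has_laplace_pos n h F" "has_laplace_pos n k G"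
  shows "has_laplace_pos n (\<lambda>rs. h rs + k rs) (\<lambda>ts. F ts + G ts)"
proof -
  obtain f where f: "has_laplace n f F"
    "\<forall>rs. length rs = n \<and> (\<forall>r\<in>set rs. 0 < r) \<longrightarrow> h rs = f (map complex_of_real rs)"
    using assms(1) unfolding has_laplace_pos_def by blast
  obtain g where g: "has_laplace n g G"
    "\<forall>rs. length rs = n \<and> (\<forall>r\<in>set rs. 0 < r) \<longrightarrow> k rs = g (map complex_of_real rs)"
    using assms(2) unfolding has_laplace_pos_def by blast
  show ?thesis by (rule has_laplace_posI[OF has_laplace_add[OF f(1) g(1)]]) (use f g in simp)
qed

lemma has_laplace_pos_cmult:
  assumes "has_laplace_pos n h F"
  shows "has_laplace_pos n (\<lambda>rs. c * h rs) (\<lambda>ts. c * F ts)"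
proof -
  obtain f where f: "has_laplace n f F"
    "\<forall>rs. length rs = n \<and> (\<forall>r\<in>set rs. 0 < r) \<longrightarrow> h rs = f (map complex_of_real rs)"
    using assms(1) unfolding has_laplace_pos_def by blast
  show ?thesis by (rule has_laplace_posI[OF has_laplace_cmult[OF f(1)]]) (use f in simp)
qed

lemma has_laplace_pos_sum:
  "(\<And>a. a \<in> A \<Longrightarrow> has_laplace_pos n (h a) (F a)) \<Longrightarrow>
    has_laplace_pos n (\<lambda>rs. \<Sum>a\<in>A. h a rs) (\<lambda>ts. \<Sum>a\<in>A. F a ts)"
proof (induction A rule: infinite_finite_induct)
  case (insert a A)
  thus ?case using has_laplace_pos_add[of n "h a" "F a"] by simp
qed (auto intro!: has_laplace_posI[OF has_laplace_0])

lemma has_laplace_pos_unique: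
  assumes "has_laplace n f F" "has_laplace_pos n h G"
    "\<And>rs. length rs = n \<Longrightarrow> (\<forall>r\<in>set rs. (0::real) < r) \<Longrightarrow> f (map of_real rs) = h rs"
    "length ts = n" "0 \<notin> set ts"
  shows "F ts = G ts"
proof -
  obtain k where k: "has_laplace n k G"
    "\<forall>rs. length rs = n \<and> (\<forall>r\<in>set rs. 0 < r) \<longrightarrow> h rs = k (map complex_of_real rs)"
    using assms(2) unfolding has_laplace_pos_def by blast
  show ?thesis by (rule has_laplace_unique[OF assms(1) k(1) _ assms(4,5)]) (use assms(3) k(2) in simp)
qed

lemma has_laplace_ConsConsE:
  assumes "has_laplace (Suc (Suc m)) f F"
  obtains S :: "(nat \<Rightarrow> nat) set" and f' F' where "finite S" "\<And>e. has_laplace m (f' e) (F' e)"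
    "\<And>x y xs. length xs = m \<Longrightarrow> f (x # y # xs) = (\<Sum>e\<in>S. x ^ e 0 * y ^ e 1 * f' e xs)"
    "\<And>s t ts. s \<noteq> 0 \<Longrightarrow> t \<noteq> 0 \<Longrightarrow> 0 \<notin> set ts \<Longrightarrow> length ts = m \<Longrightarrow> F (s # t # ts) =
       (\<Sum>e\<in>S. fact (e 0) * fact (e 1) * F' e ts * inverse s ^ Suc (e 0) * inverse t ^ Suc (e 1))"
proof -
  obtain S c where "laplace_rep (Suc (Suc m)) f F S c" using assms unfolding has_laplace_def by blast
  note S = laplace_repD[OF this]
  show ?thesis
  proof (rule that[OF S(1), of "\<lambda>e xs. c e * (\<Prod>i<m. (xs ! i) ^ e (Suc (Suc i)))"
      "\<lambda>e ts. c e * (\<Prod>i<m. fact (e (Suc (Suc i))) * inverse (ts ! i) ^ Suc (e (Suc (Suc i))))"])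
    show "has_laplace m (\<lambda>xs. c e * (\<Prod>i<m. (xs ! i) ^ e (Suc (Suc i))))
      (\<lambda>ts. c e * (\<Prod>i<m. fact (e (Suc (Suc i))) * inverse (ts ! i) ^ Suc (e (Suc (Suc i)))))" for e
      by (rule has_laplaceI[of "{()}" _ _ "\<lambda>_. c e" "\<lambda>_ i. e (Suc (Suc i))"]) auto
    show "f (x # y # xs) = (\<Sum>e\<in>S. x ^ e 0 * y ^ e 1 * (c e * (\<Prod>i<m. (xs ! i) ^ e (Suc (Suc i)))))"
      if "length xs = m" for x y xs
      using that S(2) by (simp add: prod.lessThan_Suc_shift mult_ac del: prod.lessThan_Suc)
    show "F (s # t # ts) = (\<Sum>e\<in>S. fact (e 0) * fact (e 1) *
       (c e * (\<Prod>i<m. fact (e (Suc (Suc i))) * inverse (ts ! i) ^ Suc (e (Suc (Suc i))))) *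
       inverse s ^ Suc (e 0) * inverse t ^ Suc (e 1))"
      if "s \<noteq> 0" "t \<noteq> 0" "0 \<notin> set ts" "length ts = m" for s t ts
      using that S(3) by (simp add: prod.lessThan_Suc_shift mult_ac del: prod.lessThan_Suc power_Suc)
  qed
qed

text \<open>A monomial with exponents \<open>p\<close> and \<open>q\<close> contributes
  \<open>(p+1)! (q+1)! / (p+q+4)! * b^(p+q+4)\<close>. The transform cancels the denominator, and
  \<open>1/t^(p+q+5)\<close> splits into \<open>1/t\<close> and the powers \<open>1/t^(p+2)\<close>
  and \<open>1/t^(q+2)\<close> of the two derivatives.\<close>

lemma has_laplace_pos_triangle:
  assumes "has_laplace (Suc (Suc m)) q Q"
  shows "has_laplace_pos (Suc m)
    (\<lambda>rs. LINT (x, y):triangle (hd rs)|lborel.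
       of_real (x * y) * q (of_real x # of_real y # map of_real (tl rs)))
    (\<lambda>ts. 1 / hd ts * mixed_deriv (\<lambda>x y. Q (x # y # tl ts)) (hd ts) (hd ts))"
proof -
  obtain S :: "(nat \<Rightarrow> nat) set" and f F where S: "finite S" "\<And>e. has_laplace m (f e) (F e)"
    "\<And>x y xs. length xs = m \<Longrightarrow> q (x # y # xs) = (\<Sum>e\<in>S. x ^ e 0 * y ^ e 1 * f e xs)"
    "\<And>s t ts. s \<noteq> 0 \<Longrightarrow> t \<noteq> 0 \<Longrightarrow> 0 \<notin> set ts \<Longrightarrow> length ts = m \<Longrightarrow> Q (s # t # ts) =
       (\<Sum>e\<in>S. fact (e 0) * fact (e 1) * F e ts * inverse s ^ Suc (e 0) * inverse t ^ Suc (e 1))"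
    by (rule has_laplace_ConsConsE[OF assms]) auto
  define K :: "(nat \<Rightarrow> nat) \<Rightarrow> complex" where
    "K e = fact (Suc (e 0)) * fact (Suc (e 1)) / fact (e 0 + e 1 + 4)" for e
  have "has_laplace (Suc m) (\<lambda>xs. \<Sum>e\<in>S. hd xs ^ (e 0 + e 1 + 4) * (K e * f e (tl xs)))
     (\<lambda>ts. \<Sum>e\<in>S. fact (e 0 + e 1 + 4) * inverse (hd ts) ^ Suc (e 0 + e 1 + 4) * (K e * F e (tl ts)))"
    by (intro has_laplace_sum has_laplace_Cons has_laplace_cmult S(2))
  hence lap: "has_laplace (Suc m) (\<lambda>xs. \<Sum>e\<in>S. hd xs ^ (e 0 + e 1 + 4) * (K e * f e (tl xs)))
     (\<lambda>ts. 1 / hd ts * mixed_deriv (\<lambda>x y. Q (x # y # tl ts)) (hd ts) (hd ts))"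
  proof (rule has_laplace_cong[OF _ refl])
    fix us :: "complex list" assume "length us = Suc m" "0 \<notin> set us"
    then obtain t ts where us: "us = t # ts" and ts: "t \<noteq> 0" "0 \<notin> set ts" "length ts = m"
      by (cases us) auto
    have mixed: "mixed_deriv (\<lambda>x y. Q (x # y # ts)) t t =
      (\<Sum>e\<in>S. fact (e 0) * fact (e 1) * F e ts * of_nat (Suc (e 0)) * of_nat (Suc (e 1)) *
         inverse t ^ Suc (Suc (e 0)) * inverse t ^ Suc (Suc (e 1)))"
      by (rule mixed_deriv_inverse_sum[OF S(1) ts(1) ts(1)]) (use S(4) ts in auto)
    have summand: "1 / t * (fact (e 0) * fact (e 1) * F e ts * of_nat (Suc (e 0)) * of_nat (Suc (e 1)) *
         inverse t ^ Suc (Suc (e 0)) * inverse t ^ Suc (Suc (e 1))) =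
       fact (e 0 + e 1 + 4) * inverse t ^ Suc (e 0 + e 1 + 4) * (K e * F e ts)" for e
    proof -
      have "inverse t ^ Suc (e 0 + e 1 + 4) = 1 / t * (inverse t ^ Suc (Suc (e 0)) * inverse t ^ Suc (Suc (e 1)))"
      proof -
        have "Suc (e 0 + e 1 + 4) = Suc (Suc (Suc (e 0)) + Suc (Suc (e 1)))" by simp
        thus ?thesis by (simp only: power_Suc power_add divide_inverse) (simp add: mult_ac)
      qed
      thus ?thesis unfolding K_def by (simp del: power_Suc)
    qed
    show "1 / hd us * mixed_deriv (\<lambda>x y. Q (x # y # tl us)) (hd us) (hd us) =
      (\<Sum>e\<in>S. fact (e 0 + e 1 + 4) * inverse (hd us) ^ Suc (e 0 + e 1 + 4) * (K e * F e (tl us)))"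
      by (simp only: us list.sel mixed sum_distrib_left summand)
  qed
  show ?thesis
  proof (rule has_laplace_posI[OF lap])
    fix us :: "real list" assume "length us = Suc m" "\<forall>r\<in>set us. 0 < r"
    then obtain b rs where us: "us = b # rs" and rs: "0 < b" "length rs = m" by (cases us) auto
    let ?T = "triangle b"
    let ?w = "\<lambda>z (e :: nat \<Rightarrow> nat). (case z of (x, y) \<Rightarrow> (x :: real) ^ Suc (e 0) * y ^ Suc (e 1))"
    let ?I = "\<lambda>e :: nat \<Rightarrow> nat. fact (Suc (e 0)) * fact (Suc (e 1)) / fact (Suc (e 0) + Suc (e 1) + 2) *
       b ^ (Suc (e 0) + Suc (e 1) + 2)"
    have "(LINT z:?T|lborel. (\<Sum>e\<in>S. of_real (?w z e) * f e (map of_real rs))) =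
        (\<Sum>e\<in>S. of_real (?I e) * f e (map of_real rs))"
    proof (rule set_lebesgue_integral_weighted_sum)
      fix e
      show "has_bochner_integral lborel (\<lambda>z. indicator ?T z * ?w z e) (?I e)"
        using has_bochner_integral_triangle[of b "Suc (e 0)" "Suc (e 1)"] rs(1) by (simp add: split_beta')
    qed
    moreover have "(\<Sum>e\<in>S. of_real (?w z e) * f e (map of_real rs)) =
        (case z of (x, y) \<Rightarrow> of_real (x * y) * q (of_real x # of_real y # map of_real rs))" for z
      using rs by (cases z) (simp add: S(3) sum_distrib_left mult_ac)
    moreover have "of_real (?I e) * f e (map of_real rs) =
        of_real b ^ (e 0 + e 1 + 4) * (K e * f e (map of_real rs))" for e
      unfolding K_def by (simp add: numeral_eq_Suc)
    ultimately show "(LINT (x, y):triangle (hd us)|lborel.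
       of_real (x * y) * q (of_real x # of_real y # map of_real (tl us))) =
       (\<Sum>e\<in>S. hd (map of_real us) ^ (e 0 + e 1 + 4) * (K e * f e (tl (map of_real us))))"
      unfolding us by simp
  qed
qed

section \<open>Shifts by 2 pi i and multiplication by the sine\<close>

lemma of_nat_choose_mult_fact:
  "k \<le> n \<Longrightarrow> of_nat (n choose k) * (fact k * fact (n - k)) = (fact n :: complex)"
  using binomial_fact[of k n, where 'a = complex] by simp

lemma poly_fls_prpart_exp:
  "poly (fls_prpart (fls_shift (int N) (fps_to_fls (fps_exp w)))) (inverse (t::complex)) =
    (\<Sum>i<N. w ^ i / fact i * inverse t ^ (N - i))"
proof -
  have "fls_prpart (fls_shift (int N) (fps_to_fls (fps_exp w))) = (\<Sum>i<N. monom (w ^ i / fact i) (N - i))"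
  proof (rule poly_eqI)
    fix n
    have "(\<Sum>i<N. coeff (monom (w ^ i / fact i) (N - i)) n) =
        (if n = 0 \<or> n > N then 0 else w ^ (N - n) / fact (N - n))"
    proof (cases "n = 0 \<or> n > N")
      case False
      hence "(\<Sum>i<N. coeff (monom (w ^ i / fact i) (N - i)) n) =
          (\<Sum>i<N. if i = N - n then w ^ i / fact i else 0)"
        by (intro sum.cong) auto
      thus ?thesis using False by (simp add: sum.delta)
    qed (auto intro!: sum.neutral)
    thus "coeff (fls_prpart (fls_shift (int N) (fps_to_fls (fps_exp w)))) n =
        coeff (\<Sum>i<N. monom (w ^ i / fact i) (N - i)) n"
      by (auto simp: coeff_sum nat_diff_distrib' of_nat_diff[symmetric] simp del: of_nat_diff)
  qed
  thus ?thesis by (simp add: poly_sum poly_monom)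
qed

lemma has_laurent_expansion_exp_shift:
  "(\<lambda>s. exp (w * s) * inverse s ^ N) has_laurent_expansion fls_shift (int N) (fps_to_fls (fps_exp w))"
proof -
  have "(\<lambda>s. exp (w * s)) has_laurent_expansion fps_to_fls (fps_exp w)"
    by (intro has_laurent_expansion_fps has_fps_expansion_exp)
  from has_laurent_expansion_shift'[OF this, of "int N"] show ?thesis
    by (simp add: power_int_minus power_inverse)
qed

text \<open>The sine is split into exponentials with exponents \<open>w\<close> and
  \<open>- w\<close> for \<open>w = 2 pi i\<close>. The coefficients then contain
  \<open>w^i - (- w)^i\<close>, just like the binomial expansion of a difference of shifts by
  \<open>w\<close>.\<close>

lemma principal_part_sin:
  "meromorphic_at_0 (\<lambda>s. c * (sin (2 * of_real pi * s) / (2 * of_real pi) * inverse s ^ N))" (is ?A)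
  "principal_part (\<lambda>s. c * (sin (2 * of_real pi * s) / (2 * of_real pi) * inverse s ^ N)) t =
    (\<Sum>i<N. c * (((2 * of_real pi * \<i>) ^ i - (- (2 * of_real pi * \<i>)) ^ i) / (4 * of_real pi * \<i>)
       / fact i * inverse t ^ (N - i)))" (is ?B)
proof -
  define w where "w = 2 * of_real pi * \<i>"
  let ?E = "\<lambda>w. fls_shift (int N) (fps_to_fls (fps_exp w)) :: complex fls"
  let ?k = "c / (4 * of_real pi * \<i>)"
  have "(\<lambda>s. ?k * (exp (w * s) * inverse s ^ N) - ?k * (exp (- w * s) * inverse s ^ N))
      has_laurent_expansion fls_const ?k * ?E w - fls_const ?k * ?E (- w)"
    by (intro has_laurent_expansion_diff has_laurent_expansion_cmult_left has_laurent_expansion_exp_shift)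
  moreover have "?k * (exp (w * s) * inverse s ^ N) - ?k * (exp (- w * s) * inverse s ^ N) =
      c * (sin (2 * of_real pi * s) / (2 * of_real pi) * inverse s ^ N)" for s
  proof -
    have "sin (2 * of_real pi * s) = (exp (w * s) - exp (- w * s)) / (2 * \<i>)"
      unfolding sin_exp_eq' w_def by (simp add: mult_ac field_simps)
    moreover have "c / (4 * p * q) * (X * r) - c / (4 * p * q) * (Y * r) = c * ((X - Y) / (2 * q) / (2 * p) * r)"
      if "p \<noteq> 0" "q \<noteq> 0" for p q X Y r using that by (simp add: field_simps)
    from this[of "of_real pi" \<i> "exp (w * s)" "inverse s ^ N" "exp (- w * s)"] calculation
    show ?thesis by (simp only:) simp
  qed
  ultimately have *: "(\<lambda>s. c * (sin (2 * of_real pi * s) / (2 * of_real pi) * inverse s ^ N))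
      has_laurent_expansion fls_const ?k * ?E w - fls_const ?k * ?E (- w)" by simp
  show ?A by (rule meromorphic_at_0I[OF *])
  have "c / D * (x / y * r) - c / D * (x' / y * r) = c * ((x - x') / D / y * r)" for x x' y r D
    by (simp add: diff_divide_distrib algebra_simps)
  thus ?B
    by (simp only: principal_part_eqI[OF *] fls_prpart_minus fls_prpart_cmult poly_diff poly_smult
        poly_fls_prpart_exp w_def[symmetric] sum_distrib_left sum_subtractf[symmetric])
qed

text \<open>A comparison of coefficients: a shifted power \<open>(x + w)^(k+1)\<close> contributes
  \<open>w^i\<close> with a binomial coefficient, the exponential series contributes
  \<open>w^i / i!\<close>, and the two match since \<open>j! * (k+1 choose j) = (k+1)! / i!\<close>
  for \<open>i + j = k + 1\<close>.\<close>

lemma has_laplace_shift: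
  fixes w :: complex
  defines "w \<equiv> 2 * of_real pi * \<i>"
  assumes "has_laplace (Suc m) f F"
  shows "has_laplace (Suc m)
    (\<lambda>xs. 1 / (4 * of_real pi * \<i>) *
       ((hd xs + w) * f ((hd xs + w) # tl xs) - (hd xs - w) * f ((hd xs - w) # tl xs)))
    (\<lambda>ts. - principal_part (\<lambda>s. sin (2 * of_real pi * s) / (2 * of_real pi) *
       deriv (\<lambda>x. F (x # tl ts)) s) (hd ts))"
proof -
  obtain d f' F' where "laplace_Cons_rep m f F d f' F'"
    by (rule has_laplace_ConsE[OF assms(2)])
  note * = laplace_Cons_repD[OF this]
  \<comment> \<open>The coefficient of \<open>x^j\<close> in the shift quotient of
    \<open>x^(k+1)\<close>. It is 0 for \<open>j = k + 1\<close>, where the two powers of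
    \<open>w\<close> and \<open>- w\<close> are both 1.\<close>
  define K where "K k j = of_nat (Suc k choose j) * ((w ^ (Suc k - j) - (- w) ^ (Suc k - j)) / (4 * of_real pi * \<i>))"
    for k j :: nat
  have "has_laplace (Suc m) (\<lambda>xs. \<Sum>k\<le>d. \<Sum>j\<le>Suc k. hd xs ^ j * (K k j * f' k (tl xs)))
    (\<lambda>ts. \<Sum>k\<le>d. \<Sum>j\<le>Suc k. fact j * inverse (hd ts) ^ Suc j * (K k j * F' k (tl ts)))"
    by (intro has_laplace_sum has_laplace_Cons has_laplace_cmult *(1))
  thus ?thesis
  proof (rule has_laplace_cong)
    fix us :: "complex list" assume "length us = Suc m"
    then obtain x xs where us: "us = x # xs" "length xs = m" by (cases us) auto
    have "1 / (4 * of_real pi * \<i>) * ((x + w) ^ Suc k - (x - w) ^ Suc k) = (\<Sum>j\<le>Suc k. x ^ j * K k j)" for k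
      unfolding diff_conv_add_uminus[of x] binomial_ring[of x w] binomial_ring[of x "- w"] K_def
      by (simp add: sum_subtractf[symmetric] sum_distrib_left right_diff_distrib diff_divide_distrib mult_ac
          del: sum.atMost_Suc power_Suc binomial_Suc_Suc)
    hence **: "1 / (4 * of_real pi * \<i>) * ((x + w) ^ Suc k - (x - w) ^ Suc k) * f' k xs =
        (\<Sum>j\<le>Suc k. x ^ j * (K k j * f' k xs))" for k
      by (simp only: sum_distrib_right mult.assoc)
    have "1 / (4 * of_real pi * \<i>) * ((x + w) * f ((x + w) # xs) - (x - w) * f ((x - w) # xs)) =
       (\<Sum>k\<le>d. 1 / (4 * of_real pi * \<i>) * ((x + w) ^ Suc k - (x - w) ^ Suc k) * f' k xs)"
      unfolding *(2)[OF us(2)]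
      by (simp add: sum_distrib_left sum_subtractf[symmetric] left_diff_distrib right_diff_distrib mult.assoc diff_divide_distrib)
    thus "1 / (4 * of_real pi * \<i>) * ((hd us + w) * f ((hd us + w) # tl us) - (hd us - w) * f ((hd us - w) # tl us)) =
      (\<Sum>k\<le>d. \<Sum>j\<le>Suc k. hd us ^ j * (K k j * f' k (tl us)))"
      unfolding us(1) list.sel ** .
  next
    fix us :: "complex list" assume "length us = Suc m" "0 \<notin> set us"
    then obtain t ts where us: "us = t # ts" and ts: "t \<noteq> 0" "0 \<notin> set ts" "length ts = m"
      by (cases us) auto
    let ?s = "\<lambda>s. sin (2 * of_real pi * s) / (2 * of_real pi) :: complex"
    define c where "c k = - (fact (Suc k) * F' k ts)" for k
    let ?T = "\<lambda>k i. c k * ((w ^ i - (- w) ^ i) / (4 * of_real pi * \<i>) / fact i * inverse t ^ (Suc (Suc k) - i))"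
    let ?Q = "\<lambda>k j. fact j * inverse t ^ Suc j * (K k j * F' k ts)"
    have D: "deriv (\<lambda>x. F (x # ts)) s = (\<Sum>k\<le>d. c k * inverse s ^ Suc (Suc k))" if "s \<noteq> 0" for s
      by (subst deriv_inverse_sum[of "{..d}" _ "\<lambda>k. fact k * F' k ts" Suc])
         (use that ts *(3) in \<open>auto simp: c_def mult_ac simp del: power_Suc sum.atMost_Suc\<close>)
    have "principal_part (\<lambda>s. ?s s * deriv (\<lambda>x. F (x # ts)) s) t =
        principal_part (\<lambda>s. \<Sum>k\<le>d. c k * (?s s * inverse s ^ Suc (Suc k))) t"
      by (intro principal_part_cong eventually_mono[OF eventually_at_0_avoid[of "{}"]])
         (auto simp: D sum_distrib_left sum_divide_distrib mult_ac simp del: power_Suc intro!: sum.cong)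
    also have "\<dots> = (\<Sum>k\<le>d. \<Sum>i<Suc (Suc k). ?T k i)"
      unfolding w_def by (subst principal_part_sum(2)) (rule principal_part_sin(1), simp only: principal_part_sin(2))
    also have "\<dots> = - (\<Sum>k\<le>d. \<Sum>j\<le>Suc k. ?Q k j)"
    proof -
      have "(\<Sum>i<Suc (Suc k). ?T k i) = (\<Sum>j\<le>Suc k. - ?Q k j)" for k
      proof -
        have "(\<Sum>i<Suc (Suc k). ?T k i) = (\<Sum>j\<le>Suc k. ?T k (Suc k - j))"
          by (subst sum.nat_diff_reindex[symmetric]) (simp only: lessThan_Suc_atMost diff_Suc_Suc)
        also have "\<dots> = (\<Sum>j\<le>Suc k. - ?Q k j)"
        proof (rule sum.cong[OF refl])
          fix j assume j: "j \<in> {..Suc k}"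
          have e: "Suc (Suc k) - (Suc k - j) = Suc j" using j by auto
          have "of_nat (Suc k choose j) * (fact j * fact (Suc k - j)) = (fact (Suc k) :: complex)"
            by (rule of_nat_choose_mult_fact) (use j in simp)
          hence "fact j * of_nat (Suc k choose j) = (fact (Suc k) / fact (Suc k - j) :: complex)"
            by (simp add: field_simps del: fact_Suc binomial_Suc_Suc)
          moreover have "- (C * f) * (Y / E * r) = - (A * r * ((B * Y) * f))" if "A * B = C / E"
            for A B C E f Y r :: complex
          proof -
            have "A * r * ((B * Y) * f) = (A * B) * (r * Y * f)" by (simp only: mult_ac)
            thus ?thesis by (simp add: that)
          qed
          ultimately show "?T k (Suc k - j) = - ?Q k j" unfolding e c_def K_def by blast
        qed
        finally show ?thesis .
      qed
      thus ?thesis by (simp only: sum_negf)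
    qed
    finally show "- principal_part (\<lambda>s. sin (2 * of_real pi * s) / (2 * of_real pi) *
       deriv (\<lambda>x. F (x # tl us)) s) (hd us) =
       (\<Sum>k\<le>d. \<Sum>j\<le>Suc k. fact j * inverse (hd us) ^ Suc j * (K k j * F' k (tl us)))"
      unfolding us list.sel by simp
  qed
qed

lemma has_laplace_insert:
  assumes "has_laplace m f F" "j \<le> m"
  shows "has_laplace (Suc m) (\<lambda>xs. (xs ! j) ^ r * f (remove_at j xs))
    (\<lambda>ts. fact r * inverse (ts ! j) ^ Suc r * F (remove_at j ts))"
proof -
  have 1: "has_laplace 1 (\<lambda>xs. hd xs ^ r * 1) (\<lambda>ts. fact r * inverse (hd ts) ^ Suc r * 1)"
    using has_laplace_Cons[of 0 "\<lambda>_. 1" "\<lambda>_. 1" r] has_laplaceI[of "{()}" 0 "\<lambda>_. 1" "\<lambda>_. 1" "\<lambda>_ _. 0" "\<lambda>_. 1"]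
    by simp
  have a: "{i. i < Suc m \<and> i \<in> {j}} = {j}" and b: "{i. i < Suc m \<and> i \<in> - {j}} = {..<Suc m} - {j}"
    using assms(2) by auto
  have "has_laplace (Suc m) (\<lambda>xs. (hd (nths xs {j}) ^ r * 1) * f (nths xs (- {j})))
    (\<lambda>ts. (fact r * inverse (hd (nths ts {j})) ^ Suc r * 1) * F (nths ts (- {j})))"
    by (rule has_laplace_product[OF 1 assms(1), of "Suc m" "{j}", unfolded a b]) (use assms(2) in simp_all)
  moreover have "nths xs {j} = [xs ! j]" if "j < length xs" for xs :: "complex list"
    using that
  proof (induction xs arbitrary: j)
    case (Cons x xs)
    have "{i. Suc i = j} = (if j = 0 then {} else {j - 1})" by auto
    thus ?case using Cons by (cases j) (auto simp: nths_Cons)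
  qed simp
  ultimately show ?thesis
    by (elim has_laplace_cong) (use assms(2) in \<open>simp_all add: remove_at_def\<close>)
qed

section \<open>Integrals with end points b + b_j and b - b_j\<close>

lemma power_add_diff_even:
  fixes b c :: complex
  shows "(b + c) ^ (2 * M) + (b - c) ^ (2 * M) =
    2 * (\<Sum>l\<le>M. of_nat (2 * M choose (2 * l)) * b ^ (2 * l) * c ^ (2 * (M - l)))"
proof -
  let ?g = "\<lambda>i. of_nat (2 * M choose i) * b ^ i * (c ^ (2 * M - i) + (- c) ^ (2 * M - i))"
  have "(b + c) ^ (2 * M) + (b - c) ^ (2 * M) = (\<Sum>i\<le>2 * M. ?g i)"
    unfolding diff_conv_add_uminus[of b] binomial_ring by (simp add: sum.distrib distrib_left)
  \<comment> \<open>One further term, with binomial coefficient 0, makes the number of terms even,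
    so that they can be grouped in pairs.\<close>
  also have "\<dots> = (\<Sum>i\<le>Suc (2 * M). ?g i)" by (simp add: binomial_eq_0)
  also have "\<dots> = (\<Sum>l\<le>M. 2 * (of_nat (2 * M choose (2 * l)) * b ^ (2 * l) * c ^ (2 * (M - l))))"
    unfolding sum.in_pairs_0
  proof (rule sum.cong[OF refl])
    fix l assume "l \<in> {..M}"
    hence "?g (Suc (2 * l)) = 0" by (cases "l = M") (auto simp: binomial_eq_0 power_minus_odd)
    moreover have "2 * M - 2 * l = 2 * (M - l)" by simp
    ultimately show "?g (2 * l) + ?g (Suc (2 * l)) = 2 * (of_nat (2 * M choose (2 * l)) * b ^ (2 * l) * c ^ (2 * (M - l)))"
      by simp
  qed
  finally show ?thesis by (simp only: sum_distrib_left)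
qed

text \<open>Covers negative \<open>z\<close> too, because the interval integral is oriented; this is
  the case \<open>b < b_j\<close> in (N).\<close>

lemma interval_integral_odd_sum:
  fixes c :: "'i \<Rightarrow> complex"
  shows "(LBINT x=0..ereal z. of_real x * (\<Sum>a\<in>A. of_real x ^ (2 * i a) * c a)) =
    (\<Sum>a\<in>A. of_real z ^ (2 * i a + 2) / of_nat (2 * i a + 2) * c a)"
proof -
  have "(LBINT x=ereal 0..ereal z. of_real x * (\<Sum>a\<in>A. of_real x ^ (2 * i a) * c a)) =
    (\<Sum>a\<in>A. of_real z ^ (2 * i a + 2) / of_nat (2 * i a + 2) * c a) -
    (\<Sum>a\<in>A. of_real 0 ^ (2 * i a + 2) / of_nat (2 * i a + 2) * c a)"
  proof (rule interval_integral_FTC_finite)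
    show "continuous_on {min 0 z..max 0 z} (\<lambda>x. of_real x * (\<Sum>a\<in>A. of_real x ^ (2 * i a) * c a))"
      by (intro continuous_intros)
    fix x :: real
    have "((\<lambda>y. \<Sum>a\<in>A. y ^ (2 * i a + 2) / of_nat (2 * i a + 2) * c a) has_field_derivative
        (\<Sum>a\<in>A. of_real x ^ Suc (2 * i a) * c a)) (at (of_real x))"
    proof (rule DERIV_sum)
      fix a
      have "of_nat (2 * i a + 2) \<noteq> (0 :: complex)" unfolding of_nat_eq_0_iff by simp
      thus "((\<lambda>y. y ^ (2 * i a + 2) / of_nat (2 * i a + 2) * c a) has_field_derivative
        of_real x ^ Suc (2 * i a) * c a) (at (of_real x))"
        by (auto intro!: derivative_eq_intros simp del: power_Suc)
    qed
    moreover have "of_real x * (\<Sum>a\<in>A. of_real x ^ (2 * i a) * c a) = (\<Sum>a\<in>A. of_real x ^ Suc (2 * i a) * c a)"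
      by (simp add: sum_distrib_left mult.assoc)
    ultimately show "((\<lambda>x. \<Sum>a\<in>A. of_real x ^ (2 * i a + 2) / of_nat (2 * i a + 2) * c a)
      has_vector_derivative of_real x * (\<Sum>a\<in>A. of_real x ^ (2 * i a) * c a)) (at x within {min 0 z..max 0 z})"
      by (auto intro: has_vector_derivative_at_within has_vector_derivative_real_field)
  qed
  thus ?thesis by (simp add: zero_ereal_def)
qed

text \<open>For \<open>r = b_j\<close>, an even power \<open>x^(2h)\<close> leads to
  \<open>((b + r)^(2h+2) + (b - r)^(2h+2)) / (2h+2)\<close>, in which the odd powers of
  \<open>r\<close> cancel; up to a constant factor its transform is the geometric sum of
  \<open>third_term_monomial\<close>. The closed form of \<open>G\<close> is restricted to
  \<open>t^2 \<noteq> t_j^2\<close>, because the quotient takes the value 0 at the removable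
  singularities.\<close>

lemma has_laplace_pos_third:
  assumes "has_laplace m f F" "j < m"
    and even: "\<And>x xs. length xs = m - 1 \<Longrightarrow> f ((- x) # xs) = f (x # xs)"
  obtains G where "has_laplace_pos (Suc m)
    (\<lambda>rs. (LBINT x=0..ereal (hd rs + tl rs ! j). of_real x * f (of_real x # remove_at j (map of_real (tl rs))))
        + (LBINT x=0..ereal (hd rs - tl rs ! j). of_real x * f (of_real x # remove_at j (map of_real (tl rs))))) G"
    "\<And>t ts. t \<noteq> 0 \<Longrightarrow> 0 \<notin> set ts \<Longrightarrow> length ts = m \<Longrightarrow> t\<^sup>2 \<noteq> (ts ! j)\<^sup>2 \<Longrightarrow> G (t # ts) =
       2 * (1 / (t\<^sup>2 - (ts ! j)\<^sup>2) * (ts ! j / t * deriv (\<lambda>x. F (x # remove_at j ts)) t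
         - t / ts ! j * deriv (\<lambda>x. F (x # remove_at j ts)) (ts ! j)))"
proof -
  obtain m' where m: "m = Suc m'" using assms(2) by (cases m) auto
  obtain d f' F' where "laplace_Cons_rep m' f F d f' F'"
    by (rule has_laplace_ConsE[OF assms(1)[unfolded m]])
  note * = laplace_Cons_repD[OF this]
  \<comment> \<open>The difference of \<open>f\<close> at \<open>r\<close> and at \<open>- r\<close>
    has the coefficients \<open>(1 - (-1)^k) * f' k xs\<close> and vanishes by evenness; for odd
    \<open>k\<close> the first factor is 2.\<close>
  have odd0: "f' k xs = 0" if k: "odd k" "k \<le> d" and xs: "length xs = m'" for k xs
  proof -
    have "(1 - (- 1) ^ k) * f' k xs = 0"
    proof (rule poly_sum_eq_0_on_pos[OF _ k(2)])
      fix r :: real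
      have "(\<Sum>k\<le>d. of_real r ^ k * ((1 - (- 1) ^ k) * f' k xs)) = f (of_real r # xs) - f ((- of_real r) # xs)"
        unfolding *(2)[OF xs] by (simp add: sum_subtractf[symmetric] power_minus[of "of_real r"] algebra_simps)
      thus "(\<Sum>k\<le>d. complex_of_real r ^ k * ((1 - (- 1) ^ k) * f' k xs)) = 0"
        using even[of xs "of_real r"] xs m by simp
    qed
    thus ?thesis using k(1) by simp
  qed
  have odd0': "F' k ts = 0" if "odd k" "k \<le> d" "length ts = m'" "0 \<notin> set ts" for k ts
    using has_laplace_eq_0[OF *(1)[of k]] odd0[OF that(1,2)] that(3,4) by auto
  define K where "K = {k. k \<le> d \<and> even k}"
  define h where "h k = k div 2" for k :: nat
  have hK: "k = 2 * h k" if "k \<in> K" for k using that by (auto simp: K_def h_def)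
  have f: "f (x # xs) = (\<Sum>k\<in>K. x ^ k * f' k xs)" if "length xs = m'" for x xs
    unfolding *(2)[OF that] by (rule sum.mono_neutral_right) (auto simp: K_def odd0 that)
  have F: "F (t # ts) = (\<Sum>k\<in>K. fact k * F' k ts * inverse t ^ Suc k)"
    if "t \<noteq> 0" "0 \<notin> set ts" "length ts = m'" for t ts
  proof -
    have "F (t # ts) = (\<Sum>k\<le>d. fact k * F' k ts * inverse t ^ Suc k)"
      unfolding *(3)[OF that] by (simp add: mult_ac del: power_Suc)
    also have "\<dots> = (\<Sum>k\<in>K. fact k * F' k ts * inverse t ^ Suc k)"
      by (rule sum.mono_neutral_right) (auto simp: K_def odd0' that)
    finally show ?thesis .
  qed
  define c :: "nat \<Rightarrow> nat \<Rightarrow> complex" where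
    "c k l = 2 / of_nat (2 * h k + 2) * of_nat (2 * (h k + 1) choose (2 * l))" for k l
  define G where "G us = (\<Sum>k\<in>K. \<Sum>l\<le>h k + 1. fact (2 * l) * inverse (hd us) ^ Suc (2 * l) * (c k l *
     (fact (2 * (h k + 1 - l)) * inverse (tl us ! j) ^ Suc (2 * (h k + 1 - l)) * F' k (remove_at j (tl us)))))"
    for us
  define g where "g us = (\<Sum>k\<in>K. \<Sum>l\<le>h k + 1. hd us ^ (2 * l) * (c k l *
     ((tl us ! j) ^ (2 * (h k + 1 - l)) * f' k (remove_at j (tl us)))))" for us
  have "has_laplace (Suc m) g G"
    unfolding g_def G_def m
    by (intro has_laplace_sum has_laplace_Cons has_laplace_cmult has_laplace_insert *(1)) (use assms(2) m in simp)
  show ?thesis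
  proof (rule that[of G])
    show "has_laplace_pos (Suc m)
      (\<lambda>rs. (LBINT x=0..ereal (hd rs + tl rs ! j). of_real x * f (of_real x # remove_at j (map of_real (tl rs))))
        + (LBINT x=0..ereal (hd rs - tl rs ! j). of_real x * f (of_real x # remove_at j (map of_real (tl rs))))) G"
    proof (rule has_laplace_posI[OF \<open>has_laplace (Suc m) g G\<close>])
      fix us :: "real list" assume "length us = Suc m"
      then obtain b rs where us: "us = b # rs" and rs: "length rs = m" by (cases us) auto
      define xs where "xs = remove_at j (map complex_of_real rs)"
      have xs: "length xs = m'" using length_remove_at[of j "map complex_of_real rs"] rs assms(2) m
        by (simp add: xs_def)
      have int: "(LBINT x=0..ereal z. of_real x * f (of_real x # xs)) =
          (\<Sum>k\<in>K. of_real z ^ (2 * (h k + 1)) / of_nat (2 * h k + 2) * f' k xs)" for z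
      proof -
        have "f (x # xs) = (\<Sum>k\<in>K. x ^ (2 * h k) * f' k xs)" for x
          unfolding f[OF xs] using hK by (intro sum.cong) auto
        thus ?thesis by (simp only: interval_integral_odd_sum distrib_left mult_1_right)
      qed
      have "(LBINT x=0..ereal (b + rs ! j). of_real x * f (of_real x # xs)) +
          (LBINT x=0..ereal (b - rs ! j). of_real x * f (of_real x # xs)) =
          (\<Sum>k\<in>K. ((of_real b + of_real (rs ! j)) ^ (2 * (h k + 1)) + (of_real b - of_real (rs ! j)) ^ (2 * (h k + 1)))
             / of_nat (2 * h k + 2) * f' k xs)"
        unfolding int by (simp only: sum.distrib[symmetric] of_real_add of_real_diff add_divide_distrib distrib_right)
      also have "\<dots> = g (map of_real us)"
        unfolding power_add_diff_even g_def us c_def using rs assms(2)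
        by (simp add: xs_def sum_distrib_left sum_distrib_right sum_divide_distrib mult_ac
             del: sum.atMost_Suc power_Suc binomial_Suc_Suc mult_Suc_right)
      finally show "(LBINT x=0..ereal (hd us + tl us ! j). of_real x * f (of_real x # remove_at j (map of_real (tl us))))
        + (LBINT x=0..ereal (hd us - tl us ! j). of_real x * f (of_real x # remove_at j (map of_real (tl us))))
        = g (map of_real us)" by (simp add: us xs_def)
    qed
    fix t :: complex and ts :: "complex list"
    assume t: "t \<noteq> 0" "0 \<notin> set ts" "length ts = m" "t\<^sup>2 \<noteq> (ts ! j)\<^sup>2"
    have tj: "ts ! j \<noteq> 0" using t(2,3) assms(2) nth_mem by metis
    have rem: "0 \<notin> set (remove_at j ts)" "length (remove_at j ts) = m'"
      using t(2) set_remove_at[of j ts] length_remove_at[of j ts] t(3) assms(2) m by auto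
    define A where "A k = fact (2 * h k + 1) * F' k (remove_at j ts)" for k
    have "finite K" by (simp add: K_def)
    have D: "deriv (\<lambda>x. F (x # remove_at j ts)) s = (\<Sum>k\<in>K. - (A k * inverse s ^ (2 * h k + 2)))"
      if "s \<noteq> 0" for s
    proof -
      have "deriv (\<lambda>x. F (x # remove_at j ts)) s =
          (\<Sum>k\<in>K. - (fact k * F' k (remove_at j ts) * of_nat (Suc k) * inverse s ^ Suc (Suc k)))"
        by (rule deriv_inverse_sum[OF \<open>finite K\<close> F[OF _ rem] that])
      also have "\<dots> = (\<Sum>k\<in>K. - (A k * inverse s ^ (2 * h k + 2)))"
      proof (rule sum.cong[OF refl])
        fix k assume "k \<in> K"
        hence "2 * h k + 1 = Suc k" "2 * h k + 2 = Suc (Suc k)" using hK[of k] by auto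
        thus "- (fact k * F' k (remove_at j ts) * of_nat (Suc k) * inverse s ^ Suc (Suc k)) =
          - (A k * inverse s ^ (2 * h k + 2))"
          unfolding A_def by (simp only: fact_Suc of_nat_mult of_nat_fact mult_ac)
      qed
      finally show ?thesis .
    qed
    have "1 / (t\<^sup>2 - (ts ! j)\<^sup>2) * (ts ! j / t * deriv (\<lambda>x. F (x # remove_at j ts)) t
         - t / ts ! j * deriv (\<lambda>x. F (x # remove_at j ts)) (ts ! j)) =
       (\<Sum>k\<in>K. - A k * (1 / (t\<^sup>2 - (ts ! j)\<^sup>2) * (ts ! j / t * inverse t ^ (2 * h k + 2) -
          t / ts ! j * inverse (ts ! j) ^ (2 * h k + 2))))"
      unfolding D[OF t(1)] D[OF tj]
      by (simp add: sum_distrib_left sum_subtractf[symmetric] right_diff_distrib mult_ac del: power_Suc)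
    also have "\<dots> = (\<Sum>k\<in>K. \<Sum>l\<le>h k + 1. A k * (inverse t ^ Suc (2 * l) * inverse (ts ! j) ^ Suc (2 * (h k + 1 - l))))"
      unfolding third_term_monomial[OF t(1) tj t(4)]
      by (simp add: sum_distrib_left sum_negf[symmetric] del: power_Suc sum.atMost_Suc)
    also have "2 * \<dots> = G (t # ts)"
      unfolding G_def sum_distrib_left list.sel
    proof (intro sum.cong refl)
      fix k l assume "l \<in> {..h k + 1}"
      hence l: "2 * l \<le> 2 * (h k + 1)" by simp
      have nz: "of_nat (2 * h k + 2) \<noteq> (0 :: complex)" unfolding of_nat_eq_0_iff by simp
      have "of_nat (2 * (h k + 1) choose (2 * l)) * (fact (2 * l) * fact (2 * (h k + 1 - l))) =
          (fact (2 * (h k + 1)) :: complex)"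
        using of_nat_choose_mult_fact[OF l] by (simp only: diff_mult_distrib2)
      also have "\<dots> = of_nat (2 * h k + 2) * fact (2 * h k + 1)"
        by (simp only: fact_Suc of_nat_mult of_nat_fact mult_2_right flip: Suc_eq_plus1) simp
      finally have "c k l * (fact (2 * l) * fact (2 * (h k + 1 - l))) = 2 * fact (2 * h k + 1)"
        using nz unfolding c_def by (simp add: mult_ac del: fact_Suc of_nat_Suc of_nat_add binomial_Suc_Suc mult_Suc_right)
      hence "2 * A k * (inverse t ^ Suc (2 * l) * inverse (ts ! j) ^ Suc (2 * (h k + 1 - l))) =
          c k l * (fact (2 * l) * fact (2 * (h k + 1 - l))) * F' k (remove_at j ts) *
          (inverse t ^ Suc (2 * l) * inverse (ts ! j) ^ Suc (2 * (h k + 1 - l)))"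
        unfolding A_def by (simp only: mult.assoc)
      thus "2 * (A k * (inverse t ^ Suc (2 * l) * inverse (ts ! j) ^ Suc (2 * (h k + 1 - l)))) =
        fact (2 * l) * inverse t ^ Suc (2 * l) * (c k l *
          (fact (2 * (h k + 1 - l)) * inverse (ts ! j) ^ Suc (2 * (h k + 1 - l)) * F' k (remove_at j ts)))"
        by (simp only: mult_ac)
    qed
    finally show "G (t # ts) = 2 * (1 / (t\<^sup>2 - (ts ! j)\<^sup>2) * (ts ! j / t * deriv (\<lambda>x. F (x # remove_at j ts)) t
         - t / ts ! j * deriv (\<lambda>x. F (x # remove_at j ts)) (ts ! j)))" by simp
  qed
qed

lemma nths_cong_length:
  assumes "\<And>i. i < length xs \<Longrightarrow> i \<in> I \<longleftrightarrow> i \<in> J"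
  shows "nths xs I = nths xs J"
  unfolding nths_def by (intro arg_cong[of _ _ "map fst"] filter_cong) (use assms in \<open>auto simp: set_zip\<close>)

text \<open>Two new variables precede the given ones, the first for \<open>f\<close> and the second
  for \<open>g\<close>; the set \<open>I'\<close> encodes this enlarged partition. The number of
  arguments of each factor depends on the partition, so transforms are assumed in every positive
  arity.\<close>

lemma has_laplace_partition:
  assumes f: "\<And>a. 1 \<le> a \<Longrightarrow> has_laplace a f F" and g: "\<And>a. 1 \<le> a \<Longrightarrow> has_laplace a g G"
    and IJ: "(I, J) \<in> partitions m"
  shows "has_laplace (Suc (Suc m))
    (\<lambda>xs. f (hd xs # nths (tl (tl xs)) I) * g (hd (tl xs) # nths (tl (tl xs)) J))
    (\<lambda>ts. F (hd ts # nths (tl (tl ts)) I) * G (hd (tl ts) # nths (tl (tl ts)) J))"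
proof -
  define I' where "I' = insert 0 ((\<lambda>i. Suc (Suc i)) ` I)"
  have sub: "{j. Suc j \<in> {j. Suc j \<in> I'}} = I" "{j. Suc j \<in> {j. Suc j \<in> - I'}} = - I"
    by (auto simp: I'_def)
  have in01: "0 \<in> I'" "Suc 0 \<in> - I'" by (auto simp: I'_def)
  have "1 \<le> card {i. i < Suc (Suc m) \<and> i \<in> I'}"
    using card_mono[of "{i. i < Suc (Suc m) \<and> i \<in> I'}" "{0}"] in01 by simp
  moreover have "1 \<le> card {i. i < Suc (Suc m) \<and> i \<in> - I'}"
    using card_mono[of "{i. i < Suc (Suc m) \<and> i \<in> - I'}" "{Suc 0}"] in01 by simp
  ultimately have "has_laplace (Suc (Suc m)) (\<lambda>xs. f (nths xs I') * g (nths xs (- I')))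
      (\<lambda>ts. F (nths ts I') * G (nths ts (- I')))"
    by (intro has_laplace_product[OF f g refl refl])
  moreover have "nths xs I' = hd xs # nths (tl (tl xs)) I \<and> nths xs (- I') = hd (tl xs) # nths (tl (tl xs)) J"
    if "length xs = Suc (Suc m)" for xs :: "complex list"
  proof -
    obtain x y ys where xs: "xs = x # y # ys" "length ys = m"
      using \<open>length xs = Suc (Suc m)\<close> by (metis length_Suc_conv)
    have "nths ys (- I) = nths ys J"
      by (rule nths_cong_length) (use IJ xs in \<open>auto simp: partitions_def\<close>)
    thus ?thesis using in01 sub unfolding xs(1) by (simp add: nths_Cons)
  qed
  ultimately show ?thesis by (elim has_laplace_cong) simp_all
qed

lemma has_laplace_field_differentiable:
  assumes "has_laplace (Suc m) f F" "s \<noteq> 0" "0 \<notin> set ts" "length ts = m"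
  shows "(\<lambda>x. F (x # ts)) field_differentiable at s"
proof -
  obtain d f' F' where "laplace_Cons_rep m f F d f' F'"
    by (rule has_laplace_ConsE[OF assms(1)])
  note * = laplace_Cons_repD[OF this]
  have "((\<lambda>x. F (x # ts)) has_field_derivative
      (\<Sum>k\<le>d. - (fact k * F' k ts * of_nat (Suc k) * inverse s ^ Suc (Suc k)))) (at s)"
    by (rule has_field_derivative_inverse_sum) (use *(3) assms in \<open>auto simp: mult_ac\<close>)
  thus ?thesis unfolding field_differentiable_def by blast
qed

lemma mixed_deriv_mult:
  assumes "f field_differentiable at t" "g field_differentiable at t'"
  shows "mixed_deriv (\<lambda>x y. f x * g y) t t' = deriv f t * deriv g t'"
  unfolding mixed_deriv_def using assms by simp

lemma recursion_N_imp_B: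
  assumes V: "volume_family V" and n: "1 \<le> n" "2 \<le> 2 * int g - 2 + int n" and N: "recursion_N V g n"
  shows "recursion_B (laplace_transform V) g n"
proof -
  define m where "m = n - 1"
  have nm: "n = Suc m" using n(1) by (simp add: m_def)
  let ?L = "laplace_transform V"
  let ?S = "{(g1, g2). g1 + g2 = g}"
  note F = odd_inv_poly_laplace_transform[OF V]
  note lap = has_laplace_stab_volume[OF V]
  define tri where "tri q rs = (LINT (x, y):triangle (hd rs)|lborel.
     of_real (x * y) * q (of_real x # of_real y # map of_real (tl rs)))"
    for q :: "complex list \<Rightarrow> complex" and rs
  define mix where "mix Q ts = 1 / hd ts * mixed_deriv (\<lambda>x y. Q (x # y # tl ts)) (hd ts) (hd ts)"
    for Q and ts :: "complex list"
  have tri: "has_laplace_pos (Suc m) (tri q) (mix Q)" if "has_laplace (Suc (Suc m)) q Q" for q Q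
    using has_laplace_pos_triangle[OF that] unfolding tri_def mix_def .
  define pr where "pr U p r xs = stab U (int (fst p)) (hd xs # nths (tl (tl xs)) (fst r)) *
      stab U (int (snd p)) (hd (tl xs) # nths (tl (tl xs)) (snd r))" for U p r xs
  have pr: "has_laplace (Suc (Suc m)) (pr V p r) (pr ?L p r)" if "r \<in> partitions m" for p r
    unfolding pr_def by (rule has_laplace_partition) (use lap that in auto)
  define third where "third j rs =
      (LBINT x=0..ereal (hd rs + tl rs ! j). of_real x * stab V (int g) (of_real x # remove_at j (map of_real (tl rs))))
    + (LBINT x=0..ereal (hd rs - tl rs ! j). of_real x * stab V (int g) (of_real x # remove_at j (map of_real (tl rs))))"
    for j rs
  define Z where "Z j t ts = 1 / (t\<^sup>2 - (ts ! j)\<^sup>2) *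
     (ts ! j / t * deriv (\<lambda>x. stab ?L (int g) (x # remove_at j ts)) t
      - t / ts ! j * deriv (\<lambda>x. stab ?L (int g) (x # remove_at j ts)) (ts ! j))" for j t ts
  \<comment> \<open>\<open>has_laplace_pos_third\<close> yields some \<open>G\<close> for each
    \<open>j\<close>; the predicate packs its two properties so that a function of \<open>j\<close>
    can be chosen.\<close>
  define good where "good j G \<longleftrightarrow> has_laplace_pos (Suc m) (third j) G \<and>
      (\<forall>t ts. t \<noteq> 0 \<and> 0 \<notin> set ts \<and> length ts = m \<and> t\<^sup>2 \<noteq> (ts ! j)\<^sup>2 \<longrightarrow> G (t # ts) = 2 * Z j t ts)"
    for j G
  have "\<exists>G. good j G" if j: "j < m" for j
  proof -
    have m1: "1 \<le> m" using j by simp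
    have even: "stab V (int g) ((- x) # xs) = stab V (int g) (x # xs)" if "length xs = m - 1" for x xs
    proof -
      have "\<forall>bs i. length bs = m \<and> i < m \<longrightarrow> V g (bs[i := - (bs ! i)]) = V g bs"
        by (rule volume_familyD(3)[OF V]) (use j n nm in auto)
      from spec[OF spec[OF this, of "x # xs"], of 0]
      have "V g ((- x) # xs) = V g (x # xs)" using that j by simp
      thus ?thesis by (simp add: stab_def)
    qed
    obtain G where "has_laplace_pos (Suc m) (third j) G"
      "\<And>t ts. t \<noteq> 0 \<Longrightarrow> 0 \<notin> set ts \<Longrightarrow> length ts = m \<Longrightarrow> t\<^sup>2 \<noteq> (ts ! j)\<^sup>2 \<Longrightarrow> G (t # ts) = 2 * Z j t ts"
      by (rule has_laplace_pos_third[OF lap[OF m1, of "int g"] j even, folded third_def Z_def]) auto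
    thus ?thesis unfolding good_def by blast
  qed
  then obtain G where "\<And>j. j < m \<Longrightarrow> good j (G j)" by metis
  hence G: "has_laplace_pos (Suc m) (third j) (G j)"
    "\<And>t ts. t \<noteq> 0 \<Longrightarrow> 0 \<notin> set ts \<Longrightarrow> length ts = m \<Longrightarrow> t\<^sup>2 \<noteq> (ts ! j)\<^sup>2 \<Longrightarrow> G j (t # ts) = 2 * Z j t ts"
    if "j < m" for j using that unfolding good_def by auto
  let ?h = "\<lambda>rs. 1/2 * tri (stab V (int g - 1)) rs
      + 1/2 * (\<Sum>p\<in>?S. \<Sum>r\<in>partitions m. tri (pr V p r) rs) + 1/2 * (\<Sum>j<m. third j rs)"
  let ?H = "\<lambda>ts. 1/2 * mix (stab ?L (int g - 1)) ts
      + 1/2 * (\<Sum>p\<in>?S. \<Sum>r\<in>partitions m. mix (pr ?L p r) ts) + 1/2 * (\<Sum>j<m. G j ts)"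
  have pos: "has_laplace_pos (Suc m) ?h ?H"
    by (intro has_laplace_pos_add has_laplace_pos_cmult has_laplace_pos_sum tri pr lap G) auto
  let ?w = "2 * of_real pi * \<i> :: complex"
  let ?f = "\<lambda>xs. 1 / (4 * of_real pi * \<i>) *
       ((hd xs + ?w) * V g ((hd xs + ?w) # tl xs) - (hd xs - ?w) * V g ((hd xs - ?w) # tl xs))"
  let ?F = "\<lambda>ts. - principal_part (\<lambda>s. sin (2 * of_real pi * s) / (2 * of_real pi) *
       deriv (\<lambda>x. ?L g (x # tl ts)) s) (hd ts)"
  have shift: "has_laplace (Suc m) ?f ?F"
    by (rule has_laplace_shift) (use has_laplace_volume[OF V n(1), of g] n nm in simp)
  have eq: "?f (map of_real rs) = ?h rs" if len: "length rs = Suc m" "\<forall>r\<in>set rs. 0 < r" for rs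
  proof -
    obtain b cs where rs: "rs = b # cs" "0 < b" "\<forall>r\<in>set cs. 0 < r" "length cs = m"
      using len by (cases rs) auto
    show ?thesis
      using N[unfolded recursion_N_def Let_def, rule_format, of b cs] rs nm
      unfolding tri_def pr_def third_def
      by (simp add: case_prod_beta mult.assoc)
  qed
  show ?thesis unfolding recursion_B_def
  proof (intro allI impI, elim conjE, goal_cases)
    case t: (1 t ts)
    have len: "length ts = m" using t(3) nm by simp
    let ?D = "\<lambda>h us. deriv (\<lambda>x. stab ?L h (x # us)) t"
    let ?Z = "\<lambda>j. 1 / (t\<^sup>2 - (ts ! j)\<^sup>2) * (ts ! j / t * ?D (int g) (remove_at j ts)
            - t / ts ! j * deriv (\<lambda>x. stab ?L (int g) (ts[j := x])) (ts ! j))"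
    \<comment> \<open>Both sides of (N) agree at positive lengths by \<open>eq\<close>, so their
      transforms agree at all nonzero arguments.\<close>
    have FH: "?F (t # ts) = ?H (t # ts)"
      by (rule has_laplace_pos_unique[OF shift pos eq]) (use t len in auto)
    have mp: "mix (pr ?L p r) (t # ts) = 1 / t * (?D (int (fst p)) (nths ts (fst r)) *
        ?D (int (snd p)) (nths ts (snd r)))" for p r
    proof -
      have "(\<lambda>x. stab ?L h (x # nths ts I)) field_differentiable at t" for h I
        by (rule has_laplace_field_differentiable[OF lap t(1) notin_set_nthsI[OF t(2)] refl]) simp
      thus ?thesis unfolding mix_def pr_def list.sel
        by (subst mixed_deriv_mult) auto
    qed
    have mg: "G j (t # ts) = 2 * ?Z j" if "j < m" for j
      unfolding G(2)[OF that t(1,2) len bspec[OF t(4) nth_mem[OF that[folded len]]]] Z_def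
        deriv_stab_list_update[OF F t(2) that[folded len]] ..
    have "?H (t # ts) = 1/2 * (1 / t * mixed_deriv (\<lambda>x y. stab ?L (int g - 1) (x # y # ts)) t t)
      + 1/2 * (\<Sum>p\<in>?S. \<Sum>r\<in>partitions m. 1 / t * (?D (int (fst p)) (nths ts (fst r)) *
        ?D (int (snd p)) (nths ts (snd r))))
      + 1/2 * (\<Sum>j<m. 2 * ?Z j)"
      by (intro arg_cong2[where f = "(+)"] arg_cong2[where f = "(*)"] refl sum.cong mp mg) (auto simp: mix_def)
    moreover have "1 / 2 * (\<Sum>j<m. 2 * X j) = (\<Sum>j<m. X j)" for X :: "nat \<Rightarrow> complex"
        by (simp add: sum_distrib_left)
    moreover have "1 / 2 * (\<Sum>p\<in>A. \<Sum>r\<in>B. 1 / t * (P p r * Q p r)) = (\<Sum>p\<in>A. \<Sum>r\<in>B. 1 / (2 * t) * P p r * Q p r)"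
        for A :: "(nat \<times> nat) set" and B :: "(nat set \<times> nat set) set" and P Q
        by (simp add: sum_distrib_left mult.assoc)
    moreover have "1 / 2 * (1 / t * X) = 1 / (2 * t) * X" for X by simp
    ultimately show ?case using FH by (simp only: list.sel nm case_prod_unfold diff_Suc_1)
  qed
qed

subsection \<open>Moments of the kernel\<close>

text \<open>\<open>H\<close> is a sum of two translates of this weight, which reduces its moments to
  those of a single function over a half-line.\<close>

definition logistic :: "real \<Rightarrow> real" where
  "logistic z = 1 / (1 + exp (z / 2))"

lemma H_logistic: "H x b = logistic (x + b) + logistic (x - b)"
  by (simp add: H_def logistic_def)

lemma logistic_nonneg: "0 \<le> logistic z"
  by (simp add: logistic_def add_nonneg_nonneg)

lemma logistic_measurable[measurable]: "logistic \<in> borel_measurable borel"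
  unfolding logistic_def by measurable

lemma isCont_logistic: "isCont logistic z"
proof -
  have "1 + exp (y / 2) \<noteq> (0 :: real)" for y using exp_gt_zero[of "y / 2"] by linarith
  thus ?thesis unfolding logistic_def by (intro continuous_intros) auto
qed

lemma logistic_minus: "logistic (- z) = 1 - logistic z"
proof -
  have "1 + exp (z / 2) \<noteq> 0" using exp_gt_zero[of "z / 2"] by linarith
  thus ?thesis by (simp add: logistic_def exp_minus divide_simps)
qed

lemma logistic_le: "logistic z \<le> exp (- (z / 2))"
proof -
  have "logistic z \<le> 1 / exp (z / 2)" unfolding logistic_def
    by (intro divide_left_mono mult_pos_pos add_pos_pos) auto
  thus ?thesis by (simp add: exp_minus inverse_eq_divide)
qed

definition logistic_moment :: "nat \<Rightarrow> real" where
  "logistic_moment k = (LINT z|lborel. indicator {0..} z * (z ^ k * logistic z))"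

lemma has_bochner_integral_logistic_moment:
  "has_bochner_integral lborel (\<lambda>z. indicator {0..} z * (z ^ k * logistic z)) (logistic_moment k)"
proof -
  have "integrable lborel (\<lambda>x. indicator {0..} x * (x ^ k * exp (- (1/2) * x)) :: real)"
    using has_bochner_integral_power_exp[of "1/2" k] by (auto simp: has_bochner_integral_iff)
  hence "integrable lborel (\<lambda>z. indicator {0..} z * (z ^ k * logistic z))"
    by (rule Bochner_Integration.integrable_bound)
       (auto simp: indicator_def logistic_nonneg abs_mult intro!: AE_I2 mult_left_mono logistic_le)
  thus ?thesis by (simp add: has_bochner_integral_iff logistic_moment_def)
qed

lemma logistic_moment_nonneg: "0 \<le> logistic_moment k"
  unfolding logistic_moment_def
  by (intro integral_nonneg_AE) (auto simp: indicator_def logistic_nonneg)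

lemma has_bochner_integral_logistic_shifted_power:
  "has_bochner_integral lborel (\<lambda>z. indicator {0..} z * ((z + b) ^ m * logistic z))
     (\<Sum>i\<le>m. of_nat (m choose i) * b ^ (m - i) * logistic_moment i)"
proof -
  have "has_bochner_integral lborel
      (\<lambda>z. \<Sum>i\<le>m. of_nat (m choose i) * b ^ (m - i) * (indicator {0..} z * (z ^ i * logistic z)))
      (\<Sum>i\<le>m. of_nat (m choose i) * b ^ (m - i) * logistic_moment i)"
    by (intro has_bochner_integral_sum has_bochner_integral_mult_right has_bochner_integral_logistic_moment)
  moreover have "(\<lambda>z. \<Sum>i\<le>m. of_nat (m choose i) * b ^ (m - i) * (indicator {0..} z * (z ^ i * logistic z))) =
      (\<lambda>z. indicator {0..} z * ((z + b) ^ m * logistic z))"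
    by (simp add: binomial_ring sum_distrib_left sum_distrib_right mult_ac)
  ultimately show ?thesis by simp
qed

text \<open>Translation turns the two halves of \<open>H\<close> into integrals of
  \<open>(z - b)^m\<close> over \<open>[b, \<infinity>)\<close> and of \<open>(z + b)^m\<close> over
  \<open>[- b, \<infinity>)\<close> against the weight. Each is compared with the integral over
  \<open>[0, \<infinity>)\<close>. The corrections are \<open>p\<close> and, by
  \<open>logistic (- z) = 1 - logistic z\<close>, the integral of \<open>(b - z)^m\<close> over
  \<open>[0, b]\<close> minus \<open>p\<close>; so \<open>p\<close> cancels and
  \<open>b^(m+1) / (m+1)\<close> remains.\<close>

lemma has_bochner_integral_H_aux:
  assumes "odd m" "0 \<le> b"
  shows "has_bochner_integral lborel (\<lambda>x. indicator {0..} x * (x ^ m * H x b))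
    (b ^ Suc m / real (Suc m) +
     (\<Sum>i\<le>m. of_nat (m choose i) * (b ^ (m - i) + (- b) ^ (m - i)) * logistic_moment i))"
proof -
  let ?Q = "\<lambda>b. \<Sum>i\<le>m. of_nat (m choose i) * b ^ (m - i) * logistic_moment i"
  have m: "m > 0" using assms(1) by (auto intro: Nat.gr0I)
  have b0: "0 \<le> b" by fact
  define p where "p = (LBINT z. indicator {0..b} z *\<^sub>R ((b - z) ^ m * logistic z))"
  have P: "has_bochner_integral lborel (\<lambda>z. indicator {0..b} z * ((b - z) ^ m * logistic z)) p"
  proof -
    have "set_integrable lborel {0..b} (\<lambda>z. (b - z) ^ m * logistic z)"
      by (rule borel_integrable_atLeastAtMost')
         (intro continuous_intros continuous_at_imp_continuous_on ballI isCont_logistic)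
    thus ?thesis unfolding p_def by (simp add: has_bochner_integral_iff set_integrable_def)
  qed
  have E: "has_bochner_integral lborel (\<lambda>z. indicator {0..b} z * (b - z) ^ m) (b ^ Suc m / real (Suc m))"
  proof -
    have "has_bochner_integral lborel (\<lambda>z. indicator {0..b} z *\<^sub>R (b - z) ^ m)
        (- ((b - b) ^ Suc m / real (Suc m)) - - ((b - 0) ^ Suc m / real (Suc m)))"
    proof (rule has_bochner_integral_FTC_Icc[OF b0])
      fix x :: real
      have "((\<lambda>x. - ((b - x) ^ Suc m / real (Suc m))) has_real_derivative (b - x) ^ m) (at x within {0..b})"
        by (auto intro!: derivative_eq_intros simp del: of_nat_Suc power_Suc)
      thus "((\<lambda>x. - ((b - x) ^ Suc m / real (Suc m))) has_vector_derivative (b - x) ^ m) (at x within {0..b})"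
        by (simp only: has_real_derivative_iff_has_vector_derivative)
    qed (intro continuous_intros)
    thus ?thesis by (simp del: of_nat_Suc)
  qed
  have plus: "has_bochner_integral lborel (\<lambda>x. indicator {0..} x * (x ^ m * logistic (x + b))) (?Q (- b) + p)"
  proof -
    let ?f = "\<lambda>z. indicator {b..} z * ((z - b) ^ m * logistic z)"
    have "has_bochner_integral lborel (\<lambda>z. indicator {0..} z * ((z + - b) ^ m * logistic z) +
        indicator {0..b} z * ((b - z) ^ m * logistic z)) (?Q (- b) + p)"
      by (intro has_bochner_integral_add has_bochner_integral_logistic_shifted_power P)
    moreover have "(b - z) ^ m = - ((z - b) ^ m)" for z
      using assms(1) power_minus_odd[of m "z - b"] by simp
    \<comment> \<open>For odd \<open>m\<close> the two integrands cancel on \<open>[0, b)\<close>.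
      At \<open>z = b\<close> the powers are 0 because \<open>m\<close> is positive.\<close>
    hence "(\<lambda>z. indicator {0..} z * ((z + - b) ^ m * logistic z) +
        indicator {0..b} z * ((b - z) ^ m * logistic z)) = ?f"
      using b0 m by (auto simp: indicator_def fun_eq_iff power_0_left)
    ultimately have "has_bochner_integral lborel ?f (?Q (- b) + p)" by simp
    hence "has_bochner_integral lborel (\<lambda>x. ?f (b + 1 * x)) ((?Q (- b) + p) /\<^sub>R \<bar>1\<bar>)"
      by (subst (asm) lborel_has_bochner_integral_real_affine_iff[where c = 1 and t = b]) auto
    moreover have "(\<lambda>x. ?f (b + 1 * x)) = (\<lambda>x. indicator {0..} x * (x ^ m * logistic (x + b)))"
      by (auto simp: indicator_def fun_eq_iff add.commute)
    ultimately show ?thesis by simp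
  qed
  have minus: "has_bochner_integral lborel (\<lambda>x. indicator {0..} x * (x ^ m * logistic (x - b)))
      (?Q b + (b ^ Suc m / real (Suc m) - p))"
  proof -
    let ?f = "\<lambda>z. indicator {- b..} z * ((z + b) ^ m * logistic z)"
    let ?R = "\<lambda>z. indicator {0..b} z * (b - z) ^ m - indicator {0..b} z * ((b - z) ^ m * logistic z)"
    have "has_bochner_integral lborel ?R (b ^ Suc m / real (Suc m) - p)"
      by (intro has_bochner_integral_diff E P)
    hence "has_bochner_integral lborel (\<lambda>z. ?R (0 + (-1) * z)) ((b ^ Suc m / real (Suc m) - p) /\<^sub>R \<bar>-1\<bar>)"
      by (subst (asm) lborel_has_bochner_integral_real_affine_iff[where c = "-1" and t = 0]) auto
    hence "has_bochner_integral lborel (\<lambda>z. ?R (- z)) (b ^ Suc m / real (Suc m) - p)" by simp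
    hence "has_bochner_integral lborel (\<lambda>z. indicator {0..} z * ((z + b) ^ m * logistic z) + ?R (- z))
        (?Q b + (b ^ Suc m / real (Suc m) - p))"
      by (intro has_bochner_integral_add has_bochner_integral_logistic_shifted_power)
    \<comment> \<open>At \<open>z = 0\<close> both pieces contribute, so the functions agree only
      almost everywhere.\<close>
    moreover have "AE z in lborel. indicator {0..} z * ((z + b) ^ m * logistic z) + ?R (- z) = ?f z"
      using AE_lborel_singleton[of "0::real"]
    proof eventually_elim
      case (elim z)
      thus ?case using b0
        by (auto simp: indicator_def logistic_minus algebra_simps)
    qed
    ultimately have "has_bochner_integral lborel ?f (?Q b + (b ^ Suc m / real (Suc m) - p))"
      by (subst (asm) has_bochner_integral_cong_AE) (auto intro!: borel_measurable_times borel_measurable_add borel_measurable_diff)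
    hence "has_bochner_integral lborel (\<lambda>x. ?f (- b + 1 * x)) ((?Q b + (b ^ Suc m / real (Suc m) - p)) /\<^sub>R \<bar>1\<bar>)"
      by (subst (asm) lborel_has_bochner_integral_real_affine_iff[where c = 1 and t = "- b"]) auto
    moreover have "(\<lambda>x. ?f (- b + 1 * x)) = (\<lambda>x. indicator {0..} x * (x ^ m * logistic (x - b)))"
      by (auto simp: indicator_def fun_eq_iff)
    ultimately show ?thesis by simp
  qed
  have "(\<lambda>x. indicator {0..} x * (x ^ m * H x b)) =
      (\<lambda>x. indicator {0..} x * (x ^ m * logistic (x + b)) + indicator {0..} x * (x ^ m * logistic (x - b)))"
    by (simp add: H_logistic algebra_simps)
  moreover have "(?Q (- b) + p) + (?Q b + (b ^ Suc m / real (Suc m) - p)) =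
    b ^ Suc m / real (Suc m) +
     (\<Sum>i\<le>m. of_nat (m choose i) * (b ^ (m - i) + (- b) ^ (m - i)) * logistic_moment i)"
    by (simp add: sum.distrib distrib_left distrib_right del: of_nat_Suc power_Suc)
  ultimately show ?thesis using has_bochner_integral_add[OF plus minus] by (simp only:)
qed

text \<open>The coefficient of \<open>t^(2i)\<close> in \<open>2 pi t / sin (2 pi t)\<close>, as
  \<open>csc_coeff_sums\<close> will show. The case \<open>i = 0\<close> stands apart because it
  stems from the term \<open>b^(m+1) / (m+1)\<close> and not from a moment.\<close>

definition csc_coeff :: "nat \<Rightarrow> real" where
  "csc_coeff i = (if i = 0 then 1 else 2 * logistic_moment (2 * i - 1) / fact (2 * i - 1))"

text \<open>The coefficient of \<open>t^(2k+2)\<close> in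
  \<open>2 pi t / sin (2 pi t) * cosh (b t)\<close>.\<close>

definition kernel_poly :: "nat \<Rightarrow> real \<Rightarrow> real" where
  "kernel_poly k b = (\<Sum>i\<le>Suc k. csc_coeff i * b ^ (2 * (Suc k - i)) / fact (2 * (Suc k - i)))"

text \<open>Negative \<open>b\<close> occurs later as \<open>b - b_j\<close>; it is reduced to
  \<open>\<bar>b\<bar>\<close>, since \<open>H\<close> and \<open>kernel_poly\<close> are even in
  \<open>b\<close>. Of the binomial terms for odd exponent only the odd moments survive, and these
  carry even powers of \<open>b\<close>.\<close>

lemma has_bochner_integral_H:
  "has_bochner_integral lborel (\<lambda>x. indicator {0..} x * (x ^ (2 * k + 1) * H x b))
    (fact (2 * k + 1) * kernel_poly k b)"
proof -
  let ?m = "2 * k + 1"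
  have even: "kernel_poly k \<bar>b\<bar> = kernel_poly k b" unfolding kernel_poly_def
    by (simp add: power_mult)
  have "H x \<bar>b\<bar> = H x b" for x by (auto simp: H_def abs_if)
  moreover have "has_bochner_integral lborel (\<lambda>x. indicator {0..} x * (x ^ ?m * H x \<bar>b\<bar>))
    (\<bar>b\<bar> ^ Suc ?m / real (Suc ?m) +
     (\<Sum>i\<le>?m. of_nat (?m choose i) * (\<bar>b\<bar> ^ (?m - i) + (- \<bar>b\<bar>) ^ (?m - i)) * logistic_moment i))"
    by (rule has_bochner_integral_H_aux) auto
  moreover have "\<bar>b\<bar> ^ Suc ?m / real (Suc ?m) +
     (\<Sum>i\<le>?m. of_nat (?m choose i) * (\<bar>b\<bar> ^ (?m - i) + (- \<bar>b\<bar>) ^ (?m - i)) * logistic_moment i) =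
     fact ?m * kernel_poly k \<bar>b\<bar>"
  proof -
    define c where "c = \<bar>b\<bar>"
    let ?g = "\<lambda>i. of_nat (?m choose i) * (c ^ (?m - i) + (- c) ^ (?m - i)) * logistic_moment i"
    have "(\<Sum>i\<le>?m. ?g i) = (\<Sum>l\<le>k. ?g (2 * l) + ?g (Suc (2 * l)))"
      using sum.in_pairs_0[of ?g k] by simp
    also have "\<dots> = (\<Sum>l\<le>k. of_nat (?m choose (2 * l + 1)) * (2 * c ^ (?m - (2 * l + 1))) * logistic_moment (2 * l + 1))"
    proof (rule sum.cong[OF refl])
      fix l assume "l \<in> {..k}"
      hence "?m - 2 * l = Suc (2 * (k - l))" "?m - Suc (2 * l) = 2 * (k - l)" by auto
      thus "?g (2 * l) + ?g (Suc (2 * l)) =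
          of_nat (?m choose (2 * l + 1)) * (2 * c ^ (?m - (2 * l + 1))) * logistic_moment (2 * l + 1)"
        by (simp del: binomial_Suc_Suc)
    qed
    also have "\<dots> = (\<Sum>l\<le>k. fact ?m * (csc_coeff (Suc l) * c ^ (2 * (Suc k - Suc l)) / fact (2 * (Suc k - Suc l))))"
    proof (rule sum.cong[OF refl])
      fix l assume "l \<in> {..k}"
      hence l: "2 * l + 1 \<le> ?m" by simp
      have e: "?m - (2 * l + 1) = 2 * (Suc k - Suc l)" by simp
      have "of_nat (?m choose (2 * l + 1)) = (fact ?m / (fact (2 * l + 1) * fact (2 * (Suc k - Suc l))) :: real)"
        using binomial_fact[OF l, where 'a = real] unfolding e .
      thus "of_nat (?m choose (2 * l + 1)) * (2 * c ^ (?m - (2 * l + 1))) * logistic_moment (2 * l + 1) =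
          fact ?m * (csc_coeff (Suc l) * c ^ (2 * (Suc k - Suc l)) / fact (2 * (Suc k - Suc l)))"
        unfolding e by (simp add: csc_coeff_def del: fact_Suc)
    qed
    finally have odd_terms: "(\<Sum>i\<le>?m. ?g i) =
      (\<Sum>l\<le>k. fact ?m * (csc_coeff (Suc l) * c ^ (2 * (Suc k - Suc l)) / fact (2 * (Suc k - Suc l))))" .
    have leading: "c ^ Suc ?m / real (Suc ?m) = fact ?m * (csc_coeff 0 * c ^ (2 * (Suc k - 0)) / fact (2 * (Suc k - 0)))"
    proof -
      have e: "2 * (Suc k - 0) = Suc ?m" by simp
      show ?thesis unfolding e fact_Suc[of ?m]
        by (simp add: csc_coeff_def del: fact_Suc of_nat_Suc power_Suc)
    qed
    show ?thesis unfolding kernel_poly_def c_def[symmetric] odd_terms leading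
      by (simp only: sum.atMost_Suc_shift distrib_left sum_distrib_left)
  qed
  ultimately show ?thesis by (simp only: even)
qed

subsection \<open>The generating function of the moments\<close>

text \<open>Substituting u = 1 / (1 + exp (- (x / 2))) turns the Beta integral into the Laplace transform of the logistic weight.\<close>

lemma nn_integral_exp_logistic:
  assumes "0 < t" "t < 1 / 2"
  shows "(\<integral>\<^sup>+ x. ennreal (exp (t * x) * logistic x) \<partial>lborel) = ennreal (2 * pi / sin (2 * pi * t))"
proof -
  define a where "a = 2 * t"
  have a: "0 < a" "a < 1" using assms by (auto simp: a_def)
  define g where "g x = 1 / (1 + exp (- (x / 2)))" for x :: real
  define g' where "g' x = exp (- (x / 2)) / 2 / (1 + exp (- (x / 2)))\<^sup>2" for x :: real
  define f where "f u = u powr (a - 1) * (1 - u) powr (- a)" for u :: real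
  have pos: "0 < 1 + exp (- (x / 2))" for x :: real by (intro add_pos_pos) auto
  have img: "g ` UNIV = {0<..<1}"
  proof (intro equalityI subsetI)
    fix u :: real assume u: "u \<in> {0<..<1}"
    have "g (- 2 * ln (1 / u - 1)) = u" using u by (simp add: g_def)
    thus "u \<in> g ` UNIV" by (metis rangeI)
  next
    fix u assume "u \<in> g ` UNIV"
    then obtain x where "u = g x" by auto
    thus "u \<in> {0<..<1}" using pos[of x] by (simp add: g_def divide_less_eq)
  qed
  have der: "(g has_field_derivative g' x) (at x within UNIV)" for x
    unfolding g_def g'_def using pos[of x]
    by (auto intro!: derivative_eq_intros simp: power2_eq_square field_simps)
  have inj: "inj_on g UNIV"
  proof (rule injI)
    fix x y assume "g x = g y"
    hence "1 + exp (- (x / 2)) = 1 + exp (- (y / 2))" using pos[of x] pos[of y] by (simp add: g_def)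
    thus "x = y" by simp
  qed
  have f: "f absolutely_integrable_on {0<..<1}" "integral {0<..<1} f = Beta a (1 - a)"
  proof -
    have "(f has_integral Beta a (1 - a)) {0..1}"
      using has_integral_Beta_real[of a "1 - a"] a by (simp add: f_def[abs_def])
    hence "(f has_integral Beta a (1 - a)) {0<..<1}" by (simp add: has_integral_Icc_iff_Ioo)
    thus "integral {0<..<1} f = Beta a (1 - a)" "f absolutely_integrable_on {0<..<1}"
      by (auto simp: f_def intro!: nonnegative_absolutely_integrable_1)
  qed
  have eq: "\<bar>g' x\<bar> * f (g x) = (1/2) * (exp (t * x) * logistic x)" for x
  proof -
    define E where "E = exp (x / 2)"
    have E: "0 < E" "exp (- (x / 2)) = 1 / E" by (simp_all add: E_def exp_minus inverse_eq_divide)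
    have E1: "1 + E \<noteq> 0" using E(1) by simp
    have "g x = E / (1 + E)" unfolding g_def E(2) using E(1) E1 by (simp add: field_simps)
    moreover from this have "1 - g x = 1 / (1 + E)" using E1 by (simp add: field_simps)
    ultimately have "f (g x) = (E / (1 + E)) powr (a - 1) * (1 / (1 + E)) powr (- a)" by (simp add: f_def)
    also have "\<dots> = E powr (a - 1) * (1 + E)"
      using E by (simp add: powr_divide powr_minus powr_diff field_simps)
    also have "E powr (a - 1) = exp (t * x) / E"
      using E by (simp add: powr_diff) (simp add: E_def powr_def a_def)
    finally have fg: "f (g x) = exp (t * x) / E * (1 + E)" .
    have "1 + 1 / E = (1 + E) / E" using E(1) by (simp add: field_simps)
    hence g': "\<bar>g' x\<bar> = E / 2 / (1 + E)\<^sup>2"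
      unfolding g'_def E(2) using E(1) by (simp add: power2_eq_square)
    have l: "logistic x = 1 / (1 + E)" by (simp add: logistic_def E_def)
    show ?thesis unfolding fg g' l using E(1) E1 by (simp add: power2_eq_square)
  qed
  have "(\<lambda>x. \<bar>g' x\<bar> * f (g x)) absolutely_integrable_on UNIV \<and>
      integral UNIV (\<lambda>x. \<bar>g' x\<bar> * f (g x)) = Beta a (1 - a)"
    using has_absolute_integral_change_of_variables_1'[of UNIV g g' f, OF _ der inj] f
    unfolding img by auto
  hence int: "(\<lambda>x. (1/2) * (exp (t * x) * logistic x)) absolutely_integrable_on UNIV"
    "integral UNIV (\<lambda>x. (1/2) * (exp (t * x) * logistic x)) = Beta a (1 - a)"
    unfolding eq by blast+
  have "((\<lambda>x. (1/2) * (exp (t * x) * logistic x)) has_integral Beta a (1 - a)) UNIV"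
    using integrable_integral[OF set_lebesgue_integral_eq_integral(1)[OF int(1)]] by (simp only: int(2))
  hence "((\<lambda>x. 2 * ((1/2) * (exp (t * x) * logistic x))) has_integral 2 * Beta a (1 - a)) UNIV"
    by (rule has_integral_mult_right)
  hence "((\<lambda>x. exp (t * x) * logistic x) has_integral 2 * Beta a (1 - a)) UNIV" by simp
  \<comment> \<open>The Gamma function at \<open>a + (1 - a) = 1\<close> is 1, so the Beta value is
    a product to which the reflection formula applies.\<close>
  moreover have "2 * Beta a (1 - a) = 2 * pi / sin (2 * pi * t)"
  proof -
    have "complex_of_real (Gamma a * Gamma (1 - a)) = Gamma (of_real a) * Gamma (1 - of_real a)"
      by (simp only: of_real_mult Gamma_complex_of_real[symmetric] of_real_diff of_real_1)
    also have "\<dots> = of_real pi / sin (of_real pi * of_real a)" by (rule Gamma_reflection_complex)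
    also have "\<dots> = of_real (pi / sin (pi * a))"
      by (simp only: of_real_divide sin_of_real[symmetric] of_real_mult)
    finally have "Gamma a * Gamma (1 - a) = pi / sin (pi * a)" by (simp only: of_real_eq_iff)
    thus ?thesis by (simp add: Beta_def a_def mult_ac)
  qed
  moreover have "(\<lambda>x. exp (t * x) * logistic x) \<in> borel_measurable borel" by measurable
  ultimately show ?thesis
    by (subst nn_integral_has_integral_lborel) (auto simp: logistic_nonneg)
qed

lemma has_bochner_integral_exp_logistic:
  assumes "0 < t" "t < 1 / 2"
  shows "has_bochner_integral lborel (\<lambda>x. exp (t * x) * logistic x) (2 * pi / sin (2 * pi * t))"
proof (rule has_bochner_integral_nn_integral)
  have "0 < sin (2 * pi * t)" using assms by (intro sin_gt_zero) auto
  thus "0 \<le> 2 * pi / sin (2 * pi * t)" by simp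
qed (auto simp: logistic_nonneg nn_integral_exp_logistic[OF assms])

lemma logistic_le_one: "logistic z \<le> 1"
  using logistic_nonneg[of "- z"] by (simp add: logistic_minus)

text \<open>The integral over the whole line is folded onto the half-line. On the negative side
  \<open>logistic (- x) = 1 - logistic x\<close>, and the summand 1 contributes the integral of
  \<open>exp (- t * x)\<close>, which is \<open>1 / t\<close>.\<close>

lemma has_bochner_integral_sinh_logistic:
  assumes t: "0 < t" "t < 1 / 2"
  shows "has_bochner_integral lborel
     (\<lambda>x. indicator {0..} x * ((exp (t * x) - exp (- t * x)) * logistic x)) (2 * pi / sin (2 * pi * t) - 1 / t)"
proof -
  let ?f = "\<lambda>x. exp (t * x) * logistic x"
  define q where "q = (LINT x|lborel. indicator {0..} x * (exp (- t * x) * logistic x))"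
  have e: "has_bochner_integral lborel (\<lambda>x. indicator {0..} x * exp (- t * x)) (1 / t)"
    using has_bochner_integral_power_exp[OF t(1), of 0] by simp
  have q: "has_bochner_integral lborel (\<lambda>x. indicator {0..} x * (exp (- t * x) * logistic x)) q"
  proof -
    have "integrable lborel (\<lambda>x. indicator {0..} x * exp (- t * x) :: real)"
      using e by (simp add: has_bochner_integral_iff)
    hence "integrable lborel (\<lambda>x. indicator {0..} x * (exp (- t * x) * logistic x))"
      by (rule Bochner_Integration.integrable_bound)
         (auto simp: indicator_def abs_mult logistic_nonneg intro!: AE_I2 mult_left_le logistic_le_one)
    thus ?thesis by (simp add: q_def has_bochner_integral_iff)
  qed
  have "has_bochner_integral lborel (\<lambda>x. indicator {0..} x * exp (- t * x) -
      indicator {0..} x * (exp (- t * x) * logistic x)) (1 / t - q)"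
    by (intro has_bochner_integral_diff e q)
  hence "has_bochner_integral lborel (\<lambda>x. (\<lambda>x. indicator {0..} x * exp (- t * x) -
      indicator {0..} x * (exp (- t * x) * logistic x)) (0 + (-1) * x)) ((1 / t - q) /\<^sub>R \<bar>-1\<bar>)"
    by (subst (asm) lborel_has_bochner_integral_real_affine_iff[where c = "-1" and t = 0]) auto
  hence "has_bochner_integral lborel (\<lambda>x. indicator {0..} (- x) * exp (t * x) -
      indicator {0..} (- x) * (exp (t * x) * logistic (- x))) (1 / t - q)" by simp
  hence "has_bochner_integral lborel (\<lambda>x. indicator {..0} x * ?f x) (1 / t - q)"
  proof (elim has_bochner_integral_cong[THEN iffD1, rotated -1])
    show "indicator {0..} (- x) * exp (t * x) - indicator {0..} (- x) * (exp (t * x) * logistic (- x)) =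
      indicator {..0} x * ?f x" for x
      by (auto simp: indicator_def logistic_minus algebra_simps)
  qed auto
  from has_bochner_integral_diff[OF has_bochner_integral_diff[OF has_bochner_integral_exp_logistic[OF t] this] q]
  have *: "has_bochner_integral lborel (\<lambda>x. ?f x - indicator {..0} x * ?f x -
      indicator {0..} x * (exp (- t * x) * logistic x)) (2 * pi / sin (2 * pi * t) - 1 / t)" by simp
  have "AE x in lborel. ?f x - indicator {..0} x * ?f x - indicator {0..} x * (exp (- t * x) * logistic x) =
      indicator {0..} x * ((exp (t * x) - exp (- t * x)) * logistic x)"
    using AE_lborel_singleton[of "0::real"]
    by eventually_elim (auto simp: indicator_def algebra_simps)
  thus ?thesis using * by (subst (asm) has_bochner_integral_cong_AE) auto
qed

lemma has_bochner_integral_nonneg: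
  fixes f :: "'a \<Rightarrow> real"
  assumes "has_bochner_integral M f x" "\<And>y. 0 \<le> f y"
  shows "0 \<le> x" "(\<integral>\<^sup>+ y. ennreal (f y) \<partial>M) = ennreal x"
proof -
  have f: "integrable M f" "integral\<^sup>L M f = x" using assms(1) by (auto simp: has_bochner_integral_iff)
  show "0 \<le> x" using Bochner_Integration.integral_nonneg[of M f] assms(2) f(2) by simp
  show "(\<integral>\<^sup>+ y. ennreal (f y) \<partial>M) = ennreal x"
    using nn_integral_eq_integral[OF f(1)] assms(2) f(2) by simp
qed

lemma csc_coeff_nonneg: "0 \<le> csc_coeff i"
  by (simp add: csc_coeff_def logistic_moment_nonneg)

text \<open>Expanding \<open>exp (t * x) - exp (- t * x)\<close> produces the odd moments. All terms
  are nonnegative, so sum and integral may be exchanged, and finiteness of the integral gives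
  convergence of the series. For \<open>t < 1/2\<close> the growth of \<open>exp (t * x)\<close> is
  beaten by the decay \<open>exp (- x / 2)\<close> of the weight.\<close>

lemma csc_coeff_sums:
  assumes t: "0 < t" "t < 1 / 2"
  shows "(\<lambda>i. csc_coeff i * t ^ (2 * i)) sums (2 * pi * t / sin (2 * pi * t))"
proof -
  let ?h = "\<lambda>x. indicator {0..} x * ((exp (t * x) - exp (- t * x)) * logistic x)"
  let ?a = "\<lambda>l. csc_coeff (Suc l) * t ^ (2 * l + 1)"
  define f where "f l x = indicator {0..} x * (2 * (t * x) ^ (2 * l + 1) / fact (2 * l + 1) * logistic x)"
    for l :: nat and x :: real
  have f0: "0 \<le> f l x" for l x using t(1) by (auto simp: f_def indicator_def logistic_nonneg)
  have [measurable]: "f l \<in> borel_measurable borel" for l unfolding f_def by measurable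
  have fint: "has_bochner_integral lborel (f l) (?a l)" for l
  proof -
    have "has_bochner_integral lborel (\<lambda>z. 2 * t ^ (2 * l + 1) / fact (2 * l + 1) *
        (indicator {0..} z * (z ^ (2 * l + 1) * logistic z)))
        (2 * t ^ (2 * l + 1) / fact (2 * l + 1) * logistic_moment (2 * l + 1))"
      by (intro has_bochner_integral_mult_right has_bochner_integral_logistic_moment)
    moreover have "(\<lambda>z. 2 * t ^ (2 * l + 1) / fact (2 * l + 1) * (indicator {0..} z * (z ^ (2 * l + 1) * logistic z))) = f l"
      unfolding f_def power_mult_distrib by (auto simp: mult_ac)
    moreover have "2 * t ^ (2 * l + 1) / fact (2 * l + 1) * logistic_moment (2 * l + 1) = ?a l"
      by (simp add: csc_coeff_def)
    ultimately show ?thesis by simp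
  qed
  have fsum: "(\<lambda>l. f l x) sums ?h x" for x
  proof -
    have "(\<lambda>n. (if odd n then 2 * (t * x) ^ n / fact n else 0)) sums (exp (t * x) - exp (- t * x))"
    proof -
      have "(\<lambda>n. (t * x) ^ n /\<^sub>R fact n - (- t * x) ^ n /\<^sub>R fact n) sums (exp (t * x) - exp (- t * x))"
        by (intro sums_diff exp_converges)
      moreover have "(t * x) ^ n /\<^sub>R fact n - (- t * x) ^ n /\<^sub>R fact n = (if odd n then 2 * (t * x) ^ n / fact n else 0)" for n
        using power_minus[of "t * x" n] by (auto simp: divide_inverse)
      ultimately show ?thesis by (simp only:)
    qed
    hence "(\<lambda>l. (if odd (2 * l + 1) then 2 * (t * x) ^ (2 * l + 1) / fact (2 * l + 1) else 0)) sums
        (exp (t * x) - exp (- t * x))"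
      by (subst (asm) sums_mono_reindex[of "\<lambda>l. 2 * l + 1", symmetric])
         (auto simp: strict_mono_def image_iff elim!: oddE)
    hence "(\<lambda>l. indicator {0..} x * (2 * (t * x) ^ (2 * l + 1) / fact (2 * l + 1) * logistic x)) sums ?h x"
      by (intro sums_mult sums_mult2) simp
    thus ?thesis by (simp add: f_def)
  qed
  let ?S = "2 * pi / sin (2 * pi * t) - 1 / t"
  have nonneg: "0 \<le> ?h x" for x
    using t(1) by (auto simp: indicator_def logistic_nonneg)
  have S: "0 \<le> ?S" "(\<integral>\<^sup>+ x. ennreal (?h x) \<partial>lborel) = ennreal ?S"
    by (rule has_bochner_integral_nonneg[OF has_bochner_integral_sinh_logistic[OF t] nonneg])+
  have c0: "0 \<le> ?a l" for l
    using t(1) csc_coeff_nonneg by simp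
  have "(\<Sum>l. ennreal (?a l)) = (\<Sum>l. \<integral>\<^sup>+ x. ennreal (f l x) \<partial>lborel)"
    by (intro suminf_cong has_bochner_integral_nonneg(2)[symmetric] fint f0)
  also have "\<dots> = (\<integral>\<^sup>+ x. (\<Sum>l. ennreal (f l x)) \<partial>lborel)"
    by (rule nn_integral_suminf[symmetric]) simp
  also have "\<dots> = (\<integral>\<^sup>+ x. ennreal (?h x) \<partial>lborel)"
    by (intro nn_integral_cong suminf_ennreal_eq f0 fsum)
  also have "\<dots> = ennreal ?S" by (rule S(2))
  finally have *: "(\<Sum>l. ennreal (?a l)) = ennreal ?S" .
  hence summable: "summable ?a"
    by (intro summable_suminf_not_top c0) simp
  have "ennreal (\<Sum>l. ?a l) = ennreal ?S"
    using * suminf_ennreal2[OF c0 summable] by simp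
  hence "(\<Sum>l. ?a l) = ?S"
    using S(1) suminf_nonneg[OF summable c0] by simp
  hence "?a sums ?S" using summable by (simp add: sums_iff)
  from sums_mult[OF this, of t] have "(\<lambda>l. csc_coeff (Suc l) * t ^ (2 * Suc l)) sums (t * ?S)"
    by (simp add: mult_ac)
  hence "(\<lambda>l. csc_coeff l * t ^ (2 * l)) sums (t * ?S + csc_coeff 0 * t ^ (2 * 0))"
    by (subst (asm) sums_Suc_iff) simp
  moreover have "t * ?S + csc_coeff 0 * t ^ (2 * 0) = 2 * pi * t / sin (2 * pi * t)"
    using t(1) by (simp add: csc_coeff_def right_diff_distrib)
  ultimately show ?thesis by simp
qed

text \<open>As series in \<open>x = t^2\<close>, those of \<open>2 pi t / sin (2 pi t)\<close> and
  \<open>sin (2 pi t) / (2 pi t)\<close> have product 1 to the right of 0. A power series whose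
  zeros accumulate at 0 is zero, so their Cauchy product has no coefficient beyond the constant
  one.\<close>

lemma csc_coeff_convolution:
  "(\<Sum>i\<le>N. csc_coeff i * ((- 1) ^ (N - i) * (2 * pi) ^ (2 * (N - i)) / fact (2 * (N - i) + 1))) =
    (if N = 0 then 1 else 0)"
proof -
  define b where "b j = (- 1) ^ j * (2 * pi) ^ (2 * j) / fact (2 * j + 1)" for j
  define c where "c n = (\<Sum>i\<le>n. csc_coeff i * b (n - i))" for n
  have c0: "c 0 = 1" by (simp add: c_def b_def csc_coeff_def)
  have bsums: "(\<lambda>j. b j * t ^ (2 * j)) sums (sin (2 * pi * t) / (2 * pi * t))" if "t \<noteq> 0" for t
  proof -
    have "(\<lambda>n. (- 1) ^ n / fact (2 * n + 1) * (2 * pi * t) ^ (2 * n + 1) / (2 * pi * t)) sums (sin (2 * pi * t) / (2 * pi * t))"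
      by (intro sums_divide sin_paired)
    moreover have "(- 1) ^ n / fact (2 * n + 1) * (2 * pi * t) ^ (2 * n + 1) / (2 * pi * t) = b n * t ^ (2 * n)" for n
      using that unfolding b_def by (simp add: power_mult_distrib)
    ultimately show ?thesis by (simp only:)
  qed
  have csums: "(\<lambda>n. c n * x ^ n) sums ((\<Sum>n. csc_coeff n * x ^ n) * (\<Sum>n. b n * x ^ n))"
    if x: "\<bar>x\<bar> < 1 / 4" for x
  proof -
    \<comment> \<open>\<open>t^2\<close> is the midpoint of \<open>\<bar>x\<bar>\<close> and
      \<open>1/4\<close>: it exceeds \<open>\<bar>x\<bar>\<close>, as absolute convergence requires,
      and \<open>t\<close> stays below \<open>1/2\<close>.\<close>
    define t where "t = sqrt ((\<bar>x\<bar> + 1 / 4) / 2)"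
    have t2: "t ^ 2 = (\<bar>x\<bar> + 1 / 4) / 2" by (simp add: t_def)
    have "t < sqrt (1 / 4)" unfolding t_def using x by simp
    hence t: "0 < t" "t < 1 / 2" by (auto simp: t_def real_sqrt_divide)
    have "summable (\<lambda>n. csc_coeff n * (t ^ 2) ^ n)"
      using csc_coeff_sums[OF t] by (simp add: power_mult sums_iff)
    moreover have "norm x < norm (t ^ 2)" using x unfolding t2 by simp
    ultimately have 1: "summable (\<lambda>n. norm (csc_coeff n * x ^ n))" by (rule powser_insidea)
    have "summable (\<lambda>n. b n * 1 ^ n)" using bsums[of 1] by (simp add: sums_iff)
    hence 2: "summable (\<lambda>n. norm (b n * x ^ n))" by (rule powser_insidea) (use x in simp)
    have "csc_coeff i * x ^ i * (b (n - i) * x ^ (n - i)) = csc_coeff i * b (n - i) * x ^ n" if "i \<le> n" for i n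
      using that by (simp add: power_add[symmetric] mult_ac)
    hence "(\<lambda>n. \<Sum>i\<le>n. csc_coeff i * x ^ i * (b (n - i) * x ^ (n - i))) = (\<lambda>n. c n * x ^ n)"
      by (auto simp: c_def sum_distrib_right intro!: sum.cong)
    thus ?thesis using Cauchy_product_sums[OF 1 2] by simp
  qed
  have cone: "(\<Sum>n. csc_coeff n * x ^ n) * (\<Sum>n. b n * x ^ n) = 1" if x: "0 < x" "x < 1 / 4" for x
  proof -
    have t2: "sqrt x ^ 2 = x" using x by simp
    have "sqrt x < sqrt (1 / 4)" using x by simp
    hence t: "0 < sqrt x" "sqrt x < 1 / 2" using x by (auto simp: real_sqrt_divide)
    have "0 < sin (2 * pi * sqrt x)" using t by (intro sin_gt_zero) auto
    thus ?thesis using csc_coeff_sums[OF t] bsums[of "sqrt x"] x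
      by (simp add: power_mult t2 sums_iff)
  qed
  have "c N = 0" if Npos: "N > 0"
  proof (rule ccontr)
    assume N: "c N \<noteq> 0"
    define d where "d n = (if n = 0 then 0 else c n)" for n
    define f where "f x = (\<Sum>n. csc_coeff n * x ^ n) * (\<Sum>n. b n * x ^ n) - 1" for x
    have f0: "f 0 = 0" unfolding f_def powser_zero by (simp add: b_def csc_coeff_def)
    have sums: "(\<lambda>n. d n * (x - 0) ^ n) sums f x" if "norm (x - 0) < 1 / 4" for x
    proof -
      have "(\<lambda>n. c n * x ^ n - (if n = 0 then 1 else 0)) sums f x"
        unfolding f_def using that by (intro sums_diff csums sums_single[of 0 "\<lambda>_. 1", simplified]) auto
      moreover have "c n * x ^ n - (if n = 0 then 1 else 0) = d n * (x - 0) ^ n" for n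
        using c0 by (simp add: d_def)
      ultimately show ?thesis by simp
    qed
    obtain s where s: "0 < s" "\<And>x. x \<in> cball 0 s - {0} \<Longrightarrow> f x \<noteq> 0"
      by (rule powser_0_nonzero[of "1 / 4" 0 d f N, OF _ sums f0]) (use N Npos in \<open>auto simp: d_def\<close>)
    have "f (min s (1 / 8)) \<noteq> 0" using s(1) by (intro s(2)) auto
    moreover have "f (min s (1 / 8)) = 0" unfolding f_def using s(1) by (subst cone) auto
    ultimately show False by simp
  qed
  thus ?thesis using c0 unfolding c_def b_def by simp
qed

subsection \<open>Recursion (M) implies recursion (N)\<close>

text \<open>The left-hand side of (N) when \<open>p\<close> is the polynomial
  \<open>b * V\<close>.\<close>

definition shift_quot :: "complex poly \<Rightarrow> complex \<Rightarrow> complex" where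
  "shift_quot p z = 1 / (4 * of_real pi * \<i>) *
     (poly p (z + 2 * of_real pi * \<i>) - poly p (z - 2 * of_real pi * \<i>))"

lemma shift_quot_simps:
  "shift_quot 0 z = 0"
  "shift_quot (p + q) z = shift_quot p z + shift_quot q z"
  "shift_quot (smult c p) z = c * shift_quot p z"
  by (simp_all add: shift_quot_def algebra_simps add_divide_distrib diff_divide_distrib)

lemma shift_quot_sum: "shift_quot (\<Sum>a\<in>A. p a) z = (\<Sum>a\<in>A. shift_quot (p a) z)"
  by (induction A rule: infinite_finite_induct) (simp_all add: shift_quot_simps)

lemma power_add_diff_odd:
  fixes z w :: complex
  shows "(z + w) ^ (2 * m + 1) - (z - w) ^ (2 * m + 1) =
    2 * (\<Sum>q\<le>m. of_nat (2 * m + 1 choose (2 * (m - q))) * w ^ (2 * q + 1) * z ^ (2 * (m - q)))"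
proof -
  let ?n = "Suc (2 * m)"
  let ?g = "\<lambda>i. of_nat (?n choose i) * z ^ i * (w ^ (?n - i) - (- w) ^ (?n - i))"
  let ?h = "\<lambda>l. 2 * (of_nat (?n choose (2 * l)) * w ^ (2 * (m - l) + 1) * z ^ (2 * l))"
  have "(z + w) ^ ?n - (z - w) ^ ?n = (\<Sum>i\<le>?n. ?g i)"
    unfolding diff_conv_add_uminus[of z] binomial_ring by (simp add: sum_subtractf right_diff_distrib)
  also have "\<dots> = (\<Sum>l\<le>m. ?h l)"
    unfolding sum.in_pairs_0
  proof (rule sum.cong[OF refl])
    fix l assume "l \<in> {..m}"
    hence "?n - 2 * l = 2 * (m - l) + 1" "?n - Suc (2 * l) = 2 * (m - l)" by auto
    thus "?g (2 * l) + ?g (Suc (2 * l)) = ?h l" by simp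
  qed
  also have "\<dots> = (\<Sum>q\<le>m. ?h (m - q))"
    using sum.nat_diff_reindex[of ?h "Suc m"] by (simp only: lessThan_Suc_atMost diff_Suc_Suc)
  finally show ?thesis by (simp add: sum_distrib_left del: binomial_Suc_Suc power_Suc)
qed

text \<open>Division by \<open>2 w\<close> leaves even powers of \<open>w = 2 pi i\<close>, which
  are real since \<open>w^2 = - (2 pi)^2\<close>. The coefficients are those of
  \<open>sin (2 pi t) / (2 pi t)\<close>.\<close>

lemma shift_quot_monom:
  "shift_quot (monom (1 / fact (2 * m + 1)) (2 * m + 1)) z =
    (\<Sum>q\<le>m. of_real ((- 1) ^ q * (2 * pi) ^ (2 * q) / fact (2 * q + 1)) * (z ^ (2 * (m - q)) / fact (2 * (m - q))))"
proof -
  define w where "w = 2 * of_real pi * \<i>"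
  have w: "w \<noteq> 0" "4 * of_real pi * \<i> = 2 * w" by (simp_all add: w_def)
  have w2: "w ^ (2 * q) = of_real ((- 1) ^ q * (2 * pi) ^ (2 * q))" for q
  proof -
    have "w\<^sup>2 = of_real (- ((2 * pi)\<^sup>2))" unfolding w_def by (simp add: power_mult_distrib)
    thus ?thesis
      by (simp only: power_mult of_real_power[symmetric] power_minus[of "(2 * pi)\<^sup>2"])
  qed
  have "shift_quot (monom (1 / fact (2 * m + 1)) (2 * m + 1)) z =
      1 / (2 * w) * ((1 / fact (2 * m + 1)) * ((z + w) ^ (2 * m + 1) - (z - w) ^ (2 * m + 1)))"
    unfolding shift_quot_def poly_monom w(2) w_def[symmetric] by (simp only: right_diff_distrib)
  also have "\<dots> = (\<Sum>q\<le>m. 1 / fact (2 * m + 1) * (of_nat (2 * m + 1 choose (2 * (m - q))) * w ^ (2 * q) * z ^ (2 * (m - q))))"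
    unfolding power_add_diff_odd using w(1) by (simp add: sum_distrib_left mult_ac del: binomial_Suc_Suc fact_Suc)
  also have "\<dots> = (\<Sum>q\<le>m. w ^ (2 * q) / fact (2 * q + 1) * (z ^ (2 * (m - q)) / fact (2 * (m - q))))"
  proof (rule sum.cong[OF refl])
    fix q assume q: "q \<in> {..m}"
    have e: "2 * m + 1 - 2 * (m - q) = 2 * q + 1" using q by auto
    have "of_nat (2 * m + 1 choose (2 * (m - q))) = (fact (2 * m + 1) / (fact (2 * (m - q)) * fact (2 * q + 1)) :: complex)"
      using binomial_fact[of "2 * (m - q)" "2 * m + 1", where 'a = complex] q unfolding e by simp
    thus "1 / fact (2 * m + 1) * (of_nat (2 * m + 1 choose (2 * (m - q))) * w ^ (2 * q) * z ^ (2 * (m - q))) =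
      w ^ (2 * q) / fact (2 * q + 1) * (z ^ (2 * (m - q)) / fact (2 * (m - q)))"
      by (simp del: fact_Suc binomial_Suc_Suc)
  qed
  finally show ?thesis unfolding w2 by simp
qed

text \<open>The odd polynomial with derivative \<open>kernel_poly k\<close>. Its terms are scaled as
  \<open>z^m / m!\<close>, on which differentiation merely lowers \<open>m\<close>.\<close>

definition primitive_poly :: "nat \<Rightarrow> complex poly" where
  "primitive_poly k = (\<Sum>i\<le>Suc k. smult (of_real (csc_coeff i))
     (monom (1 / fact (2 * (Suc k - i) + 1)) (2 * (Suc k - i) + 1)))"

lemma pderiv_sum: "pderiv (\<Sum>a\<in>A. p a) = (\<Sum>a\<in>A. pderiv (p a))"
  by (induction A rule: infinite_finite_induct) (simp_all add: pderiv_add)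

lemma pderiv_primitive_poly: "poly (pderiv (primitive_poly k)) (of_real b) = of_real (kernel_poly k b)"
proof -
  have summand: "pderiv (monom (1 / fact (2 * m + 1)) (2 * m + 1)) = monom (1 / fact (2 * m) :: complex) (2 * m)" for m
    unfolding pderiv_monom by (simp add: fact_Suc del: of_nat_Suc)
  show ?thesis unfolding primitive_poly_def kernel_poly_def pderiv_sum pderiv_smult summand
    by (simp add: poly_sum poly_monom mult_ac del: sum.atMost_Suc)
qed

lemma primitive_poly_odd: "poly (primitive_poly k) (- z) = - poly (primitive_poly k) z"
  unfolding primitive_poly_def by (simp add: poly_sum poly_monom sum_negf[symmetric] del: sum.atMost_Suc)

text \<open>Collecting the terms with \<open>i + q = N\<close> gives the convolution of
  \<open>csc_coeff\<close> with the coefficients of the sine quotient. It is 0 for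
  \<open>N > 0\<close>, so the leading term alone remains.\<close>

lemma shift_quot_primitive_poly: "shift_quot (primitive_poly k) z = z ^ (2 * k + 2) / fact (2 * k + 2)"
proof -
  let ?K = "Suc k"
  define B where "B q = (- 1) ^ q * (2 * pi) ^ (2 * q) / fact (2 * q + 1)" for q
  define Z where "Z m = z ^ (2 * m) / fact (2 * m)" for m
  have "shift_quot (primitive_poly k) z = (\<Sum>i\<le>?K. \<Sum>q\<le>?K - i. of_real (csc_coeff i * B q) * Z (?K - (i + q)))"
    unfolding primitive_poly_def shift_quot_sum shift_quot_simps shift_quot_monom B_def Z_def
    by (simp add: sum_distrib_left mult.assoc del: sum.atMost_Suc fact_Suc)
  also have "\<dots> = (\<Sum>(i, q)\<in>{(i, q). i + q \<le> ?K}. of_real (csc_coeff i * B q) * Z (?K - (i + q)))"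
    by (subst sum.Sigma) (auto intro!: sum.cong)
  also have "\<dots> = (\<Sum>N\<le>?K. \<Sum>i\<le>N. of_real (csc_coeff i * B (N - i)) * Z (?K - (i + (N - i))))"
    by (rule sum.triangle_reindex_eq)
  also have "\<dots> = (\<Sum>N\<le>?K. of_real (\<Sum>i\<le>N. csc_coeff i * B (N - i)) * Z (?K - N))"
    by (simp add: sum_distrib_right of_real_sum del: sum.atMost_Suc)
  also have "\<dots> = (\<Sum>N\<le>?K. of_real (if N = 0 then 1 else 0) * Z (?K - N))"
    unfolding B_def csc_coeff_convolution ..
  also have "\<dots> = (\<Sum>N\<le>?K. if N = 0 then Z ?K else 0)"
    by (intro sum.cong) auto
  also have "\<dots> = Z ?K" by (simp add: sum.delta del: sum.atMost_Suc)
  finally show ?thesis by (simp add: Z_def)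
qed

text \<open>Both sides of one summand of the recursions (M) and (N), as functions of \<open>b > 0\<close>, come from a common polynomial \<open>p\<close>
  with \<open>p(0) = 0\<close>: the former is its derivative, the latter its shift quotient.\<close>

definition common_primitive :: "(real \<Rightarrow> complex) \<Rightarrow> (real \<Rightarrow> complex) \<Rightarrow> bool" where
  "common_primitive \<alpha> \<beta> \<longleftrightarrow> (\<exists>p. poly p 0 = 0 \<and>
     (\<forall>b>0. \<alpha> b = poly (pderiv p) (of_real b) \<and> \<beta> b = shift_quot p (of_real b)))"

lemma common_primitive_add:
  assumes "common_primitive \<alpha> \<beta>" "common_primitive \<alpha>' \<beta>'"
  shows "common_primitive (\<lambda>b. \<alpha> b + \<alpha>' b) (\<lambda>b. \<beta> b + \<beta>' b)"
proof -
  obtain p q where "poly p 0 = 0" "poly q 0 = 0"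
    "\<forall>b>0. \<alpha> b = poly (pderiv p) (of_real b) \<and> \<beta> b = shift_quot p (of_real b)"
    "\<forall>b>0. \<alpha>' b = poly (pderiv q) (of_real b) \<and> \<beta>' b = shift_quot q (of_real b)"
    using assms unfolding common_primitive_def by blast
  thus ?thesis unfolding common_primitive_def
    by (intro exI[of _ "p + q"]) (simp add: pderiv_add shift_quot_simps)
qed

lemma common_primitive_cmult:
  assumes "common_primitive \<alpha> \<beta>"
  shows "common_primitive (\<lambda>b. c * \<alpha> b) (\<lambda>b. c * \<beta> b)"
proof -
  obtain p where "poly p 0 = 0"
    "\<forall>b>0. \<alpha> b = poly (pderiv p) (of_real b) \<and> \<beta> b = shift_quot p (of_real b)"
    using assms unfolding common_primitive_def by blast
  thus ?thesis unfolding common_primitive_def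
    by (intro exI[of _ "smult c p"]) (simp add: pderiv_smult shift_quot_simps)
qed

lemma common_primitive_sum:
  "(\<And>a. a \<in> A \<Longrightarrow> common_primitive (\<alpha> a) (\<beta> a)) \<Longrightarrow>
    common_primitive (\<lambda>b. \<Sum>a\<in>A. \<alpha> a b) (\<lambda>b. \<Sum>a\<in>A. \<beta> a b)"
proof (induction A rule: infinite_finite_induct)
  case (insert a A)
  thus ?case using common_primitive_add[of "\<alpha> a" "\<beta> a"] by simp
qed (auto simp: common_primitive_def shift_quot_simps intro!: exI[of _ 0])

text \<open>The derivatives are polynomials that agree at all positive reals, hence coincide. The
  primitives then differ by a constant, which is 0 because both vanish at 0.\<close>

lemma common_primitive_unique:
  assumes "common_primitive \<alpha> \<beta>" "poly p 0 = 0" "\<And>b. 0 < b \<Longrightarrow> poly (pderiv p) (of_real b) = \<alpha> b" "0 < b"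
  shows "shift_quot p (of_real b) = \<beta> b"
proof -
  obtain q where q: "poly q 0 = 0"
    "\<forall>b>0. \<alpha> b = poly (pderiv q) (of_real b) \<and> \<beta> b = shift_quot q (of_real b)"
    using assms(1) unfolding common_primitive_def by blast
  have "pderiv (p - q) = 0"
  proof (rule ccontr)
    assume "pderiv (p - q) \<noteq> 0"
    hence "finite {z. poly (pderiv (p - q)) z = 0}" by (rule poly_roots_finite)
    moreover have "complex_of_real ` {0<..} \<subseteq> {z. poly (pderiv (p - q)) z = 0}"
      using assms(3) q(2) by (auto simp: pderiv_diff)
    moreover have "infinite (complex_of_real ` {0<..})"
      by (subst finite_image_iff) (auto simp: inj_on_def infinite_Ioi)
    ultimately show False by (metis finite_subset)
  qed
  then obtain c where c: "p - q = [:c:]" by (auto simp: pderiv_eq_0_iff elim: degree_eq_zeroE)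
  have "poly (p - q) 0 = 0" using assms(2) q(1) by simp
  hence "p = q" using c by simp
  thus ?thesis using q(2) assms(4) by simp
qed

text \<open>Translations commute with the derivative and with the shift quotient. The value at 0 of
  one translate need not be 0; oddness of \<open>primitive_poly\<close> makes the sum of the two
  vanish there.\<close>

lemma common_primitive_kernel:
  "common_primitive (\<lambda>b. of_real (kernel_poly k (b + r) + kernel_poly k (b - r)))
     (\<lambda>b. of_real (((b + r) ^ (2 * k + 2) + (b - r) ^ (2 * k + 2)) / fact (2 * k + 2)))"
proof -
  define p where "p = primitive_poly k \<circ>\<^sub>p [:of_real r, 1:] + primitive_poly k \<circ>\<^sub>p [:- of_real r, 1:]"
  have "poly p 0 = 0" unfolding p_def by (simp add: poly_pcompose primitive_poly_odd)
  moreover have "poly (pderiv p) (of_real b) = of_real (kernel_poly k (b + r) + kernel_poly k (b - r))" for b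
    using pderiv_primitive_poly[of k "b + r"] pderiv_primitive_poly[of k "b - r"]
    unfolding p_def by (simp add: pderiv_add pderiv_pcompose poly_pcompose pderiv_pCons add.commute)
  moreover have "shift_quot p (of_real b) = of_real (((b + r) ^ (2 * k + 2) + (b - r) ^ (2 * k + 2)) / fact (2 * k + 2))" for b
  proof -
    have "shift_quot (primitive_poly k \<circ>\<^sub>p [:s, 1:]) z = shift_quot (primitive_poly k) (z + s)" for s z
      by (simp add: shift_quot_def poly_pcompose algebra_simps)
    thus ?thesis unfolding p_def shift_quot_simps
      by (simp add: shift_quot_primitive_poly add_divide_distrib del: fact_Suc power_Suc)
  qed
  ultimately show ?thesis unfolding common_primitive_def by (intro exI[of _ p]) auto
qed

lemma common_primitive_kernel_0:
  "common_primitive (\<lambda>b. of_real (kernel_poly k b)) (\<lambda>b. of_real (b ^ (2 * k + 2) / fact (2 * k + 2)))"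
  using common_primitive_cmult[OF common_primitive_kernel[of k 0], of "1 / 2"]
  by (simp add: add_divide_distrib mult_2[symmetric])

lemma H_nonneg: "0 \<le> H x b"
  by (simp add: H_logistic logistic_nonneg)

lemma H_measurable[measurable]: "(\<lambda>x. H x b) \<in> borel_measurable borel"
  unfolding H_logistic by measurable

text \<open>With the factor \<open>x * y\<close> the exponents are \<open>2i+1\<close> and
  \<open>2j+1\<close>, and the substitution \<open>x + y = z\<close> leaves the moment of odd order
  \<open>2(i+j+1) + 1\<close>; hence the index \<open>k\<close>. The same factorials arise for (M)
  and for (N).\<close>

lemma common_primitive_double:
  fixes q :: "real \<Rightarrow> real \<Rightarrow> complex"
  assumes "finite A" "\<And>x y. q x y = (\<Sum>a\<in>A. of_real x ^ (2 * i a) * of_real y ^ (2 * j a) * c a)"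
  shows "common_primitive
    (\<lambda>b. LINT (x, y):{0..} \<times> {0..}|lborel. of_real (x * y * H (x + y) b) * q x y)
    (\<lambda>b. LINT (x, y):triangle b|lborel. of_real (x * y) * q x y)"
proof -
  define k where "k a = i a + j a + 1" for a
  define C where "C a = fact (2 * i a + 1) * fact (2 * j a + 1) * c a" for a
  have "common_primitive (\<lambda>b. \<Sum>a\<in>A. C a * of_real (kernel_poly (k a) b))
      (\<lambda>b. \<Sum>a\<in>A. C a * of_real (b ^ (2 * k a + 2) / fact (2 * k a + 2)))"
    by (intro common_primitive_sum common_primitive_cmult common_primitive_kernel_0)
  moreover have "(LINT (x, y):{0..} \<times> {0..}|lborel. of_real (x * y * H (x + y) b) * q x y) =
      (\<Sum>a\<in>A. C a * of_real (kernel_poly (k a) b))" for b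
  proof -
    let ?w = "\<lambda>z a. (case z of (x, y) \<Rightarrow> (x :: real) ^ (2 * i a + 1) * y ^ (2 * j a + 1) * H (x + y) b)"
    let ?I = "\<lambda>a. fact (2 * i a + 1) * fact (2 * j a + 1) * kernel_poly (k a) b"
    have "(LINT z:{0..} \<times> {0..}|lborel. (\<Sum>a\<in>A. of_real (?w z a) * c a)) = (\<Sum>a\<in>A. of_real (?I a) * c a)"
    proof (rule set_lebesgue_integral_weighted_sum)
      fix a
      have e: "2 * i a + 1 + (2 * j a + 1) + 1 = 2 * k a + 1" by (simp add: k_def)
      show "has_bochner_integral lborel (\<lambda>z. indicator ({0..} \<times> {0..}) z * ?w z a) (?I a)"
        using has_bochner_integral_simplex[of "\<lambda>z. H z b" "2 * i a + 1" "2 * j a + 1", unfolded e,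
            OF H_nonneg H_measurable has_bochner_integral_H[of "k a" b]]
        by (simp add: split_beta' mult.assoc del: fact_Suc power_Suc)
    qed
    moreover have "(\<Sum>a\<in>A. of_real (?w z a) * c a) = (case z of (x, y) \<Rightarrow> of_real (x * y * H (x + y) b) * q x y)" for z
      by (cases z) (simp add: assms(2) sum_distrib_left mult_ac)
    ultimately show ?thesis by (simp add: C_def mult_ac del: fact_Suc)
  qed
  moreover have "(LINT (x, y):triangle b|lborel. of_real (x * y) * q x y) =
      (\<Sum>a\<in>A. C a * of_real (b ^ (2 * k a + 2) / fact (2 * k a + 2)))" if "0 < b" for b
  proof -
    let ?T = "triangle b"
    let ?w = "\<lambda>z a. (case z of (x, y) \<Rightarrow> (x :: real) ^ (2 * i a + 1) * y ^ (2 * j a + 1))"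
    let ?I = "\<lambda>a. fact (2 * i a + 1) * fact (2 * j a + 1) / fact (2 * k a + 2) * b ^ (2 * k a + 2)"
    have "(LINT z:?T|lborel. (\<Sum>a\<in>A. of_real (?w z a) * c a)) = (\<Sum>a\<in>A. of_real (?I a) * c a)"
    proof (rule set_lebesgue_integral_weighted_sum)
      fix a
      have e: "2 * i a + 1 + (2 * j a + 1) + 2 = 2 * k a + 2" by (simp add: k_def)
      show "has_bochner_integral lborel (\<lambda>z. indicator ?T z * ?w z a) (?I a)"
        using has_bochner_integral_triangle[of b "2 * i a + 1" "2 * j a + 1"] that unfolding e
        by (simp add: split_beta' del: fact_Suc power_Suc)
    qed
    moreover have "(\<Sum>a\<in>A. of_real (?w z a) * c a) = (case z of (x, y) \<Rightarrow> of_real (x * y) * q x y)" for z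
      by (cases z) (simp add: assms(2) sum_distrib_left mult_ac)
    ultimately show ?thesis by (simp add: C_def mult_ac del: fact_Suc power_Suc)
  qed
  ultimately show ?thesis unfolding common_primitive_def by simp
qed

text \<open>The number \<open>b - r\<close> may be negative. \<open>has_bochner_integral_H\<close>
  holds for either sign and the interval integral is oriented, so the same polynomials describe
  \<open>b < r\<close> and \<open>b > r\<close>.\<close>

lemma common_primitive_single:
  fixes f :: "real \<Rightarrow> complex"
  assumes "\<And>x. f x = (\<Sum>a\<in>A. of_real x ^ (2 * i a) * c a)"
  shows "common_primitive
    (\<lambda>b. LINT x:{0..}|lborel. of_real (x * (H x (b + r) + H x (b - r))) * f x)
    (\<lambda>b. (LBINT x=0..ereal (b + r). of_real x * f x) + (LBINT x=0..ereal (b - r). of_real x * f x))"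
proof -
  define C where "C a = fact (2 * i a + 1) * c a" for a
  have "common_primitive (\<lambda>b. \<Sum>a\<in>A. C a * of_real (kernel_poly (i a) (b + r) + kernel_poly (i a) (b - r)))
      (\<lambda>b. \<Sum>a\<in>A. C a * of_real (((b + r) ^ (2 * i a + 2) + (b - r) ^ (2 * i a + 2)) / fact (2 * i a + 2)))"
    by (intro common_primitive_sum common_primitive_cmult common_primitive_kernel)
  moreover have "(LINT x:{0..}|lborel. of_real (x * (H x (b + r) + H x (b - r))) * f x) =
      (\<Sum>a\<in>A. C a * of_real (kernel_poly (i a) (b + r) + kernel_poly (i a) (b - r)))" for b
  proof -
    let ?w = "\<lambda>x a. x ^ (2 * i a + 1) * H x (b + r) + x ^ (2 * i a + 1) * H x (b - r)"
    let ?I = "\<lambda>a. fact (2 * i a + 1) * kernel_poly (i a) (b + r) + fact (2 * i a + 1) * kernel_poly (i a) (b - r)"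
    have "(LINT x:{0..}|lborel. (\<Sum>a\<in>A. of_real (?w x a) * c a)) = (\<Sum>a\<in>A. of_real (?I a) * c a)"
      using has_bochner_integral_add[OF has_bochner_integral_H has_bochner_integral_H]
      by (intro set_lebesgue_integral_weighted_sum) (simp only: distrib_left)
    moreover have "(\<Sum>a\<in>A. of_real (?w x a) * c a) = of_real (x * (H x (b + r) + H x (b - r))) * f x" for x
      by (simp add: assms sum_distrib_left sum.distrib algebra_simps)
    ultimately show ?thesis by (simp add: C_def algebra_simps del: fact_Suc)
  qed
  moreover have "(LBINT x=0..ereal (b + r). of_real x * f x) + (LBINT x=0..ereal (b - r). of_real x * f x) =
      (\<Sum>a\<in>A. C a * of_real (((b + r) ^ (2 * i a + 2) + (b - r) ^ (2 * i a + 2)) / fact (2 * i a + 2)))" for b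
  proof -
    have "fact (2 * n + 1) / fact (2 * n + 2) = (1 / of_nat (2 * n + 2) :: complex)" for n
    proof -
      have e: "2 * n + 2 = Suc (2 * n + 1)" by simp
      show ?thesis unfolding e fact_Suc[of "2 * n + 1"] by (simp del: fact_Suc of_nat_Suc)
    qed
    hence summand: "C a * of_real (s / fact (2 * i a + 2)) = of_real s / of_nat (2 * i a + 2) * c a" for a s
      unfolding C_def by (simp add: field_simps del: fact_Suc of_nat_add of_nat_mult)
    show ?thesis unfolding assms interval_integral_odd_sum summand
      by (simp only: sum.distrib[symmetric] of_real_add of_real_diff of_real_power add_divide_distrib distrib_right)
  qed
  ultimately show ?thesis by simp
qed

section \<open>Even expansions of the volumes\<close>

lemma stab_volume_even:
  assumes V: "volume_family V" and "i < length bs"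
  shows "stab V g (bs[i := - (bs ! i)]) = stab V g bs"
proof (cases "0 \<le> g \<and> 0 < 2 * g - 2 + int (length bs)")
  case True
  have "\<forall>cs i. length cs = length bs \<and> i < length bs \<longrightarrow> V (nat g) (cs[i := - (cs ! i)]) = V (nat g) cs"
    by (rule volume_familyD(3)[OF V]) (use True assms(2) in auto)
  thus ?thesis using assms(2) by (simp add: stab_def)
qed (auto simp: stab_def)

text \<open>Averaging over \<open>x\<close> and \<open>- x\<close> removes the odd powers. The
  transform appears only because the expansion in the first variable is taken from
  \<open>has_laplace_ConsE\<close>.\<close>

lemma stab_volume_Cons:
  assumes V: "volume_family V"
  obtains K :: "nat set" and c where "finite K"
    "\<And>x. stab V g (x # bs) = (\<Sum>k\<in>K. x ^ (2 * (k div 2)) * c k)"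
proof -
  obtain d f' F' where "laplace_Cons_rep (length bs) (stab V g) (stab (laplace_transform V) g) d f' F'"
    by (rule has_laplace_ConsE[OF has_laplace_stab_volume[OF V, of "Suc (length bs)" g]]) auto
  note * = laplace_Cons_repD[OF this]
  show ?thesis
  proof (rule that[of "{k. k \<le> d \<and> even k}" "\<lambda>k. f' k bs"])
    fix x
    have "stab V g (x # bs) = (stab V g (x # bs) + stab V g ((- x) # bs)) / 2"
      using stab_volume_even[OF V, of 0 "x # bs" g] by simp
    also have "\<dots> = (\<Sum>k\<le>d. (x ^ k + (- x) ^ k) / 2 * f' k bs)"
      by (simp add: *(2) sum.distrib[symmetric] sum_divide_distrib add_divide_distrib distrib_right)
    also have "\<dots> = (\<Sum>k\<in>{k. k \<le> d \<and> even k}. x ^ k * f' k bs)"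
      by (rule sum.mono_neutral_cong_right) (auto simp: power_minus_odd)
    also have "\<dots> = (\<Sum>k\<in>{k. k \<le> d \<and> even k}. x ^ (2 * (k div 2)) * f' k bs)"
      by (intro sum.cong) auto
    finally show "stab V g (x # bs) = \<dots>" .
  qed auto
qed

text \<open>The average over the four choices of signs for \<open>x\<close> and \<open>y\<close>
  retains exactly the monomials that are even in both.\<close>

lemma stab_volume_Cons_Cons:
  assumes V: "volume_family V"
  obtains S :: "(nat \<Rightarrow> nat) set" and c where "finite S"
    "\<And>x y. stab V g (x # y # bs) = (\<Sum>e\<in>S. x ^ (2 * (e 0 div 2)) * y ^ (2 * (e 1 div 2)) * c e)"
proof -
  obtain S :: "(nat \<Rightarrow> nat) set" and f F where S: "finite S" "\<And>e. has_laplace (length bs) (f e) (F e)"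
    "\<And>x y xs. length xs = length bs \<Longrightarrow> stab V g (x # y # xs) = (\<Sum>e\<in>S. x ^ e 0 * y ^ e 1 * f e xs)"
    by (rule has_laplace_ConsConsE[OF has_laplace_stab_volume[OF V, of "Suc (Suc (length bs))" g]]) auto
  let ?T = "{e \<in> S. even (e 0) \<and> even (e 1)}"
  show ?thesis
  proof (rule that[of ?T "\<lambda>e. f e bs"])
    have even: "even k" if "x ^ k + (- x) ^ k \<noteq> 0" for x :: complex and k
      using that power_minus_odd[of k x] by (cases "even k") auto
    fix x y
    have "stab V g (x # y # bs) = (stab V g (x # y # bs) + stab V g ((- x) # y # bs)
        + stab V g (x # (- y) # bs) + stab V g ((- x) # (- y) # bs)) / 4"
      using stab_volume_even[OF V, of 0 "x # y # bs" g] stab_volume_even[OF V, of 1 "x # y # bs" g]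
        stab_volume_even[OF V, of 0 "x # (- y) # bs" g] by simp
    also have "\<dots> = (\<Sum>e\<in>S. (x ^ e 0 + (- x) ^ e 0) * (y ^ e 1 + (- y) ^ e 1) / 4 * f e bs)"
      by (simp add: S(3) sum.distrib[symmetric] sum_divide_distrib algebra_simps add_divide_distrib)
    also have "\<dots> = (\<Sum>e\<in>?T. x ^ e 0 * y ^ e 1 * f e bs)"
      by (rule sum.mono_neutral_cong_right) (use S(1) in \<open>auto dest: even\<close>)
    also have "\<dots> = (\<Sum>e\<in>?T. x ^ (2 * (e 0 div 2)) * y ^ (2 * (e 1 div 2)) * f e bs)"
      by (intro sum.cong) auto
    finally show "stab V g (x # y # bs) = \<dots>" .
  qed (use S(1) in auto)
qed

text \<open>The comparison is made summand by summand for one fixed pair \<open>g\<close>,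
  \<open>n\<close>: evenness of the volumes on the right-hand side ensures that only odd moments of
  \<open>H\<close> occur.\<close>

lemma recursion_M_imp_N:
  assumes V: "volume_family V" and n: "1 \<le> n" "2 \<le> 2 * int g - 2 + int n" and M: "recursion_M V g n"
  shows "recursion_N V g n"
proof -
  define m where "m = n - 1"
  have nm: "n = Suc m" using n(1) by (simp add: m_def)
  let ?S = "{(g1, g2). g1 + g2 = g}"
  show ?thesis unfolding recursion_N_def Let_def
  proof (intro allI impI, elim conjE, goal_cases)
    case (1 b rs)
    hence b: "0 < b" and rs: "\<forall>r\<in>set rs. 0 < r" "length rs = m" using nm by auto
    define bs where "bs = map complex_of_real rs"
    obtain F where "has_laplace (Suc m) (V g) F"
      using has_laplace_volume[OF V n(1), of g] n(2) nm by auto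
    then obtain d f' F' where "laplace_Cons_rep m (V g) F d f' F'"
      by (rule has_laplace_ConsE)
    note f' = laplace_Cons_repD[OF this]
    \<comment> \<open>The polynomial \<open>b * V\<close>. It vanishes at 0, which singles it out
      among the primitives of the right-hand side of (M).\<close>
    define W where "W = (\<Sum>k\<le>d. monom (f' k bs) (Suc k))"
    have W: "poly W z = z * V g (z # bs)" for z
      using f'(2)[of bs z] rs(2) unfolding W_def bs_def by (simp add: poly_sum poly_monom sum_distrib_left mult_ac)
    define \<alpha>1 where "\<alpha>1 b = (LINT (x, y):{0..} \<times> {0..}|lborel.
      of_real (x * y * H (x + y) b) * stab V (int g - 1) (of_real x # of_real y # bs))" for b
    define \<beta>1 where "\<beta>1 b = (LINT (x, y):triangle b|lborel.
      of_real (x * y) * stab V (int g - 1) (of_real x # of_real y # bs))" for b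
    define \<alpha>2 where "\<alpha>2 p r b = (LINT (x, y):{0..} \<times> {0..}|lborel. of_real (x * y * H (x + y) b) *
      (stab V (int (fst p)) (of_real x # nths bs (fst r)) * stab V (int (snd p)) (of_real y # nths bs (snd r))))"
      for p r b
    define \<beta>2 where "\<beta>2 p r b = (LINT (x, y):triangle b|lborel. of_real (x * y) *
      (stab V (int (fst p)) (of_real x # nths bs (fst r)) * stab V (int (snd p)) (of_real y # nths bs (snd r))))"
      for p r b
    define \<alpha>3 where "\<alpha>3 j b = (LINT x:{0..}|lborel.
      of_real (x * (H x (b + rs ! j) + H x (b - rs ! j))) * stab V (int g) (of_real x # remove_at j bs))" for j b
    define \<beta>3 where "\<beta>3 j b =
      (LBINT x=0..ereal (b + rs ! j). of_real x * stab V (int g) (of_real x # remove_at j bs))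
      + (LBINT x=0..ereal (b - rs ! j). of_real x * stab V (int g) (of_real x # remove_at j bs))" for j b
    have cp1: "common_primitive \<alpha>1 \<beta>1"
    proof -
      obtain S :: "(nat \<Rightarrow> nat) set" and c where "finite S"
        "\<And>x y. stab V (int g - 1) (x # y # bs) = (\<Sum>e\<in>S. x ^ (2 * (e 0 div 2)) * y ^ (2 * (e 1 div 2)) * c e)"
        by (rule stab_volume_Cons_Cons[OF V]) auto
      thus ?thesis unfolding \<alpha>1_def[abs_def] \<beta>1_def[abs_def] by (rule common_primitive_double)
    qed
    have cp2: "common_primitive (\<alpha>2 p r) (\<beta>2 p r)" for p r
    proof -
      obtain K c where K: "finite (K :: nat set)"
        "\<And>x. stab V (int (fst p)) (x # nths bs (fst r)) = (\<Sum>k\<in>K. x ^ (2 * (k div 2)) * c k)"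
        by (rule stab_volume_Cons[OF V]) auto
      obtain L d where L: "finite (L :: nat set)"
        "\<And>x. stab V (int (snd p)) (x # nths bs (snd r)) = (\<Sum>k\<in>L. x ^ (2 * (k div 2)) * d k)"
        by (rule stab_volume_Cons[OF V]) auto
      show ?thesis unfolding \<alpha>2_def[abs_def] \<beta>2_def[abs_def]
      proof (rule common_primitive_double[of "K \<times> L" _ "\<lambda>a. fst a div 2" "\<lambda>a. snd a div 2" "\<lambda>a. c (fst a) * d (snd a)"])
        show "stab V (int (fst p)) (of_real x # nths bs (fst r)) * stab V (int (snd p)) (of_real y # nths bs (snd r)) =
          (\<Sum>a\<in>K \<times> L. of_real x ^ (2 * (fst a div 2)) * of_real y ^ (2 * (snd a div 2)) * (c (fst a) * d (snd a)))" for x y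
          unfolding K(2) L(2) sum_product sum.cartesian_product by (simp add: case_prod_beta mult_ac)
      qed (use K L in auto)
    qed
    have cp3: "common_primitive (\<alpha>3 j) (\<beta>3 j)" for j
    proof -
      obtain K c where K: "finite (K :: nat set)"
        "\<And>x. stab V (int g) (x # remove_at j bs) = (\<Sum>k\<in>K. x ^ (2 * (k div 2)) * c k)"
        by (rule stab_volume_Cons[OF V]) auto
      show ?thesis unfolding \<alpha>3_def[abs_def] \<beta>3_def[abs_def]
        by (rule common_primitive_single) (rule K(2))
    qed
    have cp: "common_primitive (\<lambda>b. 1/2 * \<alpha>1 b + 1/2 * (\<Sum>p\<in>?S. \<Sum>r\<in>partitions m. \<alpha>2 p r b) + 1/2 * (\<Sum>j<m. \<alpha>3 j b))
        (\<lambda>b. 1/2 * \<beta>1 b + 1/2 * (\<Sum>p\<in>?S. \<Sum>r\<in>partitions m. \<beta>2 p r b) + 1/2 * (\<Sum>j<m. \<beta>3 j b))"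
      by (intro common_primitive_add common_primitive_cmult common_primitive_sum cp1 cp2 cp3)
    have "shift_quot W (of_real b) = 1/2 * \<beta>1 b + 1/2 * (\<Sum>p\<in>?S. \<Sum>r\<in>partitions m. \<beta>2 p r b) + 1/2 * (\<Sum>j<m. \<beta>3 j b)"
    proof (rule common_primitive_unique[OF cp _ _ b])
      show "poly W 0 = 0" by (simp add: W)
      fix b :: real assume b: "0 < b"
      have "deriv (\<lambda>z. z * V g (z # bs)) (of_real b) = poly (pderiv W) (of_real b)"
        unfolding W[symmetric] by (intro DERIV_imp_deriv poly_DERIV)
      moreover have "deriv (\<lambda>z. z * V g (z # bs)) (of_real b) =
          1/2 * \<alpha>1 b + 1/2 * (\<Sum>p\<in>?S. \<Sum>r\<in>partitions m. \<alpha>2 p r b) + 1/2 * (\<Sum>j<m. \<alpha>3 j b)"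
        using M[unfolded recursion_M_def Let_def, rule_format, of b rs] b rs nm
        unfolding bs_def[symmetric] \<alpha>1_def \<alpha>2_def \<alpha>3_def
        by (simp only: case_prod_unfold mult.assoc diff_Suc_1) simp
      ultimately show "poly (pderiv W) (of_real b) =
          1/2 * \<alpha>1 b + 1/2 * (\<Sum>p\<in>?S. \<Sum>r\<in>partitions m. \<alpha>2 p r b) + 1/2 * (\<Sum>j<m. \<alpha>3 j b)" by simp
    qed
    thus ?case unfolding shift_quot_def W \<beta>1_def \<beta>2_def \<beta>3_def bs_def
      by (simp only: nm diff_Suc_1 case_prod_unfold mult.assoc)
  qed
qed

theorem theorem1p5:
  fixes g n :: nat
  assumes "1 \<le> n" and "2 \<le> 2 * int g - 2 + int n"
  shows "(\<forall>V. volume_family V \<and> recursion_M V g n \<longrightarrow> recursion_A (laplace_transform V) g n)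
       \<and> (\<forall>V. volume_family V \<and> recursion_N V g n \<longrightarrow> recursion_B (laplace_transform V) g n)
       \<and> (\<forall>F. odd_inv_poly_family F \<longrightarrow> (recursion_A F g n \<longleftrightarrow> recursion_B F g n))"
proof -
  have AB: "recursion_A F g n \<longleftrightarrow> recursion_B F g n" if "odd_inv_poly_family F" for F
    by (rule recursion_A_iff_B[OF that assms(1)]) (use assms(2) in simp)
  have NB: "recursion_B (laplace_transform V) g n" if "volume_family V" "recursion_N V g n" for V
    by (rule recursion_N_imp_B[OF that(1) assms that(2)])
  have "recursion_A (laplace_transform V) g n" if "volume_family V" "recursion_M V g n" for V
    using AB[OF odd_inv_poly_laplace_transform[OF that(1)]] NB[OF that(1) recursion_M_imp_N[OF that(1) assms that(2)]]
    by simp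
  thus ?thesis using AB NB by blast
qed

end
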